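(* Let $A$ and $B$ be $\sigma$-unital $C^*$-algebras, let $(\mathcal{A},E,D)$ be a half-closed chain from $A$ to $B$ with left action $\phi : A \to \mathbb{L}(E)$, let $x \in \mathcal{A}$ and put $\Delta := xx^*$. Then the triple $(E_x, D_x, \phi_x(\Delta))$ is an unbounded modular cycle from $\mathcal{A}_x$ to $B$ of the same parity as $(\mathcal{A},E,D)$, and with grading operator $\gamma|_{E_x} : E_x \to E_x$ in the even case (where $\gamma$ is the grading operator on $E$).
   Context: $\mathbb{L}(E)$ and $\mathbb{K}(E)$ denote the bounded adjointable and the compact operators on a Hilbert $C^*$-module $E$. A $C^*$-correspondence from $A$ to $B$ is a Hilbert $C^*$-module over $B$ with a $*$-homomorphism $A \to \mathbb{L}(E)$ (often suppressed from the notation). A closed, densely defined unbounded operator $D : \operatorname{Dom}(D) \to E$ is regular when $D^*$ is densely defined and $1 + D^*D : \operatorname{Dom}(D^*D)\to E$ has dense range. A half-closed chain from $A$ to $B$ is a triple $(\mathcal{A},E,D)$ where $\mathcal{A} \subseteq A$ is a norm-dense $*$-subalgebra, $E$ is a countably generated $C^*$-correspondence from $A$ to $B$ and $D : \operatorname{Dom}(D) \to E$ is a closed, symmetric and regular unbounded operator such that: (1) $a (1 + D^*D)^{-1} \in \mathbb{K}(E)$ for all $a \in A$; (2) $a(\operatorname{Dom}(D^* )) \subseteq \operatorname{Dom}(D)$ for all $a \in \mathcal{A}$; (3) $[D,a] : \operatorname{Dom}(D) \to E$ extends to a bounded operator $d(a) : E \to E$ for all $a \in \mathcal{A}$. It is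 even when $E$ carries a grading operator $\gamma : E \to E$ ($\gamma = \gamma^*$, $\gamma^2 = 1$) with $[a,\gamma]=0$ for all $a \in A$ and $D\gamma = -\gamma D$; otherwise it is odd. Localization: $E_x \subseteq E$ is the norm closure of $\operatorname{Im}(\phi(x))$; $D_x : \operatorname{Dom}(D_x) \to E_x$ is the closure of the symmetric unbounded operator $\phi(x) D \phi(x^* ) : \operatorname{Dom}(D) \cap E_x \to E_x$; $A_x := \operatorname{cl}(xAx^* ) \subseteq A$ (norm closure, a hereditary $C^*$-subalgebra); $\mathcal{A}_x := \mathcal{A} \cap A_x$, a norm-dense $*$-subalgebra of $A_x$; $\phi_x : A_x \to \mathbb{L}(E_x)$ is the restriction of $\phi$, making $E_x$ a $C^*$-correspondence from $A_x$ to $B$. Note that $\Delta \in A_x$. Unbounded modular cycle: for a $C^*$-algebra $A$ with dense $*$-subalgebra $\mathcal{A}$, an unbounded modular cycle from $\mathcal{A}$ to $B$ is a triple $(E,D,\Delta)$ where $E$ is a countably generated $C^*$-correspondence from $A$ to $B$, $D : \operatorname{Dom}(D) \to E$ is a selfadjoint and regular unbounded operator, and $\Delta : E \to E$ is a bounded positive selfadjoint operator with norm-dense image such that: (1) $a(i + D)^{-1} : E \to E$ is compact for all $a \in A$; (2) for all $a \in \mathcal{A}$, $\lambda \in \mathbb{C}$, the operator $(a+\lambda)\Delta$ has $\operatorname{Dom}(D)$ as an invariant submodule and $D(a+\lambda)\Delta - \Delta(a+\lambda)D : \operatorname{Dom}(D) \to E$ extends to a bounded adjointable operator $d_\Delta(a,\lambda)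 : E \to E$; (3) $\sup_{\varepsilon > 0} \| (\Delta^{1/2} + \varepsilon)^{-1} d_\Delta(a,\lambda) (\Delta^{1/2}+\varepsilon)^{-1}\|_\infty < \infty$ (operator norm) for all $a \in \mathcal{A}$, $\lambda \in \mathbb{C}$; (4) $\Delta(\Delta + 1/n)^{-1}a$ converges in operator norm to $a$ as $n \to \infty$, for all $a \in A$. It is even when $E$ carries a grading operator $\gamma$ ($\gamma = \gamma^*$, $\gamma^2 = 1$) with $[a,\gamma]=0$ for all $a\in A$ and $D\gamma = -\gamma D$; otherwise it is odd. *)

theory Defs
  imports "HOL-Analysis.Analysis"
begin

section \<open>C*-algebras\<close>

class complex_normed_vector = real_normed_vector +
  fixes scaleC :: "complex \<Rightarrow> 'a \<Rightarrow> 'a"  (infixr \<open>*\<^sub>C\<close> 75)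
  assumes scaleC_add_right: "c *\<^sub>C (x + y) = c *\<^sub>C x + c *\<^sub>C y"
    and scaleC_add_left: "(c + d) *\<^sub>C x = c *\<^sub>C x + d *\<^sub>C x"
    and scaleC_scaleC: "c *\<^sub>C d *\<^sub>C x = (c * d) *\<^sub>C x"
    and scaleR_scaleC: "r *\<^sub>R x = complex_of_real r *\<^sub>C x"
    and norm_scaleC: "norm (c *\<^sub>C x) = cmod c * norm x"

text \<open>Not necessarily unital.\<close>

class cstar_algebra = complex_normed_vector + real_normed_algebra + banach +
  fixes star :: "'a \<Rightarrow> 'a"
  assumes mult_scaleC_left: "(c *\<^sub>C x) * y = c *\<^sub>C (x * y)"
    and mult_scaleC_right: "x * (c *\<^sub>C y) = c *\<^sub>C (x * y)"
    and star_star: "star (star x) = x"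
    and star_add: "star (x + y) = star x + star y"
    and star_scaleC: "star (c *\<^sub>C x) = cnj c *\<^sub>C star x"
    and star_mult: "star (x * y) = star y * star x"
    and cstar_identity: "norm (star x * x) = (norm x)\<^sup>2"

text \<open>
  The algebra acting from the left is a closed *-subalgebra of a type of class
  \<open>cstar_algebra\<close> (possibly the whole type), so that hereditary subalgebras of it
  can be treated on the same footing. The coefficient algebra is always a whole type.
\<close>

definition star_subalgebra :: "'a::cstar_algebra set \<Rightarrow> bool" where
  "star_subalgebra A \<longleftrightarrow> 0 \<in> A \<and> (\<forall>a\<in>A. star a \<in> A \<and> (\<forall>c. c *\<^sub>C a \<in> A)) \<and>
     (\<forall>a\<in>A. \<forall>b\<in>A. a + b \<in> A \<and> a * b \<in> A)"

definition cstar_subalgebra :: "'a::cstar_algebra set \<Rightarrow> bool" where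
  "cstar_subalgebra A \<longleftrightarrow> star_subalgebra A \<and> closed A"

definition dense_star_subalgebra :: "'a::cstar_algebra set \<Rightarrow> 'a set \<Rightarrow> bool" where
  "dense_star_subalgebra \<A> A \<longleftrightarrow> star_subalgebra \<A> \<and> \<A> \<subseteq> A \<and> A \<subseteq> closure \<A>"

definition positive_in :: "'a::cstar_algebra set \<Rightarrow> 'a \<Rightarrow> bool" where
  "positive_in A a \<longleftrightarrow> (\<exists>b\<in>A. a = star b * b)"

definition sigma_unital :: "'a::cstar_algebra set \<Rightarrow> bool" where
  "sigma_unital A \<longleftrightarrow> (\<exists>u :: nat \<Rightarrow> 'a.
     (\<forall>n. u n \<in> A \<and> positive_in A (u n) \<and> norm (u n) \<le> 1) \<and>
     (\<forall>a\<in>A. (\<lambda>n. u n * a) \<longlonglongrightarrow> a \<and> (\<lambda>n. a * u n) \<longlonglongrightarrow> a))"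

section \<open>Hilbert C*-modules\<close>

text \<open>
  The vector space structure and the norm are those of the ambient type; the
  module norm is tied to the inner product in \<open>hilbert_module\<close>. Everything below
  depends only on elements of the carrier, so closed submodules are obtained by
  shrinking the carrier.
\<close>

record ('e, 'b) module_data =
  hcarrier :: "'e set"
  hinner :: "'e \<Rightarrow> 'e \<Rightarrow> 'b"
  hact :: "'e \<Rightarrow> 'b \<Rightarrow> 'e"

definition submodule ::
  "('e::complex_normed_vector, 'b::cstar_algebra) module_data \<Rightarrow> 'e set \<Rightarrow> bool" where
  "submodule E M \<longleftrightarrow> M \<subseteq> hcarrier E \<and> 0 \<in> M \<and> (\<forall>u\<in>M. \<forall>v\<in>M. u + v \<in> M) \<and>
     (\<forall>u\<in>M. (\<forall>c. c *\<^sub>C u \<in> M) \<and> (\<forall>b. hact E u b \<in> M))"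

text \<open>The inner product is linear in its second variable.\<close>

definition hilbert_module ::
  "('e::complex_normed_vector, 'b::cstar_algebra) module_data \<Rightarrow> bool" where
  "hilbert_module E \<longleftrightarrow>
     submodule E (hcarrier E) \<and>
     (\<forall>u\<in>hcarrier E. \<forall>v\<in>hcarrier E. \<forall>b. hact E (u + v) b = hact E u b + hact E v b) \<and>
     (\<forall>u\<in>hcarrier E. \<forall>b b'. hact E u (b + b') = hact E u b + hact E u b' \<and>
        hact E u (b * b') = hact E (hact E u b) b') \<and>
     (\<forall>u\<in>hcarrier E. \<forall>b c. hact E (c *\<^sub>C u) b = c *\<^sub>C hact E u b \<and>
        hact E u (c *\<^sub>C b) = c *\<^sub>C hact E u b) \<and>
     (\<forall>u\<in>hcarrier E. \<forall>v\<in>hcarrier E. \<forall>w\<in>hcarrier E.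
        hinner E u (v + w) = hinner E u v + hinner E u w) \<and>
     (\<forall>u\<in>hcarrier E. \<forall>v\<in>hcarrier E.
        (\<forall>c. hinner E u (c *\<^sub>C v) = c *\<^sub>C hinner E u v) \<and>
        (\<forall>b. hinner E u (hact E v b) = hinner E u v * b) \<and>
        hinner E v u = star (hinner E u v)) \<and>
     (\<forall>u\<in>hcarrier E. positive_in UNIV (hinner E u u) \<and>
        norm u = sqrt (norm (hinner E u u))) \<and>
     complete (hcarrier E)"

definition countably_generated ::
  "('e::complex_normed_vector, 'b::cstar_algebra) module_data \<Rightarrow> bool" where
  "countably_generated E \<longleftrightarrow> (\<exists>S. countable S \<and> S \<subseteq> hcarrier E \<and>
     closure (submodule E hull S) = hcarrier E)"

subsection \<open>Bounded operators\<close>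

text \<open>
  Operators \<open>E \<rightarrow> E\<close> are functions on the ambient type of which only the values on
  the carrier matter.
\<close>

definition bounded_op ::
  "('e::complex_normed_vector, 'b::cstar_algebra) module_data \<Rightarrow> ('e \<Rightarrow> 'e) \<Rightarrow> bool" where
  "bounded_op E T \<longleftrightarrow> T \<in> hcarrier E \<rightarrow> hcarrier E \<and>
     (\<forall>u\<in>hcarrier E. \<forall>v\<in>hcarrier E. T (u + v) = T u + T v) \<and>
     (\<forall>u\<in>hcarrier E. (\<forall>c. T (c *\<^sub>C u) = c *\<^sub>C T u) \<and> (\<forall>b. T (hact E u b) = hact E (T u) b)) \<and>
     (\<exists>C. \<forall>u\<in>hcarrier E. norm (T u) \<le> C * norm u)"

definition adjointable ::
  "('e::complex_normed_vector, 'b::cstar_algebra) module_data \<Rightarrow> ('e \<Rightarrow> 'e) \<Rightarrow> bool" where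
  "adjointable E T \<longleftrightarrow> bounded_op E T \<and> (\<exists>S \<in> hcarrier E \<rightarrow> hcarrier E.
     \<forall>u\<in>hcarrier E. \<forall>v\<in>hcarrier E. hinner E (T u) v = hinner E u (S v))"

definition selfadjoint_op ::
  "('e::complex_normed_vector, 'b::cstar_algebra) module_data \<Rightarrow> ('e \<Rightarrow> 'e) \<Rightarrow> bool" where
  "selfadjoint_op E T \<longleftrightarrow> adjointable E T \<and>
     (\<forall>u\<in>hcarrier E. \<forall>v\<in>hcarrier E. hinner E (T u) v = hinner E u (T v))"

definition positive_op ::
  "('e::complex_normed_vector, 'b::cstar_algebra) module_data \<Rightarrow> ('e \<Rightarrow> 'e) \<Rightarrow> bool" where
  "positive_op E T \<longleftrightarrow> selfadjoint_op E T \<and>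
     (\<forall>u\<in>hcarrier E. positive_in UNIV (hinner E u (T u)))"

text \<open>The positive square root of a positive operator; it is unique on the carrier.\<close>

definition sqrt_op ::
  "('e::complex_normed_vector, 'b::cstar_algebra) module_data \<Rightarrow> ('e \<Rightarrow> 'e) \<Rightarrow> 'e \<Rightarrow> 'e" where
  "sqrt_op E T = (SOME S. positive_op E S \<and> (\<forall>u\<in>hcarrier E. S (S u) = T u))"

text \<open>\<open>(T + c)\<^sup>-\<^sup>1\<close>, for an operator \<open>T + c\<close> which is a bijection of the carrier.\<close>

definition resolvent_op ::
  "('e::complex_normed_vector, 'b::cstar_algebra) module_data \<Rightarrow> ('e \<Rightarrow> 'e) \<Rightarrow> real \<Rightarrow> 'e \<Rightarrow> 'e"
  where "resolvent_op E T c = inv_into (hcarrier E) (\<lambda>u. T u + c *\<^sub>R u)"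

definition op_norm ::
  "('e::complex_normed_vector, 'b::cstar_algebra) module_data \<Rightarrow> ('e \<Rightarrow> 'e) \<Rightarrow> real" where
  "op_norm E T = (SUP u\<in>{u \<in> hcarrier E. norm u \<le> 1}. norm (T u))"

text \<open>
  Linear combinations of the operators \<open>w \<mapsto> u\<langle>v,w\<rangle>\<close>; the scalar coefficients are
  absorbed into the vectors \<open>u\<close>.
\<close>

definition finite_rank_op ::
  "('e::complex_normed_vector, 'b::cstar_algebra) module_data \<Rightarrow> ('e \<Rightarrow> 'e) \<Rightarrow> bool" where
  "finite_rank_op E T \<longleftrightarrow> (\<exists>(n::nat) u v. (\<forall>i<n. u i \<in> hcarrier E \<and> v i \<in> hcarrier E) \<and>
     (\<forall>w\<in>hcarrier E. T w = (\<Sum>i<n. hact E (u i) (hinner E (v i) w))))"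

definition compact_op ::
  "('e::complex_normed_vector, 'b::cstar_algebra) module_data \<Rightarrow> ('e \<Rightarrow> 'e) \<Rightarrow> bool" where
  "compact_op E T \<longleftrightarrow> adjointable E T \<and>
     (\<forall>\<epsilon>>0. \<exists>F. finite_rank_op E F \<and> op_norm E (\<lambda>u. T u - F u) < \<epsilon>)"

subsection \<open>Unbounded operators\<close>

text \<open>
  An unbounded operator is represented by its graph, so \<open>Domain D\<close> is its domain,
  \<open>D O D'\<close> is the composite \<open>D' \<circ> D\<close> on its natural domain, and \<open>D\<inverse>\<close> is the inverse.
\<close>

definition unbounded_op ::
  "('e::complex_normed_vector, 'b::cstar_algebra) module_data \<Rightarrow> ('e \<times> 'e) set \<Rightarrow> bool" where
  "unbounded_op E D \<longleftrightarrow> D \<subseteq> hcarrier E \<times> hcarrier E \<and> single_valued D \<and> (0, 0) \<in> D \<and>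
     (\<forall>(u, v)\<in>D. \<forall>(u', v')\<in>D. (u + u', v + v') \<in> D) \<and>
     (\<forall>(u, v)\<in>D. (\<forall>c. (c *\<^sub>C u, c *\<^sub>C v) \<in> D) \<and> (\<forall>b. (hact E u b, hact E v b) \<in> D))"

definition app :: "('e \<times> 'e) set \<Rightarrow> 'e \<Rightarrow> 'e" where
  "app D u = (THE v. (u, v) \<in> D)"

definition op_graph :: "('e, 'b) module_data \<Rightarrow> ('e \<Rightarrow> 'e) \<Rightarrow> ('e \<times> 'e) set" where
  "op_graph E T = {(u, T u) | u. u \<in> hcarrier E}"

text \<open>The graph of \<open>c + D\<close>.\<close>

definition shift :: "complex \<Rightarrow> ('e::complex_normed_vector \<times> 'e) set \<Rightarrow> ('e \<times> 'e) set" where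
  "shift c D = {(u, c *\<^sub>C u + v) | u v. (u, v) \<in> D}"

definition adjoint_graph ::
  "('e::complex_normed_vector, 'b::cstar_algebra) module_data \<Rightarrow> ('e \<times> 'e) set \<Rightarrow> ('e \<times> 'e) set"
  where "adjoint_graph E D = {(y, z). y \<in> hcarrier E \<and> z \<in> hcarrier E \<and>
     (\<forall>(u, v)\<in>D. hinner E v y = hinner E u z)}"

definition densely_defined ::
  "('e::complex_normed_vector, 'b::cstar_algebra) module_data \<Rightarrow> ('e \<times> 'e) set \<Rightarrow> bool" where
  "densely_defined E D \<longleftrightarrow> closure (Domain D) = hcarrier E"

definition symmetric_op ::
  "('e::complex_normed_vector, 'b::cstar_algebra) module_data \<Rightarrow> ('e \<times> 'e) set \<Rightarrow> bool" where
  "symmetric_op E D \<longleftrightarrow> D \<subseteq> adjoint_graph E D"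

definition selfadjoint_unbounded ::
  "('e::complex_normed_vector, 'b::cstar_algebra) module_data \<Rightarrow> ('e \<times> 'e) set \<Rightarrow> bool" where
  "selfadjoint_unbounded E D \<longleftrightarrow> D = adjoint_graph E D"

definition regular_op ::
  "('e::complex_normed_vector, 'b::cstar_algebra) module_data \<Rightarrow> ('e \<times> 'e) set \<Rightarrow> bool" where
  "regular_op E D \<longleftrightarrow> unbounded_op E D \<and> closed D \<and> densely_defined E D \<and>
     densely_defined E (adjoint_graph E D) \<and>
     closure (Range (shift 1 (D O adjoint_graph E D))) = hcarrier E"

text \<open>The graph is that of an everywhere defined compact operator.\<close>

definition compact_graph ::
  "('e::complex_normed_vector, 'b::cstar_algebra) module_data \<Rightarrow> ('e \<times> 'e) set \<Rightarrow> bool" where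
  "compact_graph E G \<longleftrightarrow> (\<exists>T. compact_op E T \<and> G = op_graph E T)"

section \<open>Correspondences and gradings\<close>

definition correspondence :: "'a::cstar_algebra set \<Rightarrow>
    ('e::complex_normed_vector, 'b::cstar_algebra) module_data \<Rightarrow> ('a \<Rightarrow> 'e \<Rightarrow> 'e) \<Rightarrow> bool" where
  "correspondence A E \<phi> \<longleftrightarrow> hilbert_module E \<and>
     (\<forall>a\<in>A. adjointable E (\<phi> a)) \<and>
     (\<forall>a\<in>A. \<forall>b\<in>A. \<forall>u\<in>hcarrier E. \<phi> (a + b) u = \<phi> a u + \<phi> b u \<and> \<phi> (a * b) u = \<phi> a (\<phi> b u)) \<and>
     (\<forall>a\<in>A. \<forall>c. \<forall>u\<in>hcarrier E. \<phi> (c *\<^sub>C a) u = c *\<^sub>C \<phi> a u) \<and>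
     (\<forall>a\<in>A. \<forall>u\<in>hcarrier E. \<forall>v\<in>hcarrier E. hinner E (\<phi> a u) v = hinner E u (\<phi> (star a) v))"

definition grading_op :: "'a::cstar_algebra set \<Rightarrow>
    ('e::complex_normed_vector, 'b::cstar_algebra) module_data \<Rightarrow> ('a \<Rightarrow> 'e \<Rightarrow> 'e) \<Rightarrow>
    ('e \<times> 'e) set \<Rightarrow> ('e \<Rightarrow> 'e) \<Rightarrow> bool" where
  "grading_op A E \<phi> D \<gamma> \<longleftrightarrow> selfadjoint_op E \<gamma> \<and> (\<forall>u\<in>hcarrier E. \<gamma> (\<gamma> u) = u) \<and>
     (\<forall>a\<in>A. \<forall>u\<in>hcarrier E. \<phi> a (\<gamma> u) = \<gamma> (\<phi> a u)) \<and>
     op_graph E \<gamma> O D = D O op_graph E (\<lambda>u. - \<gamma> u)"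

text \<open>
  Parity is part of the data: \<open>Some \<gamma>\<close> stands for an even object with grading
  operator \<open>\<gamma>\<close> and \<open>None\<close> for an odd one.
\<close>

definition parity_ok :: "'a::cstar_algebra set \<Rightarrow>
    ('e::complex_normed_vector, 'b::cstar_algebra) module_data \<Rightarrow> ('a \<Rightarrow> 'e \<Rightarrow> 'e) \<Rightarrow>
    ('e \<times> 'e) set \<Rightarrow> ('e \<Rightarrow> 'e) option \<Rightarrow> bool" where
  "parity_ok A E \<phi> D g \<longleftrightarrow> (case g of None \<Rightarrow> True | Some \<gamma> \<Rightarrow> grading_op A E \<phi> D \<gamma>)"

section \<open>Half-closed chains and unbounded modular cycles\<close>

definition half_closed_chain :: "'a::cstar_algebra set \<Rightarrow> 'a set \<Rightarrow>
    ('e::complex_normed_vector, 'b::cstar_algebra) module_data \<Rightarrow> ('a \<Rightarrow> 'e \<Rightarrow> 'e) \<Rightarrow>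
    ('e \<times> 'e) set \<Rightarrow> ('e \<Rightarrow> 'e) option \<Rightarrow> bool" where
  "half_closed_chain A \<A> E \<phi> D g \<longleftrightarrow>
     cstar_subalgebra A \<and> dense_star_subalgebra \<A> A \<and>
     correspondence A E \<phi> \<and> countably_generated E \<and>
     regular_op E D \<and> symmetric_op E D \<and>
     (\<forall>a\<in>A. compact_graph E ((shift 1 (D O adjoint_graph E D))\<inverse> O op_graph E (\<phi> a))) \<and>
     (\<forall>a\<in>\<A>. \<phi> a ` Domain (adjoint_graph E D) \<subseteq> Domain D) \<and>
     (\<forall>a\<in>\<A>. \<exists>d. bounded_op E d \<and>
        (\<forall>u\<in>Domain D. d u = app D (\<phi> a u) - \<phi> a (app D u))) \<and>
     parity_ok A E \<phi> D g"

text \<open>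
  The operator \<open>d\<close> below is \<open>d\<^sub>\<Delta>(a,\<mu>)\<close>; it is determined on the carrier because
  the domain of \<open>D\<close> is dense. In the last condition the term with \<open>n = 0\<close> is
  meaningless and irrelevant for the limit.
\<close>

definition unbounded_modular_cycle :: "'a::cstar_algebra set \<Rightarrow> 'a set \<Rightarrow>
    ('e::complex_normed_vector, 'b::cstar_algebra) module_data \<Rightarrow> ('a \<Rightarrow> 'e \<Rightarrow> 'e) \<Rightarrow>
    ('e \<times> 'e) set \<Rightarrow> ('e \<Rightarrow> 'e) \<Rightarrow> ('e \<Rightarrow> 'e) option \<Rightarrow> bool" where
  "unbounded_modular_cycle A \<A> E \<phi> D \<Delta> g \<longleftrightarrow>
     cstar_subalgebra A \<and> dense_star_subalgebra \<A> A \<and>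
     correspondence A E \<phi> \<and> countably_generated E \<and>
     regular_op E D \<and> selfadjoint_unbounded E D \<and>
     positive_op E \<Delta> \<and> closure (\<Delta> ` hcarrier E) = hcarrier E \<and>
     (\<forall>a\<in>A. compact_graph E ((shift \<i> D)\<inverse> O op_graph E (\<phi> a))) \<and>
     (\<forall>a\<in>\<A>. \<forall>\<mu>.
        (\<forall>u\<in>Domain D. \<phi> a (\<Delta> u) + \<mu> *\<^sub>C \<Delta> u \<in> Domain D) \<and>
        (\<exists>d. adjointable E d \<and>
           (\<forall>u\<in>Domain D. d u = app D (\<phi> a (\<Delta> u) + \<mu> *\<^sub>C \<Delta> u)
              - \<Delta> (\<phi> a (app D u) + \<mu> *\<^sub>C app D u)) \<and>
           bdd_above ((\<lambda>\<epsilon>. op_norm E (\<lambda>u. resolvent_op E (sqrt_op E \<Delta>) \<epsilon>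
              (d (resolvent_op E (sqrt_op E \<Delta>) \<epsilon> u)))) ` {0<..}))) \<and>
     (\<forall>a\<in>A. (\<lambda>n::nat. op_norm E (\<lambda>u. \<Delta> (resolvent_op E \<Delta> (1 / real n) (\<phi> a u)) - \<phi> a u))
        \<longlonglongrightarrow> 0) \<and>
     parity_ok A E \<phi> D g"

section \<open>Localization\<close>

definition loc_algebra :: "'a::cstar_algebra set \<Rightarrow> 'a \<Rightarrow> 'a set" where
  "loc_algebra A x = closure {x * a * star x | a. a \<in> A}"

definition loc_module :: "('e::complex_normed_vector, 'b::cstar_algebra) module_data \<Rightarrow>
    ('a \<Rightarrow> 'e \<Rightarrow> 'e) \<Rightarrow> 'a \<Rightarrow> ('e, 'b) module_data" where
  "loc_module E \<phi> x = E\<lparr>hcarrier := closure (\<phi> x ` hcarrier E)\<rparr>"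

definition loc_action :: "'a::cstar_algebra set \<Rightarrow>
    ('e::complex_normed_vector, 'b::cstar_algebra) module_data \<Rightarrow>
    ('a \<Rightarrow> 'e \<Rightarrow> 'e) \<Rightarrow> 'a \<Rightarrow> 'a \<Rightarrow> 'e \<Rightarrow> 'e" where
  "loc_action A E \<phi> x = (\<lambda>a\<in>loc_algebra A x. restrict (\<phi> a) (hcarrier (loc_module E \<phi> x)))"

definition loc_operator :: "('e::complex_normed_vector, 'b::cstar_algebra) module_data \<Rightarrow>
    ('a::cstar_algebra \<Rightarrow> 'e \<Rightarrow> 'e) \<Rightarrow> ('e \<times> 'e) set \<Rightarrow> 'a \<Rightarrow> ('e \<times> 'e) set" where
  "loc_operator E \<phi> D x = closure {(u, \<phi> x (app D (\<phi> (star x) u))) | u.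
     u \<in> Domain D \<inter> hcarrier (loc_module E \<phi> x)}"

end

theory Submission
  imports Defs
begin

text \<open>
  Write \<open>x\<close> for \<open>\<phi> x\<close> and \<open>\<Delta> = x x*\<close>. The one hard point is that the closure \<open>D\<^sub>x\<close> of \<open>x D x*\<close> is
  selfadjoint and regular on \<open>E\<^sub>x\<close>, although \<open>D\<close> is only symmetric. For a closed symmetric operator
  both properties follow once \<open>D\<^sub>x + i\<mu>\<close> and \<open>D\<^sub>x - i\<mu>\<close> have dense range for one \<open>\<mu> > 0\<close>
  (\<open>symmetric_graph_range\<close>, \<open>symmetric_graph_selfadjoint\<close>, \<open>selfadjoint_one_plus_square\<close>), and this
  is proved by an explicit approximation instead of a localization at states.

  Suppose first that \<open>D\<close> is selfadjoint and regular, and put \<open>\<Theta> = x* x\<close>. Since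
  \<open>(x D x* + i\<mu>) x y = x (D \<Theta> + i\<mu>) y\<close>, it is enough to solve \<open>(D \<Theta> + i\<mu>) y = w\<close> approximately, up to
  the kernel of \<open>x\<close>. The regularized equation \<open>(D \<Theta> + \<epsilon> D + i\<mu>) y = w\<close> is solvable for large \<open>\<mu>\<close>,
  uniformly in \<open>\<epsilon>\<close>: up to a bounded term the operator is \<open>x* D x + \<epsilon> D\<close>, which is symmetric, so it is bounded below
  after adding \<open>i\<mu>\<close>, and it is surjective by continuation from \<open>(\<Theta> + \<epsilon>)(D + i\<nu>)\<close>. Moving \<open>D\<close> past
  \<open>\<Theta>\<close> shows that \<open>(\<Theta> + \<epsilon>) D y\<close> is bounded by a multiple of \<open>w\<close>, and positivity of \<open>\<Theta>\<close> turns this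
  into \<open>\<parallel>\<epsilon> x D y\<parallel> = O(\<surd>\<epsilon>)\<close>; so the regularization disappears after multiplication by \<open>x\<close>
  (\<open>localized_resolvent_approx\<close>). For a half-closed \<open>D\<close> this is applied on \<open>E \<oplus> E\<close> to the selfadjoint
  operator with off-diagonal entries \<open>D*\<close> and \<open>D\<close>, and to \<open>x \<oplus> x\<close>. Because \<open>x\<close> maps the domain of \<open>D*\<close>
  into that of \<open>D\<close>, both components of the approximate solution end up in the domain of \<open>D\<close>, and
  their sum solves the problem on \<open>E\<^sub>x\<close> (\<open>half_closed_localized\<close>).

  Compactness of \<open>a (D\<^sub>x + i)\<^sup>-\<^sup>1\<close> rests on the fact that \<open>\<Delta>\<close> maps the domain of \<open>D\<^sub>x\<close> boundedly into the
  domain of \<open>D\<close> (\<open>\<Delta>_Dx\<close>). Hence \<open>\<Delta> (D\<^sub>x + i)\<^sup>-\<^sup>1\<close> is approximated in norm by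
  \<open>\<kappa> (\<kappa> + D* D)\<^sup>-\<^sup>1 \<Delta> (D\<^sub>x + i)\<^sup>-\<^sup>1\<close> as \<open>\<kappa> \<rightarrow> \<infinity>\<close>, and \<open>b (\<kappa> + D* D)\<^sup>-\<^sup>1\<close> is compact for \<open>b\<close> in \<open>A\<close>
  (\<open>\<phi>_Rx_approx\<close>). The twisted commutator comes out as \<open>x d(x* (a + \<lambda>) x) x*\<close>, and its bound holds
  because \<open>(\<Delta>\<^sup>1\<^sup>/\<^sup>2 + \<epsilon>)\<^sup>-\<^sup>1 x\<close> is a contraction (\<open>twisted_commutator\<close>, \<open>resolvent_x_le\<close>).

  All inequalities in a Hilbert module use that \<open>\<parallel>p\<parallel> \<le> \<parallel>p + q\<parallel>\<close> for \<open>p\<close> and \<open>q\<close> of the form \<open>b* b\<close>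
  in the coefficient algebra. This is proved from the C*-identity in the first two
  sections, without spectra (\<open>cpos_norm_mono\<close>, \<open>cpos_star_mult_self\<close>).
\<close>

section \<open>The unitization of a C*-algebra\<close>

lemma scaleC_one [simp]: "(1::complex) *\<^sub>C x = (x::'a::complex_normed_vector)"
  using scaleR_scaleC[of 1 x] by simp

lemma scaleC_zero_left [simp]: "(0::complex) *\<^sub>C x = (0::'a::complex_normed_vector)"
  using scaleR_scaleC[of 0 x] by simp

lemma scaleC_zero_right [simp]: "c *\<^sub>C (0::'a::complex_normed_vector) = 0"
  using norm_scaleC[of c "0::'a"] by simp

lemma scaleC_minus_left: "(- c) *\<^sub>C x = - (c *\<^sub>C (x::'a::complex_normed_vector))"
  using scaleC_add_left[of "- c" c x] by (simp add: eq_neg_iff_add_eq_0)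

lemma scaleC_minus_right: "c *\<^sub>C (- x) = - (c *\<^sub>C (x::'a::complex_normed_vector))"
  using scaleC_add_right[of c "- x" x] by (simp add: eq_neg_iff_add_eq_0)

lemma scaleC_minus_one [simp]: "(- 1::complex) *\<^sub>C x = - (x::'a::complex_normed_vector)"
  by (simp add: scaleC_minus_left)

lemma scaleC_diff_right: "c *\<^sub>C (x - y) = c *\<^sub>C x - c *\<^sub>C (y::'a::complex_normed_vector)"
  using scaleC_add_right[of c x "- y"] by (simp add: scaleC_minus_right)

lemma scaleC_diff_left: "(c - d) *\<^sub>C x = c *\<^sub>C x - d *\<^sub>C (x::'a::complex_normed_vector)"
  using scaleC_add_left[of c "- d" x] by (simp add: scaleC_minus_left)

lemma scaleC_scaleR: "c *\<^sub>C (r *\<^sub>R x) = r *\<^sub>R (c *\<^sub>C (x::'a::complex_normed_vector))"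
  by (simp add: scaleR_scaleC scaleC_scaleC mult.commute)

lemma scaleC_of_real: "complex_of_real r *\<^sub>C x = r *\<^sub>R (x::'a::complex_normed_vector)"
  by (simp add: scaleR_scaleC)

lemmas scaleC_simps = scaleC_add_right scaleC_diff_right scaleC_minus_right scaleC_minus_left

lemma bounded_linear_scaleC: "bounded_linear (\<lambda>x::'a::complex_normed_vector. c *\<^sub>C x)"
  by (rule bounded_linear_intro[of _ "cmod c"])
     (simp_all add: scaleC_add_right scaleC_scaleR norm_scaleC)

lemmas tendsto_scaleC [tendsto_intros] = bounded_linear.tendsto[OF bounded_linear_scaleC]

lemma star_zero [simp]: "star (0::'a::cstar_algebra) = 0"
  using star_add[of 0 "0::'a"] by simp

lemma star_minus: "star (- x) = - star (x::'a::cstar_algebra)"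
  using star_add[of x "- x"] by (simp add: eq_neg_iff_add_eq_0 add.commute)

lemma star_diff: "star (x - y) = star x - star (y::'a::cstar_algebra)"
  using star_add[of x "- y"] by (simp add: star_minus)

lemma star_scaleR: "star (r *\<^sub>R x) = r *\<^sub>R star (x::'a::cstar_algebra)"
  by (simp add: scaleR_scaleC star_scaleC)

lemma norm_star [simp]: "norm (star x) = norm (x::'a::cstar_algebra)"
proof -
  have "norm y \<le> norm (star y)" for y :: 'a
  proof (cases "y = 0")
    case False
    have "norm y * norm y \<le> norm (star y) * norm y"
      using cstar_identity[of y] norm_mult_ineq[of "star y" y] by (simp add: power2_eq_square)
    then show ?thesis using False by simp
  qed simp
  from this[of x] this[of "star x"] show ?thesis by (simp add: star_star)
qed

lemma bounded_linear_star: "bounded_linear (star :: 'a::cstar_algebra \<Rightarrow> 'a)"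
  by (rule bounded_linear_intro[of _ 1]) (simp_all add: star_add star_scaleR)

lemmas tendsto_star [tendsto_intros] = bounded_linear.tendsto[OF bounded_linear_star]

text \<open>
  A unit is adjoined even if the algebra already has one, or is zero. The norm of \<open>(a, \<lambda>)\<close> is
  the larger of \<open>\<bar>\<lambda>\<bar>\<close> and the norm of \<open>u \<mapsto> a u + \<lambda> u\<close>; the first term keeps it definite when
  \<open>-a/\<lambda>\<close> happens to be a left unit.
\<close>

typedef 'a unitization = "UNIV :: ('a \<times> complex) set" by simp

setup_lifting type_definition_unitization

definition lact :: "'a::cstar_algebra \<times> complex \<Rightarrow> 'a \<Rightarrow> 'a" where
  "lact p u = fst p * u + snd p *\<^sub>C u"

lemma bounded_linear_lact: "bounded_linear (lact p)"
  unfolding lact_def[abs_def]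
  by (intro bounded_linear_add bounded_linear_mult_right bounded_linear_scaleC)

lemma norm_lact: "norm (lact p u) \<le> onorm (lact p) * norm u"
  by (rule onorm[OF bounded_linear_lact])

lemma onorm_lact_ge0: "0 \<le> onorm (lact p)"
  by (rule onorm_pos_le[OF bounded_linear_lact])

definition unorm :: "'a::cstar_algebra \<times> complex \<Rightarrow> real" where
  "unorm p = max (onorm (lact p)) (cmod (snd p))"

definition umult :: "'a::cstar_algebra \<times> complex \<Rightarrow> 'a \<times> complex \<Rightarrow> 'a \<times> complex" where
  "umult p q = (fst p * fst q + snd p *\<^sub>C fst q + snd q *\<^sub>C fst p, snd p * snd q)"

definition ustar :: "'a::cstar_algebra \<times> complex \<Rightarrow> 'a \<times> complex" where
  "ustar p = (star (fst p), cnj (snd p))"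

lemma lact_umult: "lact (umult p q) u = lact p (lact q u)"
  by (simp add: lact_def umult_def algebra_simps scaleC_add_right mult_scaleC_left
      mult_scaleC_right scaleC_scaleC)

lemma lact_ustar: "star (lact p u) * v = star u * lact (ustar p) v"
  by (simp add: lact_def ustar_def star_add star_mult star_scaleC algebra_simps
      mult_scaleC_left mult_scaleC_right)

lemma lact_add: "lact (p + q) u = lact p u + lact q u"
  by (simp add: lact_def algebra_simps scaleC_add_left)

lemma onorm_lact_umult: "onorm (lact (umult p q)) \<le> onorm (lact p) * onorm (lact q)"
  using onorm_compose[OF bounded_linear_lact bounded_linear_lact, of p q]
  by (simp add: lact_umult[abs_def] comp_def)

text \<open>
  Multiplication operators are adjointable for the pairing \<open>u* v\<close>, so the C*-identity of the algebra
  passes to their operator norms.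
\<close>

lemma onorm_lact_sq: "(onorm (lact p))\<^sup>2 \<le> onorm (lact (umult (ustar p) p))"
proof -
  let ?c = "onorm (lact (umult (ustar p) p))"
  have c0: "0 \<le> ?c" by (rule onorm_lact_ge0)
  have "norm (lact p u) \<le> sqrt ?c * norm u" for u
  proof -
    have "(norm (lact p u))\<^sup>2 = norm (star u * lact (umult (ustar p) p) u)"
      by (simp add: cstar_identity[symmetric] lact_ustar lact_umult)
    also have "\<dots> \<le> norm (star u) * norm (lact (umult (ustar p) p) u)"
      by (rule norm_mult_ineq)
    also have "\<dots> \<le> norm u * (?c * norm u)"
      by (simp add: mult_left_mono norm_lact)
    also have "\<dots> = (sqrt ?c * norm u)\<^sup>2" using c0
      by (simp add: power_mult_distrib power2_eq_square)
    finally show ?thesis by (rule power2_le_imp_le) (simp add: c0)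
  qed
  then have "onorm (lact p) \<le> sqrt ?c" by (intro onorm_bound) (use c0 in auto)
  then show ?thesis
    using onorm_lact_ge0[of p] c0 by (metis power_mono real_sqrt_pow2)
qed

lemma onorm_lact_ustar_le: "onorm (lact p) \<le> onorm (lact (ustar p))"
proof (cases "onorm (lact p) = 0")
  case False
  have "onorm (lact p) * onorm (lact p) \<le> onorm (lact (ustar p)) * onorm (lact p)"
    using onorm_lact_sq[of p] onorm_lact_umult[of "ustar p" p] by (simp add: power2_eq_square)
  then show ?thesis using False onorm_lact_ge0[of p] by simp
qed (simp add: onorm_lact_ge0)

lemma ustar_ustar: "ustar (ustar p) = p"
  by (simp add: ustar_def star_star)

lemma onorm_lact_ustar: "onorm (lact (ustar p)) = onorm (lact p)"
  using onorm_lact_ustar_le[of p] onorm_lact_ustar_le[of "ustar p"] by (simp add: ustar_ustar)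

lemma onorm_lact_cstar: "onorm (lact (umult (ustar p) p)) = (onorm (lact p))\<^sup>2"
  using onorm_lact_sq[of p] onorm_lact_umult[of "ustar p" p]
  by (simp add: onorm_lact_ustar power2_eq_square)

text \<open>
  Together with \<open>unorm_le\<close> this makes the norm equivalent to the product norm, whence completeness.
\<close>

lemma norm_fst_le_unorm: "norm (fst p) \<le> 2 * unorm p"
proof -
  have *: "norm (fst p * u) \<le> 2 * unorm p * norm u" for u
  proof -
    have "norm (fst p * u) = norm (lact p u - snd p *\<^sub>C u)" by (simp add: lact_def)
    also have "\<dots> \<le> onorm (lact p) * norm u + cmod (snd p) * norm u"
      using norm_triangle_ineq4[of "lact p u" "snd p *\<^sub>C u"] norm_lact[of p u]
      by (simp add: norm_scaleC)
    also have "\<dots> \<le> unorm p * norm u + unorm p * norm u"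
      by (intro add_mono mult_right_mono) (simp_all add: unorm_def)
    also have "\<dots> = 2 * unorm p * norm u" by simp
    finally show ?thesis .
  qed
  have "(norm (fst p))\<^sup>2 = norm (fst p * star (fst p))"
    using cstar_identity[of "star (fst p)"] by (simp add: star_star)
  also have "\<dots> \<le> 2 * unorm p * norm (fst p)" using *[of "star (fst p)"] by simp
  finally show ?thesis by (cases "norm (fst p) = 0") (auto simp: power2_eq_square unorm_def le_max_iff_disj)
qed

lemma unorm_le: "unorm p \<le> norm (fst p) + cmod (snd p)"
proof -
  have "onorm (lact p) \<le> norm (fst p) + cmod (snd p)"
  proof (rule onorm_bound)
    fix u
    have "norm (lact p u) \<le> norm (fst p * u) + norm (snd p *\<^sub>C u)"
      unfolding lact_def by (rule norm_triangle_ineq)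
    also have "\<dots> \<le> (norm (fst p) + cmod (snd p)) * norm u"
      using norm_mult_ineq[of "fst p" u] by (simp add: norm_scaleC algebra_simps)
    finally show "norm (lact p u) \<le> (norm (fst p) + cmod (snd p)) * norm u" .
  qed simp
  then show ?thesis by (simp add: unorm_def)
qed

lemma onorm_lact_scaleC: "onorm (lact (c *\<^sub>C fst p, c * snd p)) = cmod c * onorm (lact p)"
proof -
  have eq: "lact (c *\<^sub>C fst p, c * snd p) u = c *\<^sub>C lact p u" for c p and u :: 'a
    by (simp add: lact_def scaleC_add_right mult_scaleC_left scaleC_scaleC)
  have le: "onorm (lact (c *\<^sub>C fst p, c * snd p)) \<le> cmod c * onorm (lact p)" for c and p :: "'a \<times> complex"
    by (rule onorm_bound) (simp_all add: eq norm_scaleC mult.assoc mult_left_mono norm_lact onorm_lact_ge0)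
  show ?thesis
  proof (cases "c = 0")
    case True
    then show ?thesis using le[of c p] onorm_lact_ge0[of "(c *\<^sub>C fst p, c * snd p)"] by simp
  next
    case False
    have "onorm (lact p) \<le> cmod (inverse c) * onorm (lact (c *\<^sub>C fst p, c * snd p))"
      using le[of "inverse c" "(c *\<^sub>C fst p, c * snd p)"] False
      by (simp add: scaleC_scaleC flip: mult.assoc)
    then show ?thesis using le[of c p] False
      by (simp add: norm_divide field_simps)
  qed
qed

instantiation unitization :: (cstar_algebra) real_vector
begin

lift_definition zero_unitization :: "'a unitization" is "(0, 0)" .
lift_definition plus_unitization :: "'a unitization \<Rightarrow> 'a unitization \<Rightarrow> 'a unitization" is "(+)" .
lift_definition minus_unitization :: "'a unitization \<Rightarrow> 'a unitization \<Rightarrow> 'a unitization" is "(-)" .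
lift_definition uminus_unitization :: "'a unitization \<Rightarrow> 'a unitization" is "uminus" .
lift_definition scaleR_unitization :: "real \<Rightarrow> 'a unitization \<Rightarrow> 'a unitization" is scaleR .

instance
proof
  fix x y z :: "'a unitization" and a b :: real
  show "x + y + z = x + (y + z)" by transfer (simp add: add.assoc)
  show "x + y = y + x" by transfer (simp add: add.commute)
  show "0 + x = x" by transfer (simp add: plus_prod_def)
  show "- x + x = 0" by transfer (simp add: plus_prod_def)
  show "x - y = x + - y" by transfer simp
  show "a *\<^sub>R (x + y) = a *\<^sub>R x + a *\<^sub>R y" by transfer (simp add: scaleR_add_right)
  show "(a + b) *\<^sub>R x = a *\<^sub>R x + b *\<^sub>R x" by transfer (simp add: scaleR_add_left)
  show "a *\<^sub>R b *\<^sub>R x = (a * b) *\<^sub>R x" by transfer simp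
  show "1 *\<^sub>R x = x" by transfer simp
qed

end

instantiation unitization :: (cstar_algebra) real_normed_algebra_1
begin

lift_definition one_unitization :: "'a unitization" is "(0, 1)" .
lift_definition times_unitization :: "'a unitization \<Rightarrow> 'a unitization \<Rightarrow> 'a unitization" is umult .
lift_definition norm_unitization :: "'a unitization \<Rightarrow> real" is unorm .
definition dist_unitization :: "'a unitization \<Rightarrow> 'a unitization \<Rightarrow> real" where
  "dist_unitization x y = norm (x - y)"
definition sgn_unitization :: "'a unitization \<Rightarrow> 'a unitization" where
  "sgn_unitization x = x /\<^sub>R norm x"
definition uniformity_unitization :: "('a unitization \<times> 'a unitization) filter" where
  "uniformity_unitization = (INF e\<in>{0 <..}. principal {(x, y). dist x y < e})"
definition open_unitization :: "'a unitization set \<Rightarrow> bool" where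
  "open_unitization U = (\<forall>x\<in>U. eventually (\<lambda>(x', y). x' = x \<longrightarrow> y \<in> U) uniformity)"

instance
proof
  fix x y z :: "'a unitization" and a b :: real
  show "x * y * z = x * (y * z)"
    by transfer (simp add: umult_def algebra_simps scaleC_add_right mult_scaleC_left
        mult_scaleC_right scaleC_scaleC)
  show "(x + y) * z = x * z + y * z"
    by transfer (simp add: umult_def algebra_simps scaleC_add_right scaleC_add_left)
  show "x * (y + z) = x * y + x * z"
    by transfer (simp add: umult_def algebra_simps scaleC_add_right scaleC_add_left)
  show "a *\<^sub>R x * y = a *\<^sub>R (x * y)"
    by transfer (simp add: umult_def algebra_simps scaleC_scaleR scaleR_scaleC scaleC_scaleC
       mult_scaleC_left scaleC_add_right scaleR_conv_of_real)
  show "x * a *\<^sub>R y = a *\<^sub>R (x * y)"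
    by transfer (simp add: umult_def algebra_simps scaleC_scaleR scaleR_scaleC scaleC_scaleC
       mult_scaleC_right scaleC_add_right scaleR_conv_of_real)
  show "1 * x = x" by transfer (simp add: umult_def)
  show "x * 1 = x" by transfer (simp add: umult_def)
  show "(0::'a unitization) \<noteq> 1" by transfer simp
  show "dist x y = norm (x - y)" by (rule dist_unitization_def)
  show "sgn x = x /\<^sub>R norm x" by (rule sgn_unitization_def)
  show "uniformity = (INF e\<in>{0 <..}. principal {(x, y::'a unitization). dist x y < e})"
    by (rule uniformity_unitization_def)
  show "open U \<longleftrightarrow> (\<forall>x\<in>U. eventually (\<lambda>(x', y). x' = x \<longrightarrow> y \<in> U) uniformity)"
    for U :: "'a unitization set" by (rule open_unitization_def)
  show "norm x = 0 \<longleftrightarrow> x = 0"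
  proof transfer
    fix p :: "'a \<times> complex"
    have "p = (0, 0)" if "unorm p = 0"
      using that norm_fst_le_unorm[of p] onorm_lact_ge0[of p]
      by (intro prod_eqI) (auto simp: unorm_def max_def split: if_splits)
    moreover have "unorm (0::'a, 0) = 0" using unorm_le[of "(0::'a, 0)"]
      by (simp add: unorm_def)
    ultimately show "unorm p = 0 \<longleftrightarrow> p = (0, 0)" by auto
  qed
  show "norm (x + y) \<le> norm x + norm y"
  proof transfer
    fix p q :: "'a \<times> complex"
    have "onorm (lact (p + q)) \<le> onorm (lact p) + onorm (lact q)"
      using onorm_triangle[OF bounded_linear_lact bounded_linear_lact, of p q]
      by (simp add: lact_add[abs_def])
    then show "unorm (p + q) \<le> unorm p + unorm q"
      using norm_triangle_ineq[of "snd p" "snd q"] by (auto simp: unorm_def)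
  qed
  show "norm (a *\<^sub>R x) = \<bar>a\<bar> * norm x"
  proof transfer
    fix a :: real and p :: "'a \<times> complex"
    have "a *\<^sub>R p = (complex_of_real a *\<^sub>C fst p, complex_of_real a * snd p)"
      by (simp add: prod_eq_iff scaleC_of_real scaleR_conv_of_real)
    then show "unorm (a *\<^sub>R p) = \<bar>a\<bar> * unorm p"
      by (simp add: unorm_def onorm_lact_scaleC norm_mult max_mult_distrib_left)
  qed
  show "norm (1::'a unitization) = 1"
  proof transfer
    have "onorm (lact (0::'a, 1)) \<le> 1" by (rule onorm_bound) (simp_all add: lact_def)
    then show "unorm (0::'a, 1) = 1" by (simp add: unorm_def)
  qed
  show "norm (x * y) \<le> norm x * norm y"
  proof transfer
    fix p q :: "'a \<times> complex"
    have "onorm (lact (umult p q)) \<le> unorm p * unorm q"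
      using onorm_lact_umult[of p q]
      by (rule order_trans) (intro mult_mono; simp add: unorm_def onorm_lact_ge0 le_max_iff_disj)
    moreover have "cmod (snd p * snd q) \<le> unorm p * unorm q"
      unfolding norm_mult by (intro mult_mono) (simp_all add: unorm_def le_max_iff_disj)
    ultimately show "unorm (umult p q) \<le> unorm p * unorm q"
      unfolding unorm_def[of "umult p q"] by (simp add: umult_def)
  qed
qed

end

instance unitization :: (cstar_algebra) banach
proof
  fix X :: "nat \<Rightarrow> 'a unitization"
  assume X: "Cauchy X"
  define f where "f n = fst (Rep_unitization (X n))" for n
  define l where "l n = snd (Rep_unitization (X n))" for n
  have df: "norm (f m - f n) \<le> 2 * dist (X m) (X n)" and dl: "norm (l m - l n) \<le> 2 * dist (X m) (X n)" for m n
    using norm_fst_le_unorm[of "Rep_unitization (X m) - Rep_unitization (X n)"]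
      onorm_lact_ge0[of "Rep_unitization (X m) - Rep_unitization (X n)"]
    by (auto simp: f_def l_def dist_unitization_def norm_unitization.rep_eq
        minus_unitization.rep_eq unorm_def max_def)
  have "Cauchy h" if "\<And>m n. norm (h m - h n) \<le> 2 * dist (X m) (X n)" for h :: "nat \<Rightarrow> 'c::real_normed_vector"
  proof (rule metric_CauchyI)
    fix e :: real assume "0 < e"
    then obtain M where M: "\<forall>m\<ge>M. \<forall>n\<ge>M. dist (X m) (X n) < e / 2"
      using metric_CauchyD[OF X, of "e / 2"] by auto
    show "\<exists>M. \<forall>m\<ge>M. \<forall>n\<ge>M. dist (h m) (h n) < e"
      using M that by (metis dist_norm le_less_trans less_divide_eq_numeral1(1) mult.commute)
  qed
  from this[OF df] this[OF dl] have "Cauchy f" "Cauchy l" .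
  then obtain F L where FL: "f \<longlonglongrightarrow> F" "l \<longlonglongrightarrow> L"
    using convergent_eq_Cauchy by metis
  have "(\<lambda>n. norm (f n - F) + cmod (l n - L)) \<longlonglongrightarrow> 0"
    using tendsto_add[OF tendsto_norm_zero[OF LIM_zero[OF FL(1)]] tendsto_norm_zero[OF LIM_zero[OF FL(2)]]]
    by simp
  moreover have "\<forall>n. norm (X n - Abs_unitization (F, L)) \<le> norm (f n - F) + cmod (l n - L)"
  proof
    fix n
    show "norm (X n - Abs_unitization (F, L)) \<le> norm (f n - F) + cmod (l n - L)"
      using unorm_le[of "Rep_unitization (X n) - (F, L)"]
      by (simp add: norm_unitization.rep_eq minus_unitization.rep_eq Abs_unitization_inverse f_def l_def)
  qed
  ultimately have "(\<lambda>n. X n - Abs_unitization (F, L)) \<longlonglongrightarrow> 0"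
    by (rule Lim_null_comparison[OF always_eventually, rotated])
  then have "X \<longlonglongrightarrow> Abs_unitization (F, L)" by (rule LIM_zero_cancel)
  then show "convergent X" by (rule convergentI)
qed

instantiation unitization :: (cstar_algebra) cstar_algebra
begin

lift_definition star_unitization :: "'a unitization \<Rightarrow> 'a unitization" is ustar .
lift_definition scaleC_unitization :: "complex \<Rightarrow> 'a unitization \<Rightarrow> 'a unitization"
  is "\<lambda>c p. (c *\<^sub>C fst p, c * snd p)" .

instance
proof
  fix x y z :: "'a unitization" and a b :: real and c d :: complex
  show nC: "norm (c *\<^sub>C x) = cmod c * norm x" for c
    by transfer (simp add: unorm_def onorm_lact_scaleC norm_mult max_mult_distrib_left)
  show RC: "a *\<^sub>R x = complex_of_real a *\<^sub>C x" for a
    by transfer (simp add: prod_eq_iff scaleR_scaleC scaleR_conv_of_real)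
  show "c *\<^sub>C (x + y) = c *\<^sub>C x + c *\<^sub>C y"
    by transfer (simp add: scaleC_add_right algebra_simps)
  show "(c + d) *\<^sub>C x = c *\<^sub>C x + d *\<^sub>C x"
    by transfer (simp add: scaleC_add_left algebra_simps)
  show "c *\<^sub>C d *\<^sub>C x = (c * d) *\<^sub>C x"
    by transfer (simp add: scaleC_scaleC)
  show "c *\<^sub>C x * y = c *\<^sub>C (x * y)"
    by transfer (simp add: umult_def scaleC_add_right mult_scaleC_left scaleC_scaleC algebra_simps)
  show "x * c *\<^sub>C y = c *\<^sub>C (x * y)"
    by transfer (simp add: umult_def scaleC_add_right mult_scaleC_right scaleC_scaleC algebra_simps)
  show "star (star x) = x" by transfer (rule ustar_ustar)
  show "star (x + y) = star x + star y" by transfer (simp add: ustar_def star_add)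
  show "star (c *\<^sub>C x) = cnj c *\<^sub>C star x" by transfer (simp add: ustar_def star_scaleC)
  show "star (x * y) = star y * star x"
    by transfer (simp add: umult_def ustar_def star_add star_mult star_scaleC algebra_simps)
  show "norm (star x * x) = (norm x)\<^sup>2"
  proof transfer
    fix p :: "'a \<times> complex"
    have "cmod (snd (umult (ustar p) p)) = (cmod (snd p))\<^sup>2"
      by (simp add: umult_def ustar_def norm_mult power2_eq_square)
    then have "unorm (umult (ustar p) p) = max ((onorm (lact p))\<^sup>2) ((cmod (snd p))\<^sup>2)"
      by (simp add: unorm_def onorm_lact_cstar)
    also have "\<dots> = (unorm p)\<^sup>2"
      using onorm_lact_ge0[of p]
      by (auto simp: unorm_def max_def abs_le_square_iff[symmetric] power2_le_iff_abs_le)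
    finally show "unorm (umult (ustar p) p) = (unorm p)\<^sup>2" .
  qed
qed

end

lift_definition uembed :: "'a::cstar_algebra \<Rightarrow> 'a unitization" is "\<lambda>a. (a, 0)" .

lemma uembed_simps:
  shows uembed_add: "uembed (a + b) = uembed a + uembed b"
    and uembed_mult: "uembed (a * b) = uembed a * uembed b"
    and uembed_star: "uembed (star a) = star (uembed a)"
    and uembed_scaleC: "uembed (c *\<^sub>C a) = c *\<^sub>C uembed a"
  by (transfer; simp add: umult_def ustar_def)+

lemma uembed_scaleR: "uembed (r *\<^sub>R a) = r *\<^sub>R uembed a"
  by (simp add: scaleR_scaleC uembed_scaleC)

lemma uembed_minus: "uembed (a - b) = uembed a - uembed b"
  by transfer simp

lemma norm_uembed [simp]: "norm (uembed a) = norm a"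
proof (transfer, rule antisym)
  fix a :: 'a
  show "unorm (a, 0) \<le> norm a" using unorm_le[of "(a, 0)"] by simp
  have "(norm a)\<^sup>2 = norm (lact (a, 0) (star a))"
    using cstar_identity[of "star a"] by (simp add: star_star lact_def)
  also have "\<dots> \<le> onorm (lact (a, 0)) * norm a"
    using norm_lact[of "(a, 0)" "star a"] by simp
  finally show "norm a \<le> unorm (a, 0)"
    by (cases "a = 0") (auto simp: unorm_def power2_eq_square le_max_iff_disj)
qed

section \<open>Positivity in C*-algebras\<close>

lemma star_one [simp]: "star (1::'u::{cstar_algebra, real_normed_algebra_1}) = 1"
  by (metis mult.right_neutral star_mult star_star)

lemma norm_sq_selfadj:
  "star k = k \<Longrightarrow> norm (k * k) = (norm (k::'u::cstar_algebra))\<^sup>2"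
  using cstar_identity[of k] by simp

text \<open>
  Square roots of \<open>p\<close> are limits of polynomials in \<open>p\<close>; these are the sets which such limits do not leave.
  Commutants and subalgebras are the cases of interest.
\<close>

definition closed_unital :: "'u::{cstar_algebra, real_normed_algebra_1} set \<Rightarrow> bool" where
  "closed_unital C \<longleftrightarrow> closed C \<and> 1 \<in> C \<and> (\<forall>a\<in>C. \<forall>b\<in>C. a + b \<in> C \<and> a * b \<in> C) \<and>
     (\<forall>a\<in>C. \<forall>r::real. r *\<^sub>R a \<in> C)"

lemma closed_unital_UNIV: "closed_unital UNIV"
  by (simp add: closed_unital_def)

lemma closed_unital_commutant: "closed_unital {y. y * z = z * y}"
proof -
  have "closed {y. y * z = z * y}"
    by (intro closed_Collect_eq continuous_intros)
  moreover have "a * b * z = z * (a * b)" if "a * z = z * a" "b * z = z * b" for a b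
    using that by (metis mult.assoc)
  ultimately show ?thesis by (auto simp: closed_unital_def algebra_simps)
qed

text \<open>
  Positivity of the spectrum, expressed by norms alone; sums are then handled by the triangle inequality.
\<close>

definition cpos :: "'u::{cstar_algebra, real_normed_algebra_1} \<Rightarrow> bool" where
  "cpos p \<longleftrightarrow> star p = p \<and> (\<exists>t. norm (t *\<^sub>R 1 - p) \<le> t)"

lemma cpos_selfadj: "cpos p \<Longrightarrow> star p = p"
  by (simp add: cpos_def)

lemma cposI: "star p = p \<Longrightarrow> norm (t *\<^sub>R 1 - p) \<le> t \<Longrightarrow> cpos p"
  by (auto simp: cpos_def)

lemma cpos_add: "cpos p \<Longrightarrow> cpos q \<Longrightarrow> cpos (p + q)"
proof -
  assume "cpos p" "cpos q"
  then obtain s t where *: "star p = p" "star q = q" "norm (s *\<^sub>R 1 - p) \<le> s" "norm (t *\<^sub>R 1 - q) \<le> t"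
    by (auto simp: cpos_def)
  have "norm ((s + t) *\<^sub>R 1 - (p + q)) \<le> s + t"
    using norm_triangle_ineq[of "s *\<^sub>R 1 - p" "t *\<^sub>R 1 - q"] *
    by (simp add: algebra_simps)
  then show ?thesis using * by (intro cposI) (auto simp: star_add)
qed

lemma cpos_scaleR: "cpos p \<Longrightarrow> 0 \<le> r \<Longrightarrow> cpos (r *\<^sub>R p)"
proof -
  assume "cpos p" and r: "0 \<le> r"
  then obtain s where *: "star p = p" "norm (s *\<^sub>R 1 - p) \<le> s" by (auto simp: cpos_def)
  have "(r * s) *\<^sub>R 1 - r *\<^sub>R p = r *\<^sub>R (s *\<^sub>R 1 - p)" by (simp add: algebra_simps)
  then have "norm ((r * s) *\<^sub>R 1 - r *\<^sub>R p) \<le> r * s"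
    using * r by (simp add: mult_left_mono)
  then show ?thesis using * by (intro cposI) (auto simp: star_scaleR)
qed

lemma cpos_norm_minus: "star h = h \<Longrightarrow> norm h \<le> t \<Longrightarrow> cpos (t *\<^sub>R 1 - h)"
  by (rule cposI[of _ t]) (auto simp: star_diff star_scaleR)

text \<open>
  A limit \<open>b\<close> satisfies \<open>2 b = g + b\<^sup>2\<close>, which says that \<open>(1 - b)\<^sup>2 = 1 - g\<close>. Started at \<open>0\<close>, the iteration
  is dominated term by term by the one for the number \<open>g = 1\<close>, so it converges for \<open>\<parallel>g\<parallel> \<le> 1\<close>.
\<close>

fun sqrt_iter :: "'u::real_normed_algebra_1 \<Rightarrow> nat \<Rightarrow> 'u" where
  "sqrt_iter g 0 = 0"
| "sqrt_iter g (Suc n) = (1/2) *\<^sub>R (g + sqrt_iter g n * sqrt_iter g n)"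

lemma sqrt_iter_real:
  "0 \<le> sqrt_iter (1::real) n \<and> sqrt_iter (1::real) n \<le> 1 \<and> sqrt_iter (1::real) n \<le> sqrt_iter 1 (Suc n)"
proof (induction n)
  case (Suc n)
  let ?b = "sqrt_iter (1::real) n"
  have "?b * ?b \<le> 1" using Suc by (simp add: mult_le_one)
  moreover have "?b * ?b \<le> sqrt_iter 1 (Suc n) * sqrt_iter 1 (Suc n)" using Suc by (intro mult_mono) auto
  ultimately show ?case by simp
qed simp

lemma sqrt_iter_norm:
  assumes "norm (g::'u::real_normed_algebra_1) \<le> 1"
  shows "norm (sqrt_iter g n) \<le> sqrt_iter (1::real) n"
    and "norm (sqrt_iter g (Suc n) - sqrt_iter g n) \<le> sqrt_iter (1::real) (Suc n) - sqrt_iter 1 n"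
proof -
  have norm: "norm (sqrt_iter g n) \<le> sqrt_iter (1::real) n" for n
  proof (induction n)
    case (Suc n)
    have "norm (sqrt_iter g n * sqrt_iter g n) \<le> sqrt_iter (1::real) n * sqrt_iter 1 n"
      by (rule order_trans[OF norm_mult_ineq]) (intro mult_mono Suc norm_ge_zero, use sqrt_iter_real in auto)
    then show ?case using norm_triangle_ineq[of g "sqrt_iter g n * sqrt_iter g n"] assms by simp
  qed simp
  then show "norm (sqrt_iter g n) \<le> sqrt_iter (1::real) n" .
  show "norm (sqrt_iter g (Suc n) - sqrt_iter g n) \<le> sqrt_iter (1::real) (Suc n) - sqrt_iter 1 n"
  proof (induction n)
    case 0
    show ?case using assms by simp
  next
    case (Suc n)
    let ?a = "sqrt_iter g (Suc n)" and ?b = "sqrt_iter g n"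
      and ?s = "sqrt_iter (1::real) (Suc n)" and ?t = "sqrt_iter (1::real) n"
    have "sqrt_iter g (Suc (Suc n)) - ?a = (1/2) *\<^sub>R (?a * ?a - ?b * ?b)"
      by (simp add: algebra_simps)
    also have "?a * ?a - ?b * ?b = ?a * (?a - ?b) + (?a - ?b) * ?b" by (simp add: algebra_simps)
    finally have e: "sqrt_iter g (Suc (Suc n)) - ?a = (1/2) *\<^sub>R (?a * (?a - ?b) + (?a - ?b) * ?b)" .
    have "norm (?a * (?a - ?b) + (?a - ?b) * ?b) \<le> norm ?a * norm (?a - ?b) + norm (?a - ?b) * norm ?b"
      by (intro norm_triangle_le add_mono norm_mult_ineq)
    also have "\<dots> \<le> ?s * (?s - ?t) + (?s - ?t) * ?t"
      by (intro add_mono mult_mono Suc norm norm_ge_zero) (use sqrt_iter_real[of n] sqrt_iter_real[of "Suc n"] in auto)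
    also have "\<dots> = ?s * ?s - ?t * ?t" by (simp add: algebra_simps)
    finally have f: "norm (?a * (?a - ?b) + (?a - ?b) * ?b) \<le> ?s * ?s - ?t * ?t" .
    have "sqrt_iter (1::real) (Suc (Suc n)) - ?s = (1/2) * (?s * ?s - ?t * ?t)"
      by (simp add: algebra_simps)
    then show ?case unfolding e norm_scaleR using f by (simp del: sqrt_iter.simps)
  qed
qed

lemma sqrt_iter_converges:
  assumes "norm (g::'u::{real_normed_algebra_1, banach}) \<le> 1"
  obtains b where "sqrt_iter g \<longlonglongrightarrow> b" "b = (1/2) *\<^sub>R (g + b * b)" "norm b \<le> 1"
proof -
  have inc: "incseq (sqrt_iter (1::real))" using sqrt_iter_real by (intro incseq_SucI) blast
  have "convergent (sqrt_iter (1::real))"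
    using inc sqrt_iter_real by (intro Bseq_mono_convergent BseqI'[where K=1]) (auto simp: incseq_def)
  then have cau: "Cauchy (sqrt_iter (1::real))" by (rule convergent_Cauchy)
  have le: "norm (sqrt_iter g (n + k) - sqrt_iter g n) \<le> sqrt_iter (1::real) (n + k) - sqrt_iter 1 n" for n k
  proof (induction k)
    case (Suc k)
    show ?case
      using norm_triangle_ineq[of "sqrt_iter g (Suc (n + k)) - sqrt_iter g (n + k)" "sqrt_iter g (n + k) - sqrt_iter g n"]
        Suc sqrt_iter_norm(2)[OF assms, of "n + k"] by (simp del: sqrt_iter.simps)
  qed simp
  have "Cauchy (sqrt_iter g)"
  proof (rule metric_CauchyI)
    fix e :: real assume "0 < e"
    then obtain M where M: "\<And>m n. m \<ge> M \<Longrightarrow> n \<ge> M \<Longrightarrow> dist (sqrt_iter (1::real) m) (sqrt_iter 1 n) < e"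
      using metric_CauchyD[OF cau] by meson
    have "dist (sqrt_iter g m) (sqrt_iter g n) < e" if "M \<le> n" "n \<le> m" for m n
      using M[of m n] le[of n "m - n"] that by (simp add: dist_norm)
    then show "\<exists>M. \<forall>m\<ge>M. \<forall>n\<ge>M. dist (sqrt_iter g m) (sqrt_iter g n) < e"
      by (metis dist_commute nat_le_linear)
  qed
  then obtain b where b: "sqrt_iter g \<longlonglongrightarrow> b" by (auto simp: convergent_eq_Cauchy[symmetric] convergent_def)
  have "(\<lambda>n. sqrt_iter g (Suc n)) \<longlonglongrightarrow> (1/2) *\<^sub>R (g + b * b)"
    unfolding sqrt_iter.simps by (intro tendsto_intros b)
  then have "b = (1/2) *\<^sub>R (g + b * b)" using LIMSEQ_unique LIMSEQ_Suc[OF b] by blast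
  moreover have "norm b \<le> 1"
    using sqrt_iter_norm(1)[OF assms] sqrt_iter_real
    by (intro LIMSEQ_le_const2[OF tendsto_norm[OF b]]) (meson order_trans)
  ultimately show thesis using b that by blast
qed

lemma cpos_sqrt:
  fixes p :: "'u::{cstar_algebra, real_normed_algebra_1}"
  assumes p: "cpos p" and C: "closed_unital C" and pC: "p \<in> C"
  obtains q where "q \<in> C" "cpos q" "q * q = p"
proof -
  obtain t where t: "norm (t *\<^sub>R 1 - p) \<le> t" and sp: "star p = p" using p by (auto simp: cpos_def)
  have t0: "0 \<le> t" using norm_ge_zero t by (rule order_trans)
  show thesis
  proof (cases "t = 0")
    case True
    then have "p = 0" using t by simp
    then show thesis using that[of p] p pC by simp
  next
    case False
    define g where "g = 1 - inverse t *\<^sub>R p"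
    have "t *\<^sub>R g = t *\<^sub>R 1 - p" using False by (simp add: g_def algebra_simps)
    then have "t * norm g \<le> t" using t t0 by (metis abs_of_nonneg norm_scaleR)
    then have g1: "norm g \<le> 1" using False t0 by simp
    have sg: "star g = g" using sp by (simp add: g_def star_diff star_scaleR)
    have C0: "\<And>a b. a \<in> C \<Longrightarrow> b \<in> C \<Longrightarrow> a + b \<in> C" "\<And>a b. a \<in> C \<Longrightarrow> b \<in> C \<Longrightarrow> a * b \<in> C"
        "\<And>a r. a \<in> C \<Longrightarrow> r *\<^sub>R a \<in> C" "1 \<in> C" "closed C"
      using C by (auto simp: closed_unital_def)
    have C0': "- a \<in> C" if "a \<in> C" for a using C0(3)[OF that, of "-1"] by simp
    have gC: "g \<in> C" unfolding g_def diff_conv_add_uminus by (intro C0 C0' pC)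
    obtain b where b: "sqrt_iter g \<longlonglongrightarrow> b" "b = (1/2) *\<^sub>R (g + b * b)" "norm b \<le> 1"
      using sqrt_iter_converges[OF g1] by blast
    have zC: "(0::'u) \<in> C" using C0(3)[OF pC, of 0] by simp
    have "sqrt_iter g n \<in> C \<and> star (sqrt_iter g n) = sqrt_iter g n" for n
      by (induction n) (auto intro!: C0 zC gC simp: star_scaleR star_add star_mult sg)
    then have "b \<in> C" "star b = b"
      using closed_sequentially[OF C0(5), of "sqrt_iter g" b] b(1)
        LIMSEQ_unique[OF tendsto_star[OF b(1)], of b] by auto
    define q where "q = sqrt t *\<^sub>R (1 - b)"
    have "2 *\<^sub>R b = g + b * b" using arg_cong[OF b(2), of "\<lambda>x. 2 *\<^sub>R x"] by simp
    then have "(1 - b) * (1 - b) = 1 - g" by (simp add: algebra_simps scaleR_2)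
    then have "q * q = t *\<^sub>R (1 - g)" using t0 by (simp add: q_def)
    also have "\<dots> = p" using False by (simp add: g_def algebra_simps)
    finally have "q * q = p" .
    moreover have "q \<in> C" unfolding q_def diff_conv_add_uminus using \<open>b \<in> C\<close> by (intro C0 C0') auto
    moreover have "cpos q"
    proof (rule cposI[of _ "sqrt t"])
      have "sqrt t *\<^sub>R 1 - q = sqrt t *\<^sub>R b" by (simp add: q_def algebra_simps)
      then show "norm (sqrt t *\<^sub>R 1 - q) \<le> sqrt t"
        using b(3) t0 by (simp add: mult_left_le)
      show "star q = q" using \<open>star b = b\<close> by (simp add: q_def star_scaleR star_diff)
    qed
    ultimately show thesis using that by blast
  qed
qed

text \<open>
  The element \<open>u = h + i k\<close> satisfies \<open>u* u = n\<close>, and \<open>h\<close> is its real part.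
\<close>

lemma norm_le_if_squares_sum:
  fixes h k :: "'u::{cstar_algebra, real_normed_algebra_1}"
  assumes "star h = h" "star k = k" "h * k = k * h" "h * h + k * k = n *\<^sub>R 1" "0 \<le> n"
  shows "(norm h)\<^sup>2 \<le> n"
proof -
  define u where "u = h + \<i> *\<^sub>C k"
  have su: "star u = h - \<i> *\<^sub>C k"
    using assms by (simp add: u_def star_add star_scaleC scaleC_minus_left)
  have "star u * u = h * h + k * k"
    unfolding su using assms(3) by (simp add: u_def algebra_simps mult_scaleC_left mult_scaleC_right scaleC_scaleC scaleC_simps)
  then have "(norm u)\<^sup>2 = n" using assms cstar_identity[of u] by simp
  moreover have "norm h \<le> norm u"
  proof -
    have "2 *\<^sub>R h = u + star u" by (simp add: su scaleR_2) (simp add: u_def)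
    then have "2 * norm h \<le> norm u + norm (star u)"
      by (metis norm_scaleR norm_triangle_ineq abs_numeral)
    then show ?thesis by simp
  qed
  ultimately show ?thesis by (metis norm_ge_zero power_mono)
qed

text \<open>
  Here \<open>r - h\<^sup>2\<close> is positive for a trivial reason, so it has a root \<open>k\<close>, which commutes with \<open>h\<close>; the identity
  \<open>h\<^sup>2 + k\<^sup>2 = r\<close> bounds \<open>k\<close>.
\<close>

lemma norm_minus_square_le:
  fixes h :: "'u::{cstar_algebra, real_normed_algebra_1}"
  assumes h: "star h = h" and r: "(norm h)\<^sup>2 \<le> r"
  shows "norm (r *\<^sub>R 1 - h * h) \<le> r"
proof -
  have "cpos (r *\<^sub>R 1 - h * h)"
    by (rule cpos_norm_minus) (use h r in \<open>auto simp: star_mult norm_sq_selfadj\<close>)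
  then obtain k where k: "k \<in> {y. y * h = h * y}" "cpos k" "k * k = r *\<^sub>R 1 - h * h"
    by (rule cpos_sqrt[OF _ closed_unital_commutant[of h]]) (auto simp: algebra_simps)
  have "(norm k)\<^sup>2 \<le> r"
    by (rule norm_le_if_squares_sum[of k h])
       (use k h r in \<open>auto simp: cpos_selfadj intro: order_trans[OF zero_le_power2]\<close>)
  then show ?thesis using k norm_sq_selfadj[OF cpos_selfadj[OF k(2)]] by simp
qed

lemma cpos_square:
  fixes h :: "'u::{cstar_algebra, real_normed_algebra_1}"
  assumes "star h = h" shows "cpos (h * h)"
  by (rule cposI[OF _ norm_minus_square_le[OF assms order_refl]]) (simp add: star_mult assms)

lemma cpos_norm_minus_le:
  fixes p :: "'u::{cstar_algebra, real_normed_algebra_1}"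
  assumes "cpos p" "norm p \<le> r" shows "norm (r *\<^sub>R 1 - p) \<le> r"
proof -
  obtain h where h: "cpos h" "h * h = p" using cpos_sqrt[OF assms(1) closed_unital_UNIV] by auto
  then show ?thesis
    using norm_minus_square_le[of h r] assms(2) norm_sq_selfadj[OF cpos_selfadj[OF h(1)]]
    by (auto simp: cpos_selfadj)
qed

text \<open>
  With \<open>n = \<parallel>p + q\<parallel>\<close>, both \<open>p\<close> and \<open>n - p = (n - (p + q)) + q\<close> are positive. Their commuting square
  roots have squares that sum to \<open>n\<close>.
\<close>

lemma cpos_norm_mono:
  fixes p q :: "'u::{cstar_algebra, real_normed_algebra_1}"
  assumes p: "cpos p" and q: "cpos q" shows "norm p \<le> norm (p + q)"
proof -
  define n where "n = norm (p + q)"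
  have "cpos (n *\<^sub>R 1 - (p + q))"
    using cpos_add[OF p q] by (intro cpos_norm_minus) (auto simp: n_def cpos_selfadj)
  from cpos_add[OF this q] have c: "cpos (n *\<^sub>R 1 - p)" by simp
  obtain m where m: "cpos m" "m * m = p" using cpos_sqrt[OF p closed_unital_UNIV] by auto
  obtain k where k: "k \<in> {y. y * m = m * y}" "cpos k" "k * k = n *\<^sub>R 1 - p"
    by (rule cpos_sqrt[OF c closed_unital_commutant[of m]])
       (use m(2) in \<open>auto simp: algebra_simps mult.assoc\<close>)
  have "(norm m)\<^sup>2 \<le> n"
    by (rule norm_le_if_squares_sum[of m k]) (use k m in \<open>auto simp: cpos_selfadj n_def\<close>)
  then show ?thesis using m norm_sq_selfadj[OF cpos_selfadj[OF m(1)]] by (simp add: n_def)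
qed

text \<open>
  Let \<open>q = k\<^sup>2\<close>, \<open>p = c c*\<close> and \<open>N = \<parallel>p\<parallel> = \<parallel>q\<parallel>\<close>. As \<open>c* c + c c*\<close> is a sum of squares, \<open>p\<close> is positive and
  \<open>\<parallel>N - p\<parallel> \<le> N\<close>. From \<open>p c = - c q\<close> one gets \<open>(N - p) c = c (N + q)\<close>, and comparing the norms of
  both sides gives \<open>2 N\<^sup>3 \<le> \<parallel>(N + q)\<^sup>2 q\<parallel> \<le> N\<^sup>3\<close>.
\<close>

lemma star_mult_self_eq_minus_square:
  fixes c k :: "'u::{cstar_algebra, real_normed_algebra_1}"
  assumes k: "star k = k" and c: "star c * c = - (k * k)"
  shows "c = 0"
proof -
  define q where "q = k * k"
  define p where "p = c * star c"
  define N where "N = (norm c)\<^sup>2"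
  define r where "r = c + star c"
  define s where "s = \<i> *\<^sub>C (c - star c)"
  have rs: "star r = r" "star s = s"
    by (simp_all add: r_def s_def star_add star_star star_scaleC star_diff scaleC_simps add.commute)
  have "s * s = - ((c - star c) * (c - star c))"
    by (simp add: s_def mult_scaleC_left mult_scaleC_right scaleC_scaleC)
  then have "r * r + s * s = 2 *\<^sub>R (star c * c + c * star c)"
    by (simp add: r_def algebra_simps scaleR_2)
  then have "p = (1/2) *\<^sub>R (r * r + s * s) + q" using c by (simp add: p_def q_def)
  moreover have "cpos ((1/2) *\<^sub>R (r * r + s * s) + q)"
    unfolding q_def by (intro cpos_add cpos_scaleR cpos_square k rs) simp
  ultimately have p: "cpos p" by simp
  have q0: "star q = q" by (simp add: q_def star_mult k)
  have nq: "norm q = N" using c cstar_identity[of c] by (simp add: q_def N_def)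
  have np: "norm p = N" using cstar_identity[of "star c"] by (simp add: p_def N_def star_star)
  have le: "norm (N *\<^sub>R 1 - p) \<le> N" using cpos_norm_minus_le[OF p] np by simp
  have "p * c = - (c * q)" using c by (simp add: p_def q_def mult.assoc)
  then have "(N *\<^sub>R 1 - p) * c = c * (N *\<^sub>R 1 + q)" by (simp add: algebra_simps)
  then have "star ((N *\<^sub>R 1 - p) * c) * ((N *\<^sub>R 1 - p) * c) = (N *\<^sub>R 1 + q) * (star c * c) * (N *\<^sub>R 1 + q)"
    by (simp add: star_mult star_add star_scaleR q0 mult.assoc)
  also have "\<dots> = - ((2 * N) *\<^sub>R (q * q) + ((N * N) *\<^sub>R q + q * q * q))"
    using c by (simp add: algebra_simps q_def[symmetric] scaleR_2 flip: scaleR_scaleR)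
  finally have "norm ((2 * N) *\<^sub>R (q * q) + ((N * N) *\<^sub>R q + q * q * q)) = (norm ((N *\<^sub>R 1 - p) * c))\<^sup>2"
    by (metis cstar_identity norm_minus_cancel)
  also have "\<dots> \<le> (N * norm c)\<^sup>2"
    by (intro power_mono order_trans[OF norm_mult_ineq] mult_right_mono le) auto
  also have "\<dots> = N * N * N" by (simp add: N_def power2_eq_square)
  finally have up: "norm ((2 * N) *\<^sub>R (q * q) + ((N * N) *\<^sub>R q + q * q * q)) \<le> N * N * N" .
  have "q * q * q = (k * k * k) * (k * k * k)" by (simp add: q_def mult.assoc)
  then have "cpos (q * q * q)" using cpos_square[of "k * k * k"] by (simp add: star_mult k mult.assoc)
  then have "norm ((2 * N) *\<^sub>R (q * q)) \<le> N * N * N"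
    by (intro order_trans[OF cpos_norm_mono up] cpos_add cpos_scaleR cpos_square q0)
       (auto simp: N_def q_def intro: cpos_square k)
  then have "2 * N * (N * N) \<le> N * N * N"
    using norm_sq_selfadj[OF q0] nq by (simp add: N_def power2_eq_square)
  then have "N * N * N \<le> 0" by simp
  then show "c = 0" by (simp add: N_def power2_eq_square mult_le_0_iff zero_le_mult_iff split: if_splits)
qed

text \<open>
  Let \<open>h = a* a\<close>, let \<open>m\<close> be the positive root of \<open>h\<^sup>2\<close>, and let \<open>n = (m - h)/2\<close> be the negative part of \<open>h\<close>.
  Then \<open>(a n)* (a n) = n h n = - m n\<^sup>2\<close> is minus a square, so \<open>a n = 0\<close> and therefore \<open>h = m\<close>.
\<close>

lemma cpos_star_mult_self:
  fixes a :: "'u::{cstar_algebra, real_normed_algebra_1}"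
  shows "cpos (star a * a)"
proof -
  define h where "h = star a * a"
  have h: "star h = h" by (simp add: h_def star_mult star_star)
  obtain m where m: "m \<in> {y. y * h = h * y}" "cpos m" "m * m = h * h"
    by (rule cpos_sqrt[OF cpos_square[OF h] closed_unital_commutant[of h]]) (auto simp: mult.assoc)
  then have mh: "m * h = h * m" by simp
  define n where "n = (1/2) *\<^sub>R (m - h)"
  have sn: "star n = n" by (simp add: n_def star_scaleR star_diff h cpos_selfadj[OF m(2)])
  have mn: "m * n = n * m" using mh by (simp add: n_def algebra_simps)
  have "n * h + m * n = 0" by (simp add: n_def algebra_simps mh m(3))
  then have nh: "n * h = - (m * n)" by (simp add: eq_neg_iff_add_eq_0)
  obtain w where w: "w \<in> {y. y * n = n * y}" "cpos w" "w * w = m"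
    by (rule cpos_sqrt[OF m(2) closed_unital_commutant[of n]]) (use mn in auto)
  then have wn: "w * n = n * w" by simp
  have "star (a * n) * (a * n) = n * h * n" by (simp add: star_mult sn h_def mult.assoc)
  also have "\<dots> = - ((w * n) * (w * n))"
  proof -
    have "m * n * n = w * (w * n) * n" by (simp add: w(3)[symmetric] mult.assoc)
    also have "\<dots> = w * (n * w) * n" by (simp add: wn)
    also have "\<dots> = (w * n) * (w * n)" by (simp add: mult.assoc)
    finally show ?thesis by (simp add: nh)
  qed
  finally have "star (a * n) * (a * n) = - ((w * n) * (w * n))" .
  moreover have "star (w * n) = w * n" by (simp add: star_mult sn cpos_selfadj[OF w(2)] wn)
  ultimately have an: "a * n = 0" by (rule star_mult_self_eq_minus_square[rotated])
  then have "h * n = 0" by (simp add: h_def mult.assoc)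
  then have "n * h = 0" using star_mult[of h n] by (simp add: sn h)
  then have "(norm (m - h))\<^sup>2 = norm ((m - h) * (m - h))"
    by (intro norm_sq_selfadj[symmetric]) (simp add: star_diff h cpos_selfadj[OF m(2)])
  also have "(m - h) * (m - h) = (-4) *\<^sub>R (n * h)"
    by (simp add: n_def algebra_simps mh m(3) scaleR_2)
  finally have "m = h" using \<open>n * h = 0\<close> by simp
  then show ?thesis using m(2) by (simp add: h_def)
qed

definition pos :: "'b::cstar_algebra \<Rightarrow> bool" where
  "pos b \<longleftrightarrow> cpos (uembed b)"

lemma inj_uembed: "uembed a = uembed b \<Longrightarrow> a = b"
  by transfer simp

lemma pos_selfadj: "pos p \<Longrightarrow> star p = p"
  unfolding pos_def by (drule cpos_selfadj) (auto simp: uembed_star[symmetric] intro: inj_uembed)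

lemma pos_add: "pos p \<Longrightarrow> pos q \<Longrightarrow> pos (p + q)"
  by (simp add: pos_def uembed_add cpos_add)

lemma pos_scaleR: "pos p \<Longrightarrow> 0 \<le> r \<Longrightarrow> pos (r *\<^sub>R p)"
  by (simp add: pos_def uembed_scaleR cpos_scaleR)

lemma pos_norm_mono: "pos p \<Longrightarrow> pos q \<Longrightarrow> norm p \<le> norm (p + q)"
  using cpos_norm_mono[of "uembed p" "uembed q"] by (simp add: pos_def flip: uembed_add)

lemma pos_star_mult_self: "pos (star a * a)"
  by (simp add: pos_def uembed_mult uembed_star cpos_star_mult_self)

lemma positive_in_imp_pos: "positive_in UNIV b \<Longrightarrow> pos b"
  by (auto simp: positive_in_def pos_star_mult_self)

text \<open>
  This is \<open>c* (\<parallel>p\<parallel> - p) c\<close>, with \<open>\<parallel>p\<parallel> - p\<close> a square in the unitization.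
\<close>

lemma pos_norm_conj:
  assumes p: "pos p"
  shows "pos (norm p *\<^sub>R (star c * c) - star c * p * c)"
proof -
  have "cpos (norm p *\<^sub>R 1 - uembed p)"
    using p by (intro cpos_norm_minus) (auto simp: pos_def cpos_selfadj)
  then obtain k where k: "cpos k" "k * k = norm p *\<^sub>R 1 - uembed p"
    using cpos_sqrt[OF _ closed_unital_UNIV] by auto
  have "uembed (norm p *\<^sub>R (star c * c) - star c * p * c) = star (uembed c) * (norm p *\<^sub>R 1 - uembed p) * uembed c"
    by (simp add: uembed_simps uembed_minus uembed_scaleR algebra_simps)
  also have "\<dots> = star (k * uembed c) * (k * uembed c)"
    by (simp add: k(2)[symmetric] star_mult cpos_selfadj[OF k(1)] mult.assoc)
  finally show ?thesis by (simp add: pos_def cpos_star_mult_self)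
qed

section \<open>Surjectivity by continuation and C*-valued inner products\<close>

instantiation prod :: (complex_normed_vector, complex_normed_vector) complex_normed_vector
begin

definition scaleC_prod_def: "scaleC c A = (c *\<^sub>C fst A, c *\<^sub>C snd A)"

instance
proof
  fix c d :: complex and x y :: "'a \<times> 'b" and r :: real
  show "c *\<^sub>C (x + y) = c *\<^sub>C x + c *\<^sub>C y" by (simp add: scaleC_prod_def scaleC_add_right)
  show "(c + d) *\<^sub>C x = c *\<^sub>C x + d *\<^sub>C x" by (simp add: scaleC_prod_def scaleC_add_left)
  show "c *\<^sub>C d *\<^sub>C x = (c * d) *\<^sub>C x" by (simp add: scaleC_prod_def scaleC_scaleC)
  show "r *\<^sub>R x = complex_of_real r *\<^sub>C x" by (simp add: scaleC_prod_def prod_eq_iff scaleR_scaleC)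
  show "norm (c *\<^sub>C x) = cmod c * norm x"
    by (simp add: scaleC_prod_def norm_prod_def norm_scaleC power_mult_distrib real_sqrt_mult
        flip: distrib_left)
qed

end

lemma scaleC_Pair [simp]: "c *\<^sub>C (a, b) = (c *\<^sub>C a, c *\<^sub>C b)"
  by (simp add: scaleC_prod_def)

lemma fst_scaleC [simp]: "fst (c *\<^sub>C p) = c *\<^sub>C fst p"
  by (simp add: scaleC_prod_def)

lemma snd_scaleC [simp]: "snd (c *\<^sub>C p) = c *\<^sub>C snd p"
  by (simp add: scaleC_prod_def)

definition csubspace :: "'e::complex_normed_vector set \<Rightarrow> bool" where
  "csubspace S \<longleftrightarrow> 0 \<in> S \<and> (\<forall>u\<in>S. \<forall>v\<in>S. u + v \<in> S) \<and> (\<forall>u\<in>S. \<forall>c. c *\<^sub>C u \<in> S)"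

lemma csubspaceD:
  assumes "csubspace S"
  shows "0 \<in> S" "u \<in> S \<Longrightarrow> v \<in> S \<Longrightarrow> u + v \<in> S" "u \<in> S \<Longrightarrow> c *\<^sub>C u \<in> S" "u \<in> S \<Longrightarrow> r *\<^sub>R u \<in> S"
    "u \<in> S \<Longrightarrow> - u \<in> S" "u \<in> S \<Longrightarrow> v \<in> S \<Longrightarrow> u - v \<in> S"
proof -
  show 1: "0 \<in> S" "u \<in> S \<Longrightarrow> v \<in> S \<Longrightarrow> u + v \<in> S" "u \<in> S \<Longrightarrow> c *\<^sub>C u \<in> S" for u v c
    using assms by (auto simp: csubspace_def)
  show 2: "u \<in> S \<Longrightarrow> r *\<^sub>R u \<in> S" for r u by (simp add: scaleR_scaleC 1)
  show 3: "u \<in> S \<Longrightarrow> - u \<in> S" for u using 2[of u "-1"] by simp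
  show "u \<in> S \<Longrightarrow> v \<in> S \<Longrightarrow> u - v \<in> S" using 1(2)[OF _ 3, of u v] by simp
qed

definition clinear_on :: "'e::complex_normed_vector set \<Rightarrow> ('e \<Rightarrow> 'f::complex_normed_vector) \<Rightarrow> bool" where
  "clinear_on S T \<longleftrightarrow> (\<forall>u\<in>S. \<forall>v\<in>S. T (u + v) = T u + T v) \<and> (\<forall>u\<in>S. \<forall>c. T (c *\<^sub>C u) = c *\<^sub>C T u)"

lemma clinear_onD:
  assumes "clinear_on S T"
  shows "u \<in> S \<Longrightarrow> v \<in> S \<Longrightarrow> T (u + v) = T u + T v" "u \<in> S \<Longrightarrow> T (c *\<^sub>C u) = c *\<^sub>C T u"
    "u \<in> S \<Longrightarrow> T (r *\<^sub>R u) = r *\<^sub>R T u" "u \<in> S \<Longrightarrow> T (- u) = - T u"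
    "csubspace S \<Longrightarrow> T 0 = 0"
    "csubspace S \<Longrightarrow> u \<in> S \<Longrightarrow> v \<in> S \<Longrightarrow> T (u - v) = T u - T v"
proof -
  show 1: "u \<in> S \<Longrightarrow> v \<in> S \<Longrightarrow> T (u + v) = T u + T v" "u \<in> S \<Longrightarrow> T (c *\<^sub>C u) = c *\<^sub>C T u" for u v c
    using assms by (auto simp: clinear_on_def)
  show 2: "u \<in> S \<Longrightarrow> T (r *\<^sub>R u) = r *\<^sub>R T u" for r u by (simp add: scaleR_scaleC 1)
  show 3: "u \<in> S \<Longrightarrow> T (- u) = - T u" for u using 2[of u "-1"] by simp
  show "csubspace S \<Longrightarrow> T 0 = 0" using 1(2)[of 0 0] by (simp add: csubspaceD)
  show "csubspace S \<Longrightarrow> u \<in> S \<Longrightarrow> v \<in> S \<Longrightarrow> T (u - v) = T u - T v"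
    using 1(1)[of u "- v"] 3[of v] by (simp add: csubspaceD)
qed

definition bounded_on :: "'e::complex_normed_vector set \<Rightarrow> ('e \<Rightarrow> 'e) \<Rightarrow> bool" where
  "bounded_on H T \<longleftrightarrow> T \<in> H \<rightarrow> H \<and> clinear_on H T \<and> (\<exists>C. \<forall>u\<in>H. norm (T u) \<le> C * norm u)"

lemma bounded_onD:
  assumes "bounded_on H T"
  shows "u \<in> H \<Longrightarrow> T u \<in> H" "clinear_on H T" "\<exists>C\<ge>0. \<forall>u\<in>H. norm (T u) \<le> C * norm u"
proof -
  show "u \<in> H \<Longrightarrow> T u \<in> H" "clinear_on H T" using assms by (auto simp: bounded_on_def)
  obtain C where C: "\<forall>u\<in>H. norm (T u) \<le> C * norm u" using assms by (auto simp: bounded_on_def)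
  then have "\<forall>u\<in>H. norm (T u) \<le> max 0 C * norm u"
    by (meson max.cobounded2 mult_right_mono norm_ge_zero order_trans)
  then show "\<exists>C\<ge>0. \<forall>u\<in>H. norm (T u) \<le> C * norm u" by (intro exI[of _ "max 0 C"]) auto
qed

lemma bounded_on_comp:
  assumes S: "bounded_on H S" and T: "bounded_on H T" shows "bounded_on H (\<lambda>u. S (T u))"
proof -
  obtain C where C: "0 \<le> C" "\<forall>u\<in>H. norm (S u) \<le> C * norm u" using bounded_onD(3)[OF S] by auto
  obtain C' where C': "0 \<le> C'" "\<forall>u\<in>H. norm (T u) \<le> C' * norm u" using bounded_onD(3)[OF T] by auto
  have "norm (S (T u)) \<le> (C * C') * norm u" if "u \<in> H" for u
    using C(2)[rule_format, of "T u"] mult_left_mono[OF C'(2)[rule_format, of u] C(1)] bounded_onD(1)[OF T that] that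
    by (simp add: mult.assoc)
  moreover have "clinear_on H (\<lambda>u. S (T u))"
    using S T by (simp add: clinear_on_def bounded_on_def Pi_iff)
  ultimately show ?thesis using S T by (auto simp: bounded_on_def)
qed

text \<open>
  Solve \<open>P u + N u = z\<close> for the unknown \<open>y = P u\<close>: the map \<open>y \<mapsto> z - N (P\<^sup>-\<^sup>1 y)\<close> is a contraction, for
  any choice of preimages.
\<close>

lemma surj_contraction:
  fixes H :: "'e::real_normed_vector set" and P N :: "'d \<Rightarrow> 'e"
  assumes H: "complete H" "H \<noteq> {}" "\<And>u v. u \<in> H \<Longrightarrow> v \<in> H \<Longrightarrow> u - v \<in> H"
      "\<And>u v. u \<in> H \<Longrightarrow> v \<in> H \<Longrightarrow> u + v \<in> H"
    and P: "P ` I = H" and N: "N ` I \<subseteq> H" and t: "0 \<le> \<theta>" "\<theta> < 1"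
    and le: "\<And>u v. u \<in> I \<Longrightarrow> v \<in> I \<Longrightarrow> norm (N u - N v) \<le> \<theta> * norm (P u - P v)"
  shows "(\<lambda>u. P u + N u) ` I = H"
proof
  show "(\<lambda>u. P u + N u) ` I \<subseteq> H" using P N H(4) by auto
  show "H \<subseteq> (\<lambda>u. P u + N u) ` I"
  proof
    fix z assume z: "z \<in> H"
    define R where "R = inv_into I P"
    have R: "R y \<in> I" "P (R y) = y" if "y \<in> H" for y
      using that P by (auto simp: R_def inv_into_into f_inv_into_f)
    have "\<exists>!y\<in>H. z - N (R y) = y"
    proof (rule Banach_fix[OF H(1,2) t])
      show "(\<lambda>y. z - N (R y)) ` H \<subseteq> H" using z R(1) N H(3) by (auto simp: image_subset_iff)
      show "\<And>x y. x \<in> H \<Longrightarrow> y \<in> H \<Longrightarrow> dist (z - N (R x)) (z - N (R y)) \<le> \<theta> * dist x y"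
        using le[OF R(1) R(1)] R by (simp add: dist_norm norm_minus_commute)
    qed
    then obtain y where y: "y \<in> H" "z - N (R y) = y" by blast
    then have "z = P (R y) + N (R y)" using R by (simp add: algebra_simps)
    then show "z \<in> (\<lambda>u. P u + N u) ` I" using R y by blast
  qed
qed

text \<open>
  Surjectivity persists along \<open>P + s N\<close> if \<open>N\<close> is bounded relative to \<open>P + s N\<close> uniformly in \<open>s\<close>: the path
  is cut into steps so short that each is a contraction.
\<close>

lemma surj_homotopy:
  fixes H :: "'e::complex_normed_vector set" and P N :: "'d::complex_normed_vector \<Rightarrow> 'e"
  assumes H: "complete H" "csubspace H" and I: "csubspace I"
    and P: "P ` I = H" and N: "N ` I \<subseteq> H" and lin: "clinear_on I P" "clinear_on I N"
    and le: "\<And>s u. 0 \<le> s \<Longrightarrow> s \<le> 1 \<Longrightarrow> u \<in> I \<Longrightarrow> norm (N u) \<le> L * norm (P u + s *\<^sub>R N u)"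
  shows "(\<lambda>u. P u + N u) ` I = H"
proof -
  obtain n :: nat where "max 0 L < n" using reals_Archimedean2 by blast
  then have n: "max 0 L < n" "0 < n" by auto
  have "(\<lambda>u. P u + (real k / real n) *\<^sub>R N u) ` I = H" if "k \<le> n" for k
    using that
  proof (induction k)
    case 0
    show ?case using P by simp
  next
    case (Suc k)
    let ?P = "\<lambda>u. P u + (real k / real n) *\<^sub>R N u"
    have "(\<lambda>u. ?P u + (1 / real n) *\<^sub>R N u) ` I = H"
    proof (rule surj_contraction[of H _ _ _ "max 0 L / n"])
      show "(\<lambda>u. (1 / real n) *\<^sub>R N u) ` I \<subseteq> H"
        using N csubspaceD(4)[OF H(2)] by (auto simp: image_subset_iff)
      show "(\<lambda>u. P u + (real k / real n) *\<^sub>R N u) ` I = H" using Suc by simp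
      show "H \<noteq> {}" using csubspaceD(1)[OF H(2)] by auto
      fix u v assume uv: "u \<in> I" "v \<in> I"
      have w: "u - v \<in> I" by (rule csubspaceD(6)[OF I uv])
      note d = clinear_onD(6)[OF lin(1) I uv] clinear_onD(6)[OF lin(2) I uv]
      have "norm ((1 / real n) *\<^sub>R N u - (1 / real n) *\<^sub>R N v) = norm (N (u - v)) / n"
        by (simp add: d(2) flip: scaleR_diff_right)
      also have "\<dots> \<le> max 0 L * norm (?P (u - v)) / n"
      proof (intro divide_right_mono)
        have "norm (N (u - v)) \<le> L * norm (?P (u - v))" using Suc.prems n w by (intro le) simp_all
        also have "\<dots> \<le> max 0 L * norm (?P (u - v))" by (intro mult_right_mono) simp_all
        finally show "norm (N (u - v)) \<le> max 0 L * norm (?P (u - v))" .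
      qed simp
      also have "?P (u - v) = ?P u - ?P v" by (simp add: d algebra_simps)
      finally show "norm ((1 / real n) *\<^sub>R N u - (1 / real n) *\<^sub>R N v) \<le> max 0 L / n * norm (?P u - ?P v)"
        by simp
    qed (use H(1) n csubspaceD(2,6)[OF H(2)] in \<open>simp_all\<close>)
    moreover have "?P u + (1 / real n) *\<^sub>R N u = P u + (real (Suc k) / real n) *\<^sub>R N u" for u
      by (simp add: add_divide_distrib algebra_simps)
    ultimately show ?case by simp
  qed
  from this[of n] n show ?thesis by simp
qed

text \<open>
  The constant \<open>K\<close> is there so that \<open>E \<oplus> E\<close> fits in: with the Euclidean norm of a product
  type, the norm is only equivalent to the one given by the inner product.
\<close>

locale inner_module =
  fixes H :: "'e::complex_normed_vector set" and ip :: "'e \<Rightarrow> 'e \<Rightarrow> 'b::cstar_algebra" and K :: real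
  assumes csub: "csubspace H" and complete: "complete H" and K: "1 \<le> K"
    and ip_add: "u \<in> H \<Longrightarrow> v \<in> H \<Longrightarrow> w \<in> H \<Longrightarrow> ip u (v + w) = ip u v + ip u w"
    and ip_scaleC: "u \<in> H \<Longrightarrow> v \<in> H \<Longrightarrow> ip u (c *\<^sub>C v) = c *\<^sub>C ip u v"
    and ip_star: "u \<in> H \<Longrightarrow> v \<in> H \<Longrightarrow> star (ip u v) = ip v u"
    and ip_pos: "u \<in> H \<Longrightarrow> pos (ip u u)"
    and ip_le: "u \<in> H \<Longrightarrow> v \<in> H \<Longrightarrow> norm (ip u v) \<le> norm u * norm v"
    and norm_le_ip: "u \<in> H \<Longrightarrow> (norm u)\<^sup>2 \<le> K * norm (ip u u)"
begin

lemmas mem [simp] = csubspaceD[OF csub]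

lemma closed_H: "closed H"
  using complete by (rule complete_imp_closed)

lemma ip_scaleR: "u \<in> H \<Longrightarrow> v \<in> H \<Longrightarrow> ip u (r *\<^sub>R v) = r *\<^sub>R ip u v"
  by (simp add: scaleR_scaleC ip_scaleC)

lemma ip_minus: "u \<in> H \<Longrightarrow> v \<in> H \<Longrightarrow> ip u (- v) = - ip u v"
  using ip_scaleR[of u v "-1"] by simp

lemma ip_diff: "u \<in> H \<Longrightarrow> v \<in> H \<Longrightarrow> w \<in> H \<Longrightarrow> ip u (v - w) = ip u v - ip u w"
  using ip_add[of u v "- w"] by (simp add: ip_minus)

lemma ip_add_left: "u \<in> H \<Longrightarrow> v \<in> H \<Longrightarrow> w \<in> H \<Longrightarrow> ip (v + w) u = ip v u + ip w u"
  using arg_cong[OF ip_add[of u v w], of star] by (simp add: ip_star star_add)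

lemma ip_scaleC_left: "u \<in> H \<Longrightarrow> v \<in> H \<Longrightarrow> ip (c *\<^sub>C v) u = cnj c *\<^sub>C ip v u"
  using arg_cong[OF ip_scaleC[of u v c], of star] by (simp add: ip_star star_scaleC)

lemma ip_scaleR_left: "u \<in> H \<Longrightarrow> v \<in> H \<Longrightarrow> ip (r *\<^sub>R v) u = r *\<^sub>R ip v u"
  by (simp add: scaleR_scaleC ip_scaleC_left)

lemma ip_minus_left: "u \<in> H \<Longrightarrow> v \<in> H \<Longrightarrow> ip (- v) u = - ip v u"
  using ip_scaleR_left[of u v "-1"] by simp

lemma ip_diff_left: "u \<in> H \<Longrightarrow> v \<in> H \<Longrightarrow> w \<in> H \<Longrightarrow> ip (v - w) u = ip v u - ip w u"
  using ip_add_left[of u v "- w"] by (simp add: ip_minus_left)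

lemma ip_self_eq_0: "u \<in> H \<Longrightarrow> ip u u = 0 \<Longrightarrow> u = 0"
  using norm_le_ip[of u] by simp

text \<open>
  The parts \<open>\<langle>u, a\<rangle>\<close> and \<open>\<langle>u, b\<rangle>\<close> are the real and imaginary parts of \<open>\<langle>u, a \<plusminus> i b\<rangle>\<close>, and the imaginary part
  dominates \<open>m \<langle>u, u\<rangle>\<close>.
\<close>

lemma bounded_below:
  assumes u: "u \<in> H" and ab: "a \<in> H" "b \<in> H" and a: "star (ip u a) = ip u a"
    and b: "pos (ip u b - m *\<^sub>R ip u u)" and m: "0 \<le> m" and s: "\<sigma> = 1 \<or> \<sigma> = -1"
  shows "m * norm u \<le> K * norm (a + (\<i> * of_real \<sigma>) *\<^sub>C b)"
proof (cases "u = 0")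
  case False
  let ?z = "a + (\<i> * of_real \<sigma>) *\<^sub>C b"
  have z: "?z \<in> H" using ab by simp
  have sr: "star (ip u b) = ip u b"
    using pos_selfadj[OF b] pos_selfadj[OF ip_pos[OF u]] by (simp add: star_diff star_scaleR)
  have q: "ip u ?z = ip u a + (\<i> * of_real \<sigma>) *\<^sub>C ip u b" using u ab by (simp add: ip_add ip_scaleC)
  have "ip u ?z - star (ip u ?z) = (2 * (\<i> * of_real \<sigma>)) *\<^sub>C ip u b"
    unfolding q mult_2 scaleC_add_left by (simp add: a star_add star_scaleC sr scaleC_minus_left)
  then have "norm (ip u ?z - star (ip u ?z)) = cmod (2 * (\<i> * of_real \<sigma>)) * norm (ip u b)"
    by (simp only: norm_scaleC)
  also have "cmod (2 * (\<i> * of_real \<sigma>)) = 2" using s by (auto simp: norm_mult)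
  finally have "2 * norm (ip u b) = norm (ip u ?z - star (ip u ?z))" by (rule sym)
  also have "\<dots> \<le> 2 * norm (ip u ?z)" using norm_triangle_ineq4[of "ip u ?z" "star (ip u ?z)"] by simp
  finally have "norm (ip u b) \<le> norm u * norm ?z" using ip_le[OF u z] by simp
  moreover have "m * norm (ip u u) \<le> norm (ip u b)"
    using pos_norm_mono[OF pos_scaleR[OF ip_pos[OF u] m] b] m by simp
  ultimately have "m * norm (ip u u) \<le> norm u * norm ?z" by linarith
  then have "K * (m * norm (ip u u)) \<le> K * (norm u * norm ?z)"
    using K by (intro mult_left_mono) simp_all
  moreover have "m * (norm u)\<^sup>2 \<le> m * (K * norm (ip u u))"
    using norm_le_ip[OF u] m by (intro mult_left_mono)
  moreover have "m * (K * norm (ip u u)) = K * (m * norm (ip u u))" by (rule mult.left_commute)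
  ultimately have "m * (norm u)\<^sup>2 \<le> K * (norm u * norm ?z)" by (metis order_trans)
  moreover have "m * (norm u)\<^sup>2 = norm u * (m * norm u)" "K * (norm u * norm ?z) = norm u * (K * norm ?z)"
    by (simp_all only: power2_eq_square ac_simps)
  ultimately have "norm u * (m * norm u) \<le> norm u * (K * norm ?z)" by (simp only:)
  then show ?thesis by (rule mult_left_le_imp_le) (use False in simp)
qed (use K in simp)

lemma positive_shift_bounded_below:
  assumes u: "u \<in> H" and T: "T u \<in> H" and pos: "pos (ip u (T u))" and m: "0 \<le> \<delta>"
  shows "\<delta> * norm u \<le> K * norm (T u + \<delta> *\<^sub>R u)"
proof -
  have "\<delta> * norm u \<le> K * norm (0 + (\<i> * of_real 1) *\<^sub>C (T u + \<delta> *\<^sub>R u))"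
    by (rule bounded_below) (use u T pos m in \<open>auto simp: ip_add ip_scaleR ip_diff[of u u u, simplified]\<close>)
  then show ?thesis by (simp add: norm_scaleC)
qed

text \<open>
  Adding a large multiple of the identity makes \<open>T\<close> a small perturbation; from there the shift is decreased to \<open>\<delta>\<close>
  along operators that stay bounded below by \<open>\<delta>\<close>.
\<close>

lemma positive_shift_surj:
  assumes T: "bounded_on H T" and pos: "\<And>u. u \<in> H \<Longrightarrow> pos (ip u (T u))" and d: "0 < \<delta>"
  shows "(\<lambda>u. T u + \<delta> *\<^sub>R u) ` H = H"
proof -
  obtain C where C: "0 \<le> C" "\<forall>u\<in>H. norm (T u) \<le> C * norm u" using bounded_onD(3)[OF T] by auto
  note lin = bounded_onD(2)[OF T]
  define \<nu> where "\<nu> = 2 * C + 1 + \<delta>"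
  have \<nu>: "0 < \<nu>" using C d by (simp add: \<nu>_def)
  have "(\<lambda>u. \<nu> *\<^sub>R u + T u) ` H = H"
  proof (rule surj_contraction[OF complete, of _ _ _ "1/2"])
    show "H \<noteq> {}" using mem(1) by blast
    have "u \<in> (\<lambda>u. \<nu> *\<^sub>R u) ` H" if "u \<in> H" for u
      using that \<nu> by (intro image_eqI[of _ _ "inverse \<nu> *\<^sub>R u"]) auto
    then show "(\<lambda>u. \<nu> *\<^sub>R u) ` H = H" by auto
    fix u v assume uv: "u \<in> H" "v \<in> H"
    have "norm (T u - T v) \<le> C * norm (u - v)"
      using C(2) uv clinear_onD(6)[OF lin csub uv] by (metis mem(6))
    also have "\<dots> \<le> (\<nu> / 2) * norm (u - v)" using d by (intro mult_right_mono) (auto simp: \<nu>_def)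
    also have "\<dots> = 1/2 * norm (\<nu> *\<^sub>R u - \<nu> *\<^sub>R v)"
      using \<nu> by (simp flip: scaleR_diff_right)
    finally show "norm (T u - T v) \<le> 1/2 * norm (\<nu> *\<^sub>R u - \<nu> *\<^sub>R v)" .
  qed (use bounded_onD(1)[OF T] in \<open>auto\<close>)
  then have "(\<lambda>u. (\<nu> *\<^sub>R u + T u) + (- (\<nu> - \<delta>)) *\<^sub>R u) ` H = H"
  proof (rule surj_homotopy[OF complete csub csub, where L = "(\<nu> - \<delta>) * (K / \<delta>)"])
    fix s :: real and u assume s: "0 \<le> s" "s \<le> 1" and u: "u \<in> H"
    let ?k = "\<nu> - s * (\<nu> - \<delta>)"
    have "(1 - s) * \<delta> \<le> (1 - s) * \<nu>" using s C by (intro mult_left_mono) (auto simp: \<nu>_def)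
    then have k: "\<delta> \<le> ?k" by (simp add: algebra_simps)
    have "\<delta> * norm u \<le> ?k * norm u" using k by (simp add: mult_right_mono)
    also have "\<dots> \<le> K * norm (T u + ?k *\<^sub>R u)"
      by (rule positive_shift_bounded_below[where T = T, OF u bounded_onD(1)[OF T u] pos[OF u]]) (use k d in simp)
    finally have "norm u \<le> (K / \<delta>) * norm (T u + ?k *\<^sub>R u)" using d by (simp add: field_simps)
    then have "(\<nu> - \<delta>) * norm u \<le> (\<nu> - \<delta>) * ((K / \<delta>) * norm (T u + ?k *\<^sub>R u))"
      using C by (intro mult_left_mono) (simp_all add: \<nu>_def)
    moreover have "T u + ?k *\<^sub>R u = \<nu> *\<^sub>R u + T u + s *\<^sub>R (- (\<nu> - \<delta>)) *\<^sub>R u"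
      by (simp add: algebra_simps)
    moreover have "norm ((- (\<nu> - \<delta>)) *\<^sub>R u) = (\<nu> - \<delta>) * norm u"
      using C unfolding norm_scaleR by (simp add: \<nu>_def)
    ultimately show "norm ((- (\<nu> - \<delta>)) *\<^sub>R u) \<le> (\<nu> - \<delta>) * (K / \<delta>) * norm (\<nu> *\<^sub>R u + T u + s *\<^sub>R (- (\<nu> - \<delta>)) *\<^sub>R u)"
      by (simp only: mult.assoc)
  qed (use lin in \<open>auto simp: clinear_on_def scaleR_add_right scaleC_add_right scaleC_scaleR\<close>)
  moreover have "(\<lambda>u. (\<nu> *\<^sub>R u + T u) + (- (\<nu> - \<delta>)) *\<^sub>R u) = (\<lambda>u. T u + \<delta> *\<^sub>R u)"
    by (simp add: algebra_simps)
  ultimately show ?thesis by (simp only:)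
qed

end

section \<open>Localizing a selfadjoint operator\<close>

context inner_module
begin

text \<open>
  The heart of the matter, for a selfadjoint regular \<open>D\<close>: since \<open>x (D x* x + i\<mu>) y = (x D x* + i\<mu>) x y\<close>, it
  says that \<open>x D x* + i\<mu>\<close> has dense range in the closure of the range of \<open>x\<close>, with approximate
  preimages in the image of the domain under \<open>x\<close>.
\<close>

lemma localized_resolvent_approx:
  assumes Dm: "csubspace Dm" "Dm \<subseteq> H" and D: "D \<in> Dm \<rightarrow> H" "clinear_on Dm D"
    and sym: "\<And>u v. u \<in> Dm \<Longrightarrow> v \<in> Dm \<Longrightarrow> ip (D u) v = ip u (D v)"
    and surj: "\<And>\<sigma>. \<sigma> = 1 \<or> \<sigma> = -1 \<Longrightarrow> (\<lambda>u. D u + (\<i> * of_real \<sigma>) *\<^sub>C u) ` Dm = H"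
    and x: "bounded_on H x" and x': "bounded_on H x'"
    and adj: "\<And>u v. u \<in> H \<Longrightarrow> v \<in> H \<Longrightarrow> ip (x u) v = ip u (x' v)"
    and xD: "x \<in> Dm \<rightarrow> Dm" "x' \<in> Dm \<rightarrow> Dm"
    and d: "bounded_on H d" and d': "bounded_on H d'"
    and comm: "\<And>u. u \<in> Dm \<Longrightarrow> D (x u) = x (D u) + d u" "\<And>u. u \<in> Dm \<Longrightarrow> D (x' u) = x' (D u) + d' u"
  shows "\<exists>\<mu>\<^sub>0>0. \<forall>\<mu> \<sigma>. (\<sigma> = 1 \<or> \<sigma> = -1) \<longrightarrow> \<mu>\<^sub>0 \<le> \<mu> \<longrightarrow> (\<forall>w\<in>H. \<forall>e>0. \<exists>y\<in>Dm.
    norm (x (D (x' (x y)) + (\<i> * of_real \<sigma>) *\<^sub>C \<mu> *\<^sub>R y - w)) < e)"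
proof -
  note DH = funcset_mem[OF D(1)] and xDm = funcset_mem[OF xD(1)] and x'Dm = funcset_mem[OF xD(2)]
  note bops = x x' d d'
  note ran = bops[THEN bounded_onD(1)]
  note Dsub = subsetD[OF Dm(2)]
  note Dmem = csubspaceD[OF Dm(1)]
  define \<Theta> where "\<Theta> u = x' (x u)" for u
  have \<Theta>: "bounded_on H \<Theta>" unfolding \<Theta>_def[abs_def] by (rule bounded_on_comp[OF x' x])
  have \<Theta>D: "\<Theta> u \<in> Dm" if "u \<in> Dm" for u using that by (simp add: \<Theta>_def xDm x'Dm)
  have \<Theta>pos: "pos (ip u (\<Theta> u))" if "u \<in> H" for u
    using adj[OF that ran(1)[OF that]] ip_pos[OF ran(1)[OF that]] by (simp add: \<Theta>_def)
  have D\<Theta>: "D (\<Theta> u) = x' (D (x u)) + d' (x u)" if "u \<in> Dm" for u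
    using that comm(2)[OF xDm] by (simp add: \<Theta>_def)
  have D\<Theta>': "D (\<Theta> u) = \<Theta> (D u) + (x' (d u) + d' (x u))" if "u \<in> Dm" for u
    using that by (simp add: D\<Theta> comm(1) clinear_onD(1)[OF bounded_onD(2)[OF x']] ran DH Dsub)
      (simp add: \<Theta>_def)
  have d'x: "bounded_on H (\<lambda>u. d' (x u))" by (rule bounded_on_comp[OF d' x])
  have x'd: "bounded_on H (\<lambda>u. x' (d u))" by (rule bounded_on_comp[OF x' d])
  obtain c where c: "0 \<le> c" "\<And>u. u \<in> H \<Longrightarrow> norm (d' (x u)) \<le> c * norm u" using bounded_onD(3)[OF d'x] by auto
  obtain c' where c': "0 \<le> c'" "\<And>u. u \<in> H \<Longrightarrow> norm (x' (d u)) \<le> c' * norm u" using bounded_onD(3)[OF x'd] by auto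
  obtain cT where cT: "0 \<le> cT" "\<And>u. u \<in> H \<Longrightarrow> norm (\<Theta> u) \<le> cT * norm u" using bounded_onD(3)[OF \<Theta>] by auto
  note lin = d'x[THEN bounded_onD(2)] x'd[THEN bounded_onD(2)] \<Theta>[THEN bounded_onD(2)]
  \<comment> \<open>The symmetric operator \<open>x* D x\<close> differs from \<open>D \<Theta>\<close> by \<open>d' x\<close>, of norm at most \<open>c\<close>; the shift has to dominate it.\<close>
  define \<mu>\<^sub>0 where "\<mu>\<^sub>0 = K * c + 1"
  have "\<exists>y\<in>Dm. norm (x (D (\<Theta> y) + (\<i> * of_real \<sigma>) *\<^sub>C \<mu> *\<^sub>R y - w)) < e"
    if s: "\<sigma> = 1 \<or> \<sigma> = -1" and \<mu>: "\<mu>\<^sub>0 \<le> \<mu>" and w: "w \<in> H" and e: "0 < e" for \<mu> \<sigma> w e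
  proof -
    let ?i = "\<i> * complex_of_real \<sigma>"
    have ni: "cmod ?i = 1" using s by (auto simp: norm_mult)
    have \<mu>0: "0 < \<mu>" using \<mu> K c by (simp add: \<mu>\<^sub>0_def add_nonneg_pos less_le_trans[of 0 "K * c + 1"])
    \<comment> \<open>\<open>P \<epsilon>\<close> is the operator to be inverted, and \<open>s Q \<epsilon>\<close> with \<open>s \<ge> 0\<close> only increases its imaginary part.\<close>
    define P where "P \<epsilon> u = D (\<Theta> u) + \<epsilon> *\<^sub>R D u + ?i *\<^sub>C \<mu> *\<^sub>R u" for \<epsilon> u
    define Q where "Q \<epsilon> u = ?i *\<^sub>C (\<Theta> u + \<epsilon> *\<^sub>R u)" for \<epsilon> u
    have PH: "P \<epsilon> u \<in> H" "Q \<epsilon> u \<in> H" if "u \<in> Dm" for \<epsilon> u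
      using that by (simp_all add: P_def Q_def DH \<Theta>D Dsub \<Theta>[THEN bounded_onD(1)])
    have linD: "clinear_on Dm (\<lambda>u. D (\<Theta> u))"
      using D(2) lin(3) Dsub \<Theta>D by (simp add: clinear_on_def)
    have linP: "clinear_on Dm (P \<epsilon>)" "clinear_on Dm (Q \<epsilon>)" for \<epsilon>
      using linD D(2) lin(3) Dsub
      by (simp_all add: clinear_on_def P_def Q_def scaleC_add_right scaleC_scaleC scaleC_scaleR scaleR_add_right mult.commute)
    have below: "norm u \<le> K * norm (P \<epsilon> u + s *\<^sub>R Q \<epsilon> u)"
      if u: "u \<in> Dm" and s0: "0 \<le> s" and e0: "0 \<le> \<epsilon>" for u s \<epsilon>
    proof -
      note uH = Dsub[OF u]
      let ?a = "x' (D (x u)) + \<epsilon> *\<^sub>R D u" and ?b = "\<mu> *\<^sub>R u + s *\<^sub>R (\<Theta> u + \<epsilon> *\<^sub>R u)"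
      have aH: "x' (D (x u)) \<in> H" "D u \<in> H" "D (x u) \<in> H" "x u \<in> H" "x u \<in> Dm"
        using u by (simp_all add: ran DH xDm Dsub)
      have "ip u ?a = ip (x u) (D (x u)) + \<epsilon> *\<^sub>R ip u (D u)"
        using uH aH by (simp add: ip_add ip_scaleR adj)
      then have a: "star (ip u ?a) = ip u ?a"
        using uH aH u by (simp add: star_add star_scaleR ip_star sym)
      have "ip u ?b - \<mu> *\<^sub>R ip u u = s *\<^sub>R (ip u (\<Theta> u) + \<epsilon> *\<^sub>R ip u u)"
        using uH by (simp add: ip_add ip_scaleR \<Theta>[THEN bounded_onD(1)])
      then have b: "pos (ip u ?b - \<mu> *\<^sub>R ip u u)"
        using s0 e0 uH by (simp add: pos_scaleR pos_add \<Theta>pos ip_pos)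
      have "\<mu> * norm u \<le> K * norm (?a + ?i *\<^sub>C ?b)"
        by (rule bounded_below[OF uH _ _ a b _ s]) (use uH aH \<mu>0 in \<open>simp_all add: \<Theta>[THEN bounded_onD(1)]\<close>)
      also have "?a + ?i *\<^sub>C ?b = (P \<epsilon> u + s *\<^sub>R Q \<epsilon> u) - d' (x u)"
        using u by (simp add: P_def Q_def D\<Theta> scaleC_add_right scaleC_scaleR)
      also have "K * norm \<dots> \<le> K * norm (P \<epsilon> u + s *\<^sub>R Q \<epsilon> u) + K * (c * norm u)"
        using norm_triangle_ineq4[of "P \<epsilon> u + s *\<^sub>R Q \<epsilon> u" "d' (x u)"] c(2)[OF uH] K
        unfolding distrib_left[symmetric] by (intro mult_left_mono) simp_all
      finally have "\<mu> * norm u - (K * c) * norm u \<le> K * norm (P \<epsilon> u + s *\<^sub>R Q \<epsilon> u)" by simp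
      moreover have "(\<mu> - K * c) * norm u \<ge> 1 * norm u"
        using \<mu> by (intro mult_right_mono) (simp_all add: \<mu>\<^sub>0_def)
      ultimately show ?thesis by (simp add: left_diff_distrib)
    qed
    \<comment> \<open>For a large multiple of \<open>Q \<epsilon>\<close>, the sum \<open>P \<epsilon> + \<nu> Q \<epsilon>\<close> is \<open>(\<Theta> + \<epsilon>)(D + i\<nu>)\<close> up to a bounded operator \<open>N\<close>;
       \<open>below\<close> allows a return to \<open>P \<epsilon>\<close>.\<close>
    have surjP: "P \<epsilon> ` Dm = H" if e0: "0 < \<epsilon>" for \<epsilon>
    proof -
      define M where "M = c' + c + \<mu>"
      define N where "N u = x' (d u) + d' (x u) + ?i *\<^sub>C \<mu> *\<^sub>R u" for u
      have M: "norm (N u) \<le> M * norm u" if "u \<in> H" for u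
        using c(2)[OF that] c'(2)[OF that] ni \<mu>0 unfolding N_def M_def distrib_right
        by (intro norm_triangle_le) (auto simp: norm_scaleC norm_mult intro!: add_mono norm_triangle_le)
      have linN: "clinear_on H N" using lin by (simp add: clinear_on_def N_def scaleC_add_right
          scaleR_add_right scaleC_scaleR scaleC_scaleC mult.commute)
      \<comment> \<open>Large enough that \<open>N\<close> is half as big as \<open>G R = (\<Theta> + \<epsilon>)(D + i\<nu>)\<close>, which is bounded below by \<open>\<epsilon> \<nu> / K\<^sup>2\<close>.\<close>
      define \<nu> where "\<nu> = 1 + 2 * M * K * K / \<epsilon>"
      have M0: "0 \<le> M" using c c' \<mu>0 by (simp add: M_def)
      have \<nu>1: "1 \<le> \<nu>" using M0 K e0 by (simp add: \<nu>_def)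
      define R where "R u = D u + ?i *\<^sub>C \<nu> *\<^sub>R u" for u
      have linR: "clinear_on Dm R" using D(2) by (simp add: clinear_on_def R_def scaleC_add_right
          scaleR_add_right scaleC_scaleR scaleC_scaleC mult.commute)
      have Rbelow: "t * norm u \<le> K * norm (D u + ?i *\<^sub>C t *\<^sub>R u)" if "u \<in> Dm" "0 \<le> t" for u t
        using that Dsub[OF that(1)] DH[OF that(1)]
        by (intro bounded_below s) (simp_all add: ip_star sym ip_scaleR ip_diff[of u u u, simplified] pos_scaleR[OF ip_pos, of u 0, simplified])
      have "(\<lambda>u. (D u + ?i *\<^sub>C u) + ?i *\<^sub>C (\<nu> - 1) *\<^sub>R u) ` Dm = H"
      proof (rule surj_homotopy[OF complete csub Dm(1) surj[OF s], where L = "(\<nu> - 1) * K"])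
        fix t :: real and u assume t: "0 \<le> t" "t \<le> 1" and u: "u \<in> Dm"
        have "1 * norm u \<le> (1 + t * (\<nu> - 1)) * norm u" using t \<nu>1 by (intro mult_right_mono) simp_all
        also have "\<dots> \<le> K * norm (D u + ?i *\<^sub>C (1 + t * (\<nu> - 1)) *\<^sub>R u)"
          using Rbelow[OF u, of "1 + t * (\<nu> - 1)"] t \<nu>1 by simp
        also have "D u + ?i *\<^sub>C (1 + t * (\<nu> - 1)) *\<^sub>R u = D u + ?i *\<^sub>C u + t *\<^sub>R ?i *\<^sub>C (\<nu> - 1) *\<^sub>R u"
          by (simp add: scaleR_add_left scaleC_add_right scaleC_scaleR)
        finally have "(\<nu> - 1) * (1 * norm u) \<le> (\<nu> - 1) * (K * norm (D u + ?i *\<^sub>C u + t *\<^sub>R ?i *\<^sub>C (\<nu> - 1) *\<^sub>R u))"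
          using \<nu>1 by (intro mult_left_mono) simp_all
        then show "norm (?i *\<^sub>C (\<nu> - 1) *\<^sub>R u) \<le> (\<nu> - 1) * K * norm (D u + ?i *\<^sub>C u + t *\<^sub>R ?i *\<^sub>C (\<nu> - 1) *\<^sub>R u)"
          using \<nu>1 by (simp add: norm_scaleC ni mult.assoc)
      qed (use D(2) Dsub in \<open>auto simp: clinear_on_def scaleC_add_right
          scaleR_add_right scaleC_scaleR scaleC_scaleC mult.commute\<close>)
      moreover have "(D u + ?i *\<^sub>C u) + ?i *\<^sub>C (\<nu> - 1) *\<^sub>R u = R u" for u
        by (simp add: R_def scaleR_diff_left scaleC_diff_right)
      ultimately have surjR: "R ` Dm = H" by simp
      define G where "G v = \<Theta> v + \<epsilon> *\<^sub>R v" for v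
      have surjG: "G ` H = H" unfolding G_def using \<Theta> \<Theta>pos e0 by (intro positive_shift_surj) auto
      have linG: "clinear_on H G" using lin by (simp add: clinear_on_def G_def scaleC_add_right
          scaleR_add_right scaleC_scaleR)
      have Gbelow: "\<epsilon> * norm v \<le> K * norm (G v)" if "v \<in> H" for v
        unfolding G_def using that e0 \<Theta>[THEN bounded_onD(1)] \<Theta>pos by (intro positive_shift_bounded_below) auto
      have surjGR: "(\<lambda>u. G (R u)) ` Dm = H" using surjG surjR by (metis image_image)
      have eq: "P \<epsilon> u + \<nu> *\<^sub>R Q \<epsilon> u = G (R u) + N u" if u: "u \<in> Dm" for u
      proof -
        note uH = Dsub[OF u]
        have "\<Theta> (D u + ?i *\<^sub>C \<nu> *\<^sub>R u) = \<Theta> (D u) + ?i *\<^sub>C \<nu> *\<^sub>R \<Theta> u"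
          using uH DH[OF u] by (simp add: clinear_onD[OF lin(3)])
        then show ?thesis
          by (simp add: P_def Q_def G_def R_def N_def D\<Theta>'[OF u] scaleC_add_right scaleR_add_right
              scaleC_scaleR mult.commute)
      qed
      have RH: "R u \<in> H" if "u \<in> Dm" for u using that by (simp add: R_def DH Dsub)
      have "(\<lambda>u. G (R u) + N u) ` Dm = H"
      proof (rule surj_contraction[OF complete _ _ _ surjGR, where \<theta> = "1/2"])
        show "H \<noteq> {}" using mem(1) by blast
        show "N ` Dm \<subseteq> H" using ran Dsub by (auto simp: N_def)
        fix u v assume uv: "u \<in> Dm" "v \<in> Dm"
        then have uv': "u \<in> H" "v \<in> H" "u - v \<in> H" "u - v \<in> Dm" by (auto simp: Dsub Dmem)
        have eN: "N u - N v = N (u - v)" using clinear_onD(6)[OF linN csub] uv' by simp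
        have eG: "G (R u) - G (R v) = G (R (u - v))"
          using clinear_onD(6)[OF linG csub RH RH] clinear_onD(6)[OF linR Dm(1)] uv by simp
        let ?z = "u - v"
        have 1: "\<nu> * norm ?z \<le> K * norm (R ?z)" using Rbelow[OF uv'(4), of \<nu>] \<nu>1 by (simp add: R_def)
        have 2: "\<epsilon> * norm (R ?z) \<le> K * norm (G (R ?z))" using Gbelow RH uv' by simp
        have "(2 * M * K * K / \<epsilon>) * norm ?z \<le> \<nu> * norm ?z" by (intro mult_right_mono) (simp_all add: \<nu>_def)
        with 1 have "(2 * M * K * K / \<epsilon>) * norm ?z \<le> K * norm (R ?z)" by linarith
        then have "(2 * M * K * K / \<epsilon>) * norm ?z * \<epsilon> \<le> K * norm (R ?z) * \<epsilon>"
          using e0 by (intro mult_right_mono) simp_all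
        then have "2 * M * K * K * norm ?z \<le> K * (\<epsilon> * norm (R ?z))" using e0 by (simp add: mult_ac)
        also have "\<dots> \<le> K * (K * norm (G (R ?z)))" using 2 K by (intro mult_left_mono) simp_all
        finally have "(K * K) * (2 * (M * norm ?z)) \<le> (K * K) * norm (G (R ?z))" by (simp add: mult_ac)
        then have "2 * (M * norm ?z) \<le> norm (G (R ?z))" using K by simp
        then show "norm (N u - N v) \<le> 1/2 * norm (G (R u) - G (R v))"
          unfolding eN eG using M[OF uv'(3)] by simp
      qed simp_all
      then have 3: "(\<lambda>u. P \<epsilon> u + \<nu> *\<^sub>R Q \<epsilon> u) ` Dm = H" using eq by (simp cong: image_cong)
      obtain cQ where cQ: "0 \<le> cQ" "\<And>u. u \<in> Dm \<Longrightarrow> norm (Q \<epsilon> u) \<le> cQ * norm u"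
      proof
        show "0 \<le> cT + \<epsilon>" using cT e0 by simp
        show "norm (Q \<epsilon> u) \<le> (cT + \<epsilon>) * norm u" if "u \<in> Dm" for u
          unfolding Q_def norm_scaleC ni using cT(2)[OF Dsub[OF that]] e0
          by (auto simp: distrib_right intro!: norm_triangle_le)
      qed
      have "(\<lambda>u. (P \<epsilon> u + \<nu> *\<^sub>R Q \<epsilon> u) + (- \<nu>) *\<^sub>R Q \<epsilon> u) ` Dm = H"
      proof (rule surj_homotopy[OF complete csub Dm(1) 3, where L = "\<nu> * cQ * K"])
        fix t :: real and u assume t: "0 \<le> t" "t \<le> 1" and u: "u \<in> Dm"
        have eq: "P \<epsilon> u + \<nu> *\<^sub>R Q \<epsilon> u + t *\<^sub>R (- \<nu>) *\<^sub>R Q \<epsilon> u = P \<epsilon> u + (\<nu> - t * \<nu>) *\<^sub>R Q \<epsilon> u"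
          by (simp add: algebra_simps)
        have "t * \<nu> \<le> 1 * \<nu>" using t \<nu>1 by (intro mult_right_mono) simp_all
        then have b: "norm u \<le> K * norm (P \<epsilon> u + (\<nu> - t * \<nu>) *\<^sub>R Q \<epsilon> u)" using u e0 by (intro below) simp_all
        have "norm ((- \<nu>) *\<^sub>R Q \<epsilon> u) = \<nu> * norm (Q \<epsilon> u)" using \<nu>1 by simp
        also have "\<dots> \<le> \<nu> * (cQ * norm u)" using \<nu>1 cQ(2)[OF u] by (intro mult_left_mono) simp_all
        also have "\<dots> \<le> \<nu> * (cQ * (K * norm (P \<epsilon> u + (\<nu> - t * \<nu>) *\<^sub>R Q \<epsilon> u)))"
          using \<nu>1 cQ(1) b by (intro mult_left_mono) simp_all
        finally show "norm ((- \<nu>) *\<^sub>R Q \<epsilon> u) \<le> \<nu> * cQ * K * norm (P \<epsilon> u + \<nu> *\<^sub>R Q \<epsilon> u + t *\<^sub>R (- \<nu>) *\<^sub>R Q \<epsilon> u)"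
          unfolding eq by (simp only: mult.assoc)
      qed (use linP PH in \<open>auto simp: clinear_on_def scaleR_add_right scaleC_scaleR scaleC_add_right scaleC_minus_right\<close>)
      then show ?thesis by simp
    qed
    define C where "C = (1 + (\<mu> + c + c') * K) * norm w"
    \<comment> \<open>Chosen to make \<open>\<epsilon> K\<^sup>2 C\<^sup>2\<close>, the final bound for \<open>\<parallel>\<epsilon> x D y\<parallel>\<^sup>2\<close>, smaller than \<open>e\<^sup>2\<close>; adding \<open>1\<close> avoids a division by zero.\<close>
    define \<epsilon> where "\<epsilon> = e\<^sup>2 / (K\<^sup>2 * C\<^sup>2 + 1) / 2"
    have e0: "0 < \<epsilon>" using e by (simp add: \<epsilon>_def add_nonneg_pos)
    obtain y where y: "y \<in> Dm" "P \<epsilon> y = w" using surjP[OF e0] w by blast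
    note yH = Dsub[OF y(1)]
    define v where "v = D y"
    have vH: "v \<in> H" using DH y by (simp add: v_def)
    define w' where "w' = w - ?i *\<^sub>C \<mu> *\<^sub>R y - x' (d y) - d' (x y)"
    have Gv: "\<Theta> v + \<epsilon> *\<^sub>R v = w'"
      unfolding w'_def y(2)[symmetric] P_def D\<Theta>'[OF y(1)] by (simp add: v_def)
    have ny: "norm y \<le> K * norm w" using below[OF y(1), of 0 \<epsilon>] e0 y by simp
    have "norm w' \<le> norm w + \<mu> * norm y + c' * norm y + c * norm y"
      unfolding w'_def using \<mu>0 ni c(2)[OF yH] c'(2)[OF yH]
      by (intro norm_triangle_le_diff add_mono) (simp_all add: norm_scaleC norm_mult)
    also have "\<dots> = norm w + (\<mu> + c + c') * norm y" by (simp add: algebra_simps)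
    also have "\<dots> \<le> norm w + (\<mu> + c + c') * (K * norm w)"
      using \<mu>0 c c' ny by (intro add_left_mono mult_left_mono) simp_all
    also have "\<dots> = C" by (simp add: C_def algebra_simps)
    finally have w'C: "norm w' \<le> C" .
    have w'H: "w' \<in> H" unfolding Gv[symmetric] using vH by (simp add: \<Theta>[THEN bounded_onD(1)])
    have vw: "\<epsilon> * norm v \<le> K * norm w'"
      using positive_shift_bounded_below[of v \<Theta> \<epsilon>] vH e0 \<Theta>pos by (simp add: Gv \<Theta>[THEN bounded_onD(1)])
    \<comment> \<open>Pairing \<open>(\<Theta> + \<epsilon>) v = w'\<close> with \<open>v\<close> bounds \<open>x v\<close> by the geometric mean of \<open>v\<close> and \<open>w'\<close>, so \<open>\<epsilon> x v\<close> is of order \<open>\<surd>\<epsilon>\<close>.\<close>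
    have "ip (x v) (x v) + \<epsilon> *\<^sub>R ip v v = ip v w'"
      using vH by (simp add: Gv[symmetric] ip_add ip_scaleR \<Theta>[THEN bounded_onD(1)] adj ran)
        (simp add: \<Theta>_def)
    then have "norm (ip (x v) (x v)) \<le> norm (ip v w')"
      using pos_norm_mono[of "ip (x v) (x v)" "\<epsilon> *\<^sub>R ip v v"] vH e0 by (simp add: ran pos_scaleR ip_pos)
    also have "\<dots> \<le> norm v * norm w'" by (rule ip_le[OF vH w'H])
    finally have "K * norm (ip (x v) (x v)) \<le> K * (norm v * norm w')" using K by (intro mult_left_mono) simp_all
    then have "(norm (x v))\<^sup>2 \<le> K * (norm v * norm w')" using norm_le_ip[of "x v"] vH ran by auto
    then have "\<epsilon> * (norm (x v))\<^sup>2 \<le> \<epsilon> * (K * (norm v * norm w'))"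
      using e0 by (intro mult_left_mono) simp_all
    also have "\<dots> = K * norm w' * (\<epsilon> * norm v)" by (simp add: mult_ac)
    also have "\<dots> \<le> K * norm w' * (K * norm w')" using vw K by (intro mult_left_mono) simp_all
    also have "\<dots> \<le> K * C * (K * C)" using w'C K order_trans[OF norm_ge_zero w'C] by (intro mult_mono) simp_all
    finally have "\<epsilon> * (\<epsilon> * (norm (x v))\<^sup>2) \<le> \<epsilon> * (K * C * (K * C))" using e0 by (intro mult_left_mono) simp_all
    then have "(norm (\<epsilon> *\<^sub>R x v))\<^sup>2 \<le> \<epsilon> * (K\<^sup>2 * C\<^sup>2)"
      using e0 by (simp add: power2_eq_square mult_ac)
    also have "\<dots> \<le> \<epsilon> * (K\<^sup>2 * C\<^sup>2 + 1)" using e0 by simp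
    also have "\<dots> = e\<^sup>2 / 2"
    proof -
      have "K\<^sup>2 * C\<^sup>2 + 1 \<noteq> 0" using add_nonneg_pos[of "K\<^sup>2 * C\<^sup>2" 1] by simp
      moreover have "e\<^sup>2 / Z / 2 * Z = e\<^sup>2 / 2" if "Z \<noteq> 0" for Z :: real using that by simp
      ultimately show ?thesis unfolding \<epsilon>_def by blast
    qed
    also have "\<dots> < e\<^sup>2" using e by simp
    finally have small: "norm (\<epsilon> *\<^sub>R x v) < e" using e by (simp add: power_less_imp_less_base)
    have "D (\<Theta> y) + ?i *\<^sub>C \<mu> *\<^sub>R y - w = - (\<epsilon> *\<^sub>R v)"
      unfolding y(2)[symmetric] P_def v_def by simp
    moreover have "x (- (\<epsilon> *\<^sub>R v)) = - (\<epsilon> *\<^sub>R x v)"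
      using vH by (simp add: clinear_onD[OF bounded_onD(2)[OF x]])
    ultimately show ?thesis using small y(1) by (intro bexI[of _ y]) simp_all
  qed
  moreover have "0 < \<mu>\<^sub>0" using K c by (simp add: \<mu>\<^sub>0_def add_nonneg_pos)
  ultimately show ?thesis unfolding \<Theta>_def by (intro exI[of _ \<mu>\<^sub>0]) blast
qed

end

section \<open>Symmetric graphs with dense shifted ranges\<close>

lemma Cauchy_dominated:
  fixes z :: "nat \<Rightarrow> 'c::metric_space" and u :: "nat \<Rightarrow> 'd::metric_space"
  assumes z: "Cauchy z" and le: "\<And>m n. dist (u m) (u n) \<le> C * dist (z m) (z n)"
  shows "Cauchy u"
proof (rule metric_CauchyI)
  fix e :: real assume e: "0 < e"
  have "0 < e / (\<bar>C\<bar> + 1)" using e by (intro divide_pos_pos add_nonneg_pos) simp_all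
  then obtain M where M: "\<And>m n. m \<ge> M \<Longrightarrow> n \<ge> M \<Longrightarrow> dist (z m) (z n) < e / (\<bar>C\<bar> + 1)"
    using metric_CauchyD[OF z] by blast
  have "dist (u m) (u n) < e" if "m \<ge> M" "n \<ge> M" for m n
  proof -
    have "dist (u m) (u n) \<le> (\<bar>C\<bar> + 1) * dist (z m) (z n)"
      by (rule order_trans[OF le]) (intro mult_right_mono, simp_all)
    also have "\<dots> < e" using M[OF that] by (simp add: pos_less_divide_eq add_nonneg_pos mult.commute)
    finally show ?thesis .
  qed
  then show "\<exists>M. \<forall>m\<ge>M. \<forall>n\<ge>M. dist (u m) (u n) < e" by blast
qed

definition adjoint_rel :: "'e::complex_normed_vector set \<Rightarrow> ('e \<Rightarrow> 'e \<Rightarrow> 'b::cstar_algebra) \<Rightarrow> ('e \<times> 'e) set \<Rightarrow> ('e \<times> 'e) set"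
  where "adjoint_rel H ip D = {(y, z). y \<in> H \<and> z \<in> H \<and> (\<forall>(u, v)\<in>D. ip v y = ip u z)}"

lemma adjoint_relI: "y \<in> H \<Longrightarrow> z \<in> H \<Longrightarrow> (\<And>u v. (u, v) \<in> D \<Longrightarrow> ip v y = ip u z) \<Longrightarrow> (y, z) \<in> adjoint_rel H ip D"
  by (auto simp: adjoint_rel_def)

lemma adjoint_relD: "(y, z) \<in> adjoint_rel H ip D \<Longrightarrow> (u, v) \<in> D \<Longrightarrow> ip v y = ip u z"
  "(y, z) \<in> adjoint_rel H ip D \<Longrightarrow> y \<in> H" "(y, z) \<in> adjoint_rel H ip D \<Longrightarrow> z \<in> H"
  by (auto simp: adjoint_rel_def)

lemma csubspace_pairD:
  assumes "csubspace G"
  shows "(u, v) \<in> G \<Longrightarrow> (u', v') \<in> G \<Longrightarrow> (u + u', v + v') \<in> G"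
    "(u, v) \<in> G \<Longrightarrow> (u', v') \<in> G \<Longrightarrow> (u - u', v - v') \<in> G"
    "(u, v) \<in> G \<Longrightarrow> (c *\<^sub>C u, c *\<^sub>C v) \<in> G" "(u, v) \<in> G \<Longrightarrow> (r *\<^sub>R u, r *\<^sub>R v) \<in> G"
    "(0, 0) \<in> G"
  using csubspaceD(2,6)[OF assms, of "(u, v)" "(u', v')"] csubspaceD(3)[OF assms, of "(u, v)" c]
    csubspaceD(4)[OF assms, of "(u, v)" r] csubspaceD(1)[OF assms] by (simp_all add: zero_prod_def)

context inner_module
begin

lemma dense_orthogonal_zero:
  assumes S: "S \<subseteq> H" "closure S = H" and z: "z \<in> H" and 0: "\<And>u. u \<in> S \<Longrightarrow> ip u z = 0"
  shows "z = 0"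
proof (rule ip_self_eq_0[OF z])
  obtain s where s: "\<And>n. s n \<in> S" "s \<longlonglongrightarrow> z" using z S(2) closure_sequential by metis
  have "norm (ip z z) \<le> norm (z - s n) * norm z" for n
  proof -
    have sH: "s n \<in> H" using s S by blast
    have "ip z z = ip (z - s n) z" using z sH 0[OF s(1)[of n]] by (simp add: ip_diff_left)
    then show ?thesis using ip_le[of "z - s n" z] z sH by simp
  qed
  moreover have "(\<lambda>n. norm (z - s n) * norm z) \<longlonglongrightarrow> 0"
    using tendsto_mult_left_zero[OF tendsto_norm_zero[OF LIM_zero[OF s(2)]], of "norm z"]
    by (simp add: norm_minus_commute)
  ultimately have "norm (ip z z) \<le> 0" by (intro LIMSEQ_le_const) auto
  then show "ip z z = 0" by simp
qed

text \<open>
  A closed symmetric operator shifted by \<open>\<plusminus> i m\<close> is bounded below, so that a dense range is everything; the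
  shift is then moved from \<open>m\<close> to \<open>1\<close> along operators that remain bounded below.
\<close>

lemma symmetric_graph_range:
  assumes G: "csubspace G" "closed G" "G \<subseteq> H \<times> H" "G \<subseteq> adjoint_rel H ip G" and m: "0 < m"
    and dense: "\<And>w e. w \<in> H \<Longrightarrow> 0 < e \<Longrightarrow> \<exists>(u, v)\<in>G. norm (v + (\<i> * of_real \<sigma>) *\<^sub>C m *\<^sub>R u - w) < e"
    and s: "\<sigma> = 1 \<or> \<sigma> = -1" and z: "z \<in> H"
  shows "\<exists>(u, v)\<in>G. v + (\<i> * of_real \<sigma>) *\<^sub>C u = z"
proof -
  let ?i = "\<i> * complex_of_real \<sigma>"
  have ni: "cmod ?i = 1" using s by (auto simp: norm_mult)
  have GH: "u \<in> H" "v \<in> H" if "(u, v) \<in> G" for u v using that G(3) by auto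
  have GHp: "fst p \<in> H" "snd p \<in> H" if "p \<in> G" for p using that G(3) by auto
  have below: "t * norm u \<le> K * norm (v + ?i *\<^sub>C t *\<^sub>R u)" if "(u, v) \<in> G" "0 \<le> t" for u v t
  proof (rule bounded_below[OF _ _ _ _ _ _ s])
    have "ip v u = ip u v" using adjoint_relD(1)[OF subsetD[OF G(4) that(1)] that(1)] .
    then show "star (ip u v) = ip u v" using GH[OF that(1)] by (simp add: ip_star)
    show "pos (ip u (t *\<^sub>R u) - t *\<^sub>R ip u u)"
      using GH[OF that(1)] pos_scaleR[OF ip_pos, of u 0] by (simp add: ip_scaleR)
  qed (use GH[OF that(1)] that in auto)
  have belowp: "t * norm (fst p) \<le> K * norm (snd p + ?i *\<^sub>C t *\<^sub>R fst p)" if "p \<in> G" "0 \<le> t" for p t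
    using below[of "fst p" "snd p" t] that by simp
  define P where "P p = snd p + ?i *\<^sub>C m *\<^sub>R fst p" for p :: "'e \<times> 'e"
  define N where "N p = ?i *\<^sub>C (1 - m) *\<^sub>R fst p" for p :: "'e \<times> 'e"
  have "P ` G = H"
  proof
    show "P ` G \<subseteq> H" by (rule image_subsetI) (simp add: P_def GHp)
    show "H \<subseteq> P ` G"
    proof
      fix w assume w: "w \<in> H"
      have "\<forall>n::nat. \<exists>p\<in>G. norm (P p - w) < inverse (real (Suc n))"
    proof
      fix n :: nat
      obtain u v where "(u, v) \<in> G" "norm (v + ?i *\<^sub>C m *\<^sub>R u - w) < inverse (real (Suc n))"
        using dense[OF w, of "inverse (real (Suc n))"] by auto
      then show "\<exists>p\<in>G. norm (P p - w) < inverse (real (Suc n))"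
        by (intro bexI[of _ "(u, v)"]) (simp_all add: P_def)
    qed
      then obtain p where p: "\<And>n. p n \<in> G" "\<And>n. norm (P (p n) - w) < inverse (real (Suc n))" by metis
      have lim: "(\<lambda>n. P (p n)) \<longlonglongrightarrow> w"
        by (rule LIM_zero_cancel, rule Lim_null_comparison[OF always_eventually LIMSEQ_inverse_real_of_nat])
           (intro allI less_imp_le p(2))
      define u where "u n = fst (p n)" for n
      have "Cauchy u"
      proof (rule Cauchy_dominated[OF LIMSEQ_imp_Cauchy[OF lim]])
        fix k n
        have "p k - p n \<in> G" using p(1) G(1) by (simp add: csubspaceD)
        then have "m * norm (fst (p k - p n)) \<le> K * norm (P (p k - p n))"
          unfolding P_def using m by (intro belowp) simp_all
        moreover have "P (p k - p n) = P (p k) - P (p n)" by (simp add: P_def scaleC_diff_right scaleR_diff_right)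
        ultimately show "dist (u k) (u n) \<le> K / m * dist (P (p k)) (P (p n))"
          using m by (simp add: u_def dist_norm field_simps)
      qed
      moreover have "u n \<in> H" for n using p(1)[of n] G(3) by (auto simp: u_def)
      ultimately obtain l where l: "l \<in> H" "u \<longlonglongrightarrow> l" using complete unfolding complete_def by meson
      have "(\<lambda>n. P (p n) - ?i *\<^sub>C m *\<^sub>R u n) \<longlonglongrightarrow> w - ?i *\<^sub>C m *\<^sub>R l"
        by (intro tendsto_intros lim l)
      moreover have "P (p n) - ?i *\<^sub>C m *\<^sub>R u n = snd (p n)" for n by (simp add: P_def u_def)
      ultimately have "(\<lambda>n. snd (p n)) \<longlonglongrightarrow> w - ?i *\<^sub>C m *\<^sub>R l" by simp
      then have "(\<lambda>n. (u n, snd (p n))) \<longlonglongrightarrow> (l, w - ?i *\<^sub>C m *\<^sub>R l)" by (rule tendsto_Pair[OF l(2)])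
      then have "(l, w - ?i *\<^sub>C m *\<^sub>R l) \<in> G"
        using closed_sequentially[OF G(2), of p] p(1) by (simp add: u_def)
      then show "w \<in> P ` G" by (intro image_eqI[of _ _ "(l, w - ?i *\<^sub>C m *\<^sub>R l)"]) (simp_all add: P_def)
    qed
  qed
  have "(\<lambda>p. P p + N p) ` G = H"
  proof (rule surj_homotopy[OF complete csub G(1) \<open>P ` G = H\<close>, where L = "\<bar>1 - m\<bar> * (K / min m 1)"])
    show "N ` G \<subseteq> H" by (rule image_subsetI) (simp add: N_def GHp)
    fix t :: real and p assume t: "0 \<le> t" "t \<le> 1" and p: "p \<in> G"
    let ?k = "m + t * (1 - m)"
    have "(1 - t) * min m 1 + t * min m 1 \<le> (1 - t) * m + t * 1" using t by (intro add_mono mult_left_mono) auto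
    then have k: "min m 1 \<le> ?k" by (simp add: algebra_simps)
    have "min m 1 * norm (fst p) \<le> ?k * norm (fst p)" using k by (intro mult_right_mono) simp_all
    also have "\<dots> \<le> K * norm (snd p + ?i *\<^sub>C ?k *\<^sub>R fst p)"
      using below[of "fst p" "snd p" ?k] p k m by simp
    also have "snd p + ?i *\<^sub>C ?k *\<^sub>R fst p = P p + t *\<^sub>R N p"
      by (simp add: P_def N_def scaleR_add_left scaleC_add_right scaleC_scaleR)
    finally have "norm (fst p) \<le> K / min m 1 * norm (P p + t *\<^sub>R N p)"
      using m by (simp add: pos_le_divide_eq mult.commute)
    then have "\<bar>1 - m\<bar> * norm (fst p) \<le> \<bar>1 - m\<bar> * (K / min m 1 * norm (P p + t *\<^sub>R N p))"
      by (intro mult_left_mono) simp_all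
    then show "norm (N p) \<le> \<bar>1 - m\<bar> * (K / min m 1) * norm (P p + t *\<^sub>R N p)"
      unfolding N_def norm_scaleC norm_scaleR ni by (simp only: mult.assoc mult_1)
  qed (simp_all add: N_def P_def clinear_on_def scaleC_add_right scaleR_add_right
      scaleC_scaleR scaleC_scaleC mult.commute)
  moreover have "(\<lambda>p. P p + N p) = (\<lambda>p. snd p + ?i *\<^sub>C fst p)"
    by (simp add: P_def N_def scaleR_diff_left scaleC_diff_right)
  ultimately have "z \<in> (\<lambda>p. snd p + ?i *\<^sub>C fst p) ` G" using z by (simp only:)
  then obtain p where p: "p \<in> G" "z = snd p + ?i *\<^sub>C fst p" by (rule imageE)
  then show ?thesis by (intro bexI[of _ p]) (simp_all add: case_prod_unfold)
qed

text \<open>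
  For \<open>(y, z)\<close> in the adjoint choose \<open>(u, v)\<close> in \<open>G\<close> with \<open>v + i u = z + i y\<close>. Then \<open>y - u\<close> is orthogonal to the range
  of \<open>G - i\<close>.
\<close>

lemma symmetric_graph_selfadjoint:
  assumes G: "csubspace G" "G \<subseteq> H \<times> H" "G \<subseteq> adjoint_rel H ip G"
    and surj: "\<And>\<sigma> z. \<sigma> = 1 \<or> \<sigma> = -1 \<Longrightarrow> z \<in> H \<Longrightarrow> \<exists>(u, v)\<in>G. v + (\<i> * of_real \<sigma>) *\<^sub>C u = z"
  shows "G = adjoint_rel H ip G"
proof (rule antisym[OF G(3)], clarify)
  fix y z assume yz: "(y, z) \<in> adjoint_rel H ip G"
  note yzH = adjoint_relD(2,3)[OF yz]
  have GH: "u \<in> H" "v \<in> H" if "(u, v) \<in> G" for u v using that G(2) by auto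
  obtain u v where uv: "(u, v) \<in> G" "v + \<i> *\<^sub>C u = z + \<i> *\<^sub>C y"
    using surj[of 1 "z + \<i> *\<^sub>C y"] yzH by auto
  note uvH = GH[OF uv(1)]
  define e where "e = y - u"
  have eH: "e \<in> H" using yzH uvH by (simp add: e_def)
  obtain a b where ab: "(a, b) \<in> G" "b - \<i> *\<^sub>C a = e"
    using surj[of "-1" e] eH by (auto simp: scaleC_minus_left)
  note abH = GH[OF ab(1)]
  have "ip b e = ip a (z - v)"
    using adjoint_relD(1)[OF yz ab(1)] adjoint_relD(1)[OF subsetD[OF G(3) uv(1)] ab(1)] abH uvH yzH
    by (simp add: e_def ip_diff)
  also have "z - v = - (\<i> *\<^sub>C e)" using uv(2) by (simp add: e_def scaleC_diff_right algebra_simps)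
  also have "ip a (- (\<i> *\<^sub>C e)) = - (\<i> *\<^sub>C ip a e)" using abH eH by (simp add: ip_minus ip_scaleC)
  finally have "ip (b - \<i> *\<^sub>C a) e = 0"
    using abH eH by (simp add: ip_diff_left ip_scaleC_left scaleC_minus_left)
  then have "e = 0" using ip_self_eq_0[OF eH] ab(2) by simp
  then show "(y, z) \<in> G" using uv by (simp add: e_def)
qed

text \<open>
  Factor \<open>1 + G\<^sup>2 = (G + i)(G - i)\<close>.
\<close>

lemma selfadjoint_one_plus_square:
  assumes G: "csubspace G"
    and surj: "\<And>\<sigma> z. \<sigma> = 1 \<or> \<sigma> = -1 \<Longrightarrow> z \<in> H \<Longrightarrow> \<exists>(u, v)\<in>G. v + (\<i> * of_real \<sigma>) *\<^sub>C u = z"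
    and GH: "G \<subseteq> H \<times> H" and z: "z \<in> H"
  shows "\<exists>u v t. (u, v) \<in> G \<and> (v, t) \<in> G \<and> u + t = z"
proof -
  obtain a b where ab: "(a, b) \<in> G" "b + \<i> *\<^sub>C a = z" using surj[of 1 z] z by auto
  obtain u v where uv: "(u, v) \<in> G" "v - \<i> *\<^sub>C u = a"
    using surj[of "-1" a] ab GH by (auto simp: scaleC_minus_left)
  have v: "v = a + \<i> *\<^sub>C u" using uv(2) by (simp add: algebra_simps)
  have "(v, b + \<i> *\<^sub>C v) \<in> G"
    using csubspace_pairD(1)[OF G ab(1) csubspace_pairD(3)[OF G uv(1), of \<i>]] by (simp add: v)
  moreover have "u + (b + \<i> *\<^sub>C v) = z" using ab(2) by (simp add: v scaleC_add_right scaleC_scaleC)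
  ultimately show ?thesis using uv by blast
qed

definition ip_pair :: "'e \<times> 'e \<Rightarrow> 'e \<times> 'e \<Rightarrow> 'b" where
  "ip_pair p q = ip (fst p) (fst q) + ip (snd p) (snd q)"

lemma inner_module_pair: "inner_module (H \<times> H) ip_pair (2 * K)"
proof
  show "csubspace (H \<times> H)" by (auto simp: csubspace_def zero_prod_def)
  show "complete (H \<times> H)" unfolding complete_def
  proof (intro allI impI)
    fix f :: "nat \<Rightarrow> 'e \<times> 'e" assume f: "(\<forall>n. f n \<in> H \<times> H) \<and> Cauchy f"
    have "Cauchy (\<lambda>n. fst (f n))" "Cauchy (\<lambda>n. snd (f n))"
      by (rule Cauchy_dominated[where C = 1, OF conjunct2[OF f]], simp add: dist_fst_le dist_snd_le)+
    moreover have "fst (f n) \<in> H" "snd (f n) \<in> H" for n using f by (auto simp: mem_Times_iff)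
    ultimately obtain l l' where "l \<in> H" "l' \<in> H" "(\<lambda>n. fst (f n)) \<longlonglongrightarrow> l" "(\<lambda>n. snd (f n)) \<longlonglongrightarrow> l'"
      using complete unfolding complete_def by meson
    then show "\<exists>l\<in>H \<times> H. f \<longlonglongrightarrow> l"
      using tendsto_Pair[of "\<lambda>n. fst (f n)" l _ "\<lambda>n. snd (f n)" l'] by (intro bexI[of _ "(l, l')"]) simp_all
  qed
  show "1 \<le> 2 * K" using K by simp
  fix u v w :: "'e \<times> 'e" and c
  assume u: "u \<in> H \<times> H"
  then have uH: "fst u \<in> H" "snd u \<in> H" by auto
  show "pos (ip_pair u u)" using uH by (simp add: ip_pair_def pos_add ip_pos)
  show "(norm u)\<^sup>2 \<le> 2 * K * norm (ip_pair u u)"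
  proof -
    have "norm (ip (fst u) (fst u)) \<le> norm (ip_pair u u)" "norm (ip (snd u) (snd u)) \<le> norm (ip_pair u u)"
      using pos_norm_mono[OF ip_pos[OF uH(1)] ip_pos[OF uH(2)]] pos_norm_mono[OF ip_pos[OF uH(2)] ip_pos[OF uH(1)]]
      by (simp_all add: ip_pair_def add.commute)
    then have "K * norm (ip (fst u) (fst u)) + K * norm (ip (snd u) (snd u)) \<le> K * norm (ip_pair u u) + K * norm (ip_pair u u)"
      using K by (intro add_mono mult_left_mono) simp_all
    moreover have "(norm u)\<^sup>2 = (norm (fst u))\<^sup>2 + (norm (snd u))\<^sup>2" by (simp add: norm_prod_def)
    ultimately show ?thesis using norm_le_ip[OF uH(1)] norm_le_ip[OF uH(2)] by simp
  qed
  assume v: "v \<in> H \<times> H"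
  then have vH: "fst v \<in> H" "snd v \<in> H" by auto
  show "ip_pair u (c *\<^sub>C v) = c *\<^sub>C ip_pair u v" using uH vH by (simp add: ip_pair_def ip_scaleC scaleC_add_right)
  show "star (ip_pair u v) = ip_pair v u" using uH vH by (simp add: ip_pair_def ip_star star_add)
  show "norm (ip_pair u v) \<le> norm u * norm v"
  proof -
    have "norm (ip_pair u v) \<le> norm (fst u) * norm (fst v) + norm (snd u) * norm (snd v)"
      unfolding ip_pair_def using ip_le uH vH by (intro norm_triangle_le add_mono)
    also have "\<dots> \<le> norm u * norm v"
    proof (rule power2_le_imp_le)
      have cs: "(a * c + b * d)\<^sup>2 \<le> (a\<^sup>2 + b\<^sup>2) * (c\<^sup>2 + d\<^sup>2)" for a b c d :: real
      proof -
        have "(a\<^sup>2 + b\<^sup>2) * (c\<^sup>2 + d\<^sup>2) - (a * c + b * d)\<^sup>2 = (a * d - b * c)\<^sup>2"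
          by (simp add: power2_eq_square algebra_simps)
        then show ?thesis using zero_le_power2[of "a * d - b * c"] by linarith
      qed
      show "(norm (fst u) * norm (fst v) + norm (snd u) * norm (snd v))\<^sup>2 \<le> (norm u * norm v)\<^sup>2"
        using cs by (simp add: power_mult_distrib norm_prod_def)
    qed simp
    finally show ?thesis .
  qed
  assume w: "w \<in> H \<times> H"
  then have wH: "fst w \<in> H" "snd w \<in> H" by auto
  show "ip_pair u (v + w) = ip_pair u v + ip_pair u w" using uH vH wH by (simp add: ip_pair_def ip_add)
qed

end

section \<open>Localizing a half-closed operator\<close>

lemma clinear_on_app:
  assumes G: "csubspace G" "single_valued G"
  shows "clinear_on (Domain G) (app G)" "csubspace (Domain G)"
    "(u, v) \<in> G \<Longrightarrow> app G u = v" "u \<in> Domain G \<Longrightarrow> (u, app G u) \<in> G"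
proof -
  show 1: "(u, v) \<in> G \<Longrightarrow> app G u = v" for u v
    unfolding app_def using G(2) by (auto simp: single_valued_def)
  then show 2: "u \<in> Domain G \<Longrightarrow> (u, app G u) \<in> G" for u by (auto simp: Domain_iff)
  show "clinear_on (Domain G) (app G)" unfolding clinear_on_def
    using 1[OF csubspace_pairD(1)[OF G(1) 2 2]] 1[OF csubspace_pairD(3)[OF G(1) 2]] by blast
  show "csubspace (Domain G)" unfolding csubspace_def
    using csubspace_pairD[OF G(1)] by (meson Domain.DomainI DomainE)
qed

context inner_module
begin

lemma adjoint_rel_csubspace:
  assumes "D \<subseteq> H \<times> H"
  shows "csubspace (adjoint_rel H ip D)"
  unfolding csubspace_def zero_prod_def
proof (intro conjI ballI allI)
  have DH: "u \<in> H" "v \<in> H" if "(u, v) \<in> D" for u v using that assms by auto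
  show "(0, 0) \<in> adjoint_rel H ip D"
  proof (rule adjoint_relI)
    show "ip v 0 = ip u 0" if "(u, v) \<in> D" for u v
      using DH[OF that] ip_scaleC[of u 0 0] ip_scaleC[of v 0 0] by simp
  qed simp_all
  fix p q :: "'e \<times> 'e" and c
  assume p: "p \<in> adjoint_rel H ip D"
  obtain y z where yz: "p = (y, z)" by (cases p)
  note y = adjoint_relD[OF p[unfolded yz]]
  have "(c *\<^sub>C y, c *\<^sub>C z) \<in> adjoint_rel H ip D"
    by (rule adjoint_relI) (simp_all add: y ip_scaleC DH)
  then show "c *\<^sub>C p \<in> adjoint_rel H ip D" by (simp add: yz)
  assume q: "q \<in> adjoint_rel H ip D"
  obtain y' z' where yz': "q = (y', z')" by (cases q)
  note y' = adjoint_relD[OF q[unfolded yz']]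
  have "(y + y', z + z') \<in> adjoint_rel H ip D"
    by (rule adjoint_relI) (simp_all add: y y' ip_add DH)
  then show "p + q \<in> adjoint_rel H ip D" by (simp add: yz yz')
qed

lemma adjoint_rel_single_valued:
  assumes D: "D \<subseteq> H \<times> H" "closure (Domain D) = H"
  shows "single_valued (adjoint_rel H ip D)"
  unfolding single_valued_def
proof (intro allI impI)
  fix y z z' assume 1: "(y, z) \<in> adjoint_rel H ip D" and 2: "(y, z') \<in> adjoint_rel H ip D"
  have "z - z' = 0"
  proof (rule dense_orthogonal_zero[OF _ D(2)])
    show "Domain D \<subseteq> H" using D by auto
    show "z - z' \<in> H" using adjoint_relD[OF 1] adjoint_relD[OF 2] by simp
    fix u assume "u \<in> Domain D"
    then obtain v where uv: "(u, v) \<in> D" by blast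
    then show "ip u (z - z') = 0"
      using adjoint_relD(1)[OF 1 uv] adjoint_relD(1)[OF 2 uv] adjoint_relD(3)[OF 1] adjoint_relD(3)[OF 2] D(1) by (auto simp: ip_diff)
  qed
  then show "z = z'" by simp
qed

text \<open>
  The operator \<open>(y1, y2) \<mapsto> (D* y2, D y1)\<close> is symmetric, and regularity of \<open>D\<close> and \<open>D*\<close> makes it selfadjoint and
  regular on the direct sum. The diagonal action of \<open>x\<close> preserves its domain and has bounded commutators, and it maps the domain of \<open>D*\<close>
  into that of \<open>D\<close>. Solving there with the same right hand side \<open>w/2\<close> in both components and adding the components
  replaces \<open>D*\<close> by \<open>D\<close>.
\<close>

lemma half_closed_localized:
  assumes D: "csubspace D" "D \<subseteq> H \<times> H" "closure (Domain D) = H" "D \<subseteq> adjoint_rel H ip D"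
    and reg: "\<And>z. z \<in> H \<Longrightarrow> \<exists>u w v. (u, w) \<in> D \<and> (w, v) \<in> adjoint_rel H ip D \<and> u + v = z"
    and reg': "\<And>z. z \<in> H \<Longrightarrow> \<exists>u w v. (u, w) \<in> adjoint_rel H ip D \<and> (w, v) \<in> D \<and> u + v = z"
    and x: "bounded_on H x" and x': "bounded_on H x'"
    and adj: "\<And>u v. u \<in> H \<Longrightarrow> v \<in> H \<Longrightarrow> ip (x u) v = ip u (x' v)"
    and xD: "x ` Domain (adjoint_rel H ip D) \<subseteq> Domain D" "x' ` Domain (adjoint_rel H ip D) \<subseteq> Domain D"
    and d: "bounded_on H d" and d': "bounded_on H d'"
    and comm: "\<And>u w. (u, w) \<in> adjoint_rel H ip D \<Longrightarrow> (x u, x w + d u) \<in> D"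
        "\<And>u w. (u, w) \<in> adjoint_rel H ip D \<Longrightarrow> (x' u, x' w + d' u) \<in> D"
  shows "\<exists>m>0. \<forall>\<sigma>. (\<sigma> = 1 \<or> \<sigma> = -1) \<longrightarrow> (\<forall>w\<in>H. \<forall>e>0. \<exists>y\<in>H. \<exists>v. x y \<in> Domain D \<and> (x' (x y), v) \<in> D \<and>
    norm (x v + (\<i> * of_real \<sigma>) *\<^sub>C m *\<^sub>R x y - x w) < e)"
proof -
  let ?A = "adjoint_rel H ip D"
  have Asub: "csubspace ?A" and Asv: "single_valued ?A"
    using adjoint_rel_csubspace[OF D(2)] adjoint_rel_single_valued[OF D(2,3)] by auto
  have Dsv: "single_valued D" using Asv D(4) single_valued_subset by blast
  define D1 where "D1 = app D"
  define D2 where "D2 = app ?A"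
  note app1 = clinear_on_app[OF D(1) Dsv, folded D1_def] and app2 = clinear_on_app[OF Asub Asv, folded D2_def]
  have D21: "D2 u = D1 u" if "u \<in> Domain D" for u
    using app2(3)[OF subsetD[OF D(4) app1(4)[OF that]]] .
  have D1H: "u \<in> H" "D1 u \<in> H" if "u \<in> Domain D" for u using app1(4)[OF that] D(2) by auto
  have D2H: "u \<in> H" "D2 u \<in> H" if "u \<in> Domain ?A" for u using adjoint_relD[OF app2(4)[OF that]] by auto
  have DA: "u \<in> Domain ?A" if "u \<in> Domain D" for u using that D(4) by auto
  interpret p: inner_module "H \<times> H" ip_pair "2 * K" by (rule inner_module_pair)
  define Dm where "Dm = Domain D \<times> Domain ?A"
  have Dm_iff: "p \<in> Dm \<longleftrightarrow> fst p \<in> Domain D \<and> snd p \<in> Domain ?A" for p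
    by (simp only: Dm_def mem_Times_iff)
  define DD where "DD p = (D2 (snd p), D1 (fst p))" for p
  define X where "X p = (x (fst p), x (snd p))" for p
  define X' where "X' p = (x' (fst p), x' (snd p))" for p
  define d2 where "d2 p = (d (snd p), d (fst p))" for p
  define d2' where "d2' p = (d' (snd p), d' (fst p))" for p
  have bp: "bounded_on (H \<times> H) (\<lambda>p. (T (fst p), T (snd p)))" "bounded_on (H \<times> H) (\<lambda>p. (T (snd p), T (fst p)))"
    if T: "bounded_on H T" for T
  proof -
    obtain C where C: "0 \<le> C" "\<And>u. u \<in> H \<Longrightarrow> norm (T u) \<le> C * norm u" using bounded_onD(3)[OF T] by auto
    have "norm (T (fst p), T (snd p)) \<le> C * norm p" "norm (T (snd p), T (fst p)) \<le> C * norm p" if p: "p \<in> H \<times> H" for p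
    proof -
      have "(norm (T (fst p)))\<^sup>2 + (norm (T (snd p)))\<^sup>2 \<le> (C * norm (fst p))\<^sup>2 + (C * norm (snd p))\<^sup>2"
        using C(2) p by (intro add_mono power_mono) auto
      also have "\<dots> = (C * norm p)\<^sup>2" by (simp add: norm_prod_def power_mult_distrib distrib_left)
      finally have "sqrt ((norm (T (fst p)))\<^sup>2 + (norm (T (snd p)))\<^sup>2) \<le> sqrt ((C * norm p)\<^sup>2)"
        by (rule real_sqrt_le_mono)
      then show "norm (T (fst p), T (snd p)) \<le> C * norm p" "norm (T (snd p), T (fst p)) \<le> C * norm p"
        using C(1) by (simp_all add: norm_Pair add.commute)
    qed
    moreover note bounded_onD(1,2)[OF T]
    ultimately show "bounded_on (H \<times> H) (\<lambda>p. (T (fst p), T (snd p)))" "bounded_on (H \<times> H) (\<lambda>p. (T (snd p), T (fst p)))"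
      unfolding bounded_on_def clinear_on_def
      by (intro conjI exI[of _ C] ballI allI funcsetI; simp add: mem_Times_iff)+
  qed
  have "\<exists>\<mu>\<^sub>0>0. \<forall>\<mu> \<sigma>. (\<sigma> = 1 \<or> \<sigma> = -1) \<longrightarrow> \<mu>\<^sub>0 \<le> \<mu> \<longrightarrow> (\<forall>w\<in>H \<times> H. \<forall>e>0. \<exists>y\<in>Dm.
    norm (X (DD (X' (X y)) + (\<i> * of_real \<sigma>) *\<^sub>C \<mu> *\<^sub>R y - w)) < e)"
  proof (rule p.localized_resolvent_approx[where D = DD and x = X and x' = X' and d = d2 and d' = d2'])
    show "csubspace Dm" using app1(2) app2(2) by (auto simp: csubspace_def Dm_def zero_prod_def)
    show "Dm \<subseteq> H \<times> H" using D1H D2H by (intro subsetI) (simp add: Dm_iff mem_Times_iff)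
    show "DD \<in> Dm \<rightarrow> H \<times> H" using D1H D2H by (intro funcsetI) (simp add: Dm_iff DD_def)
    show "clinear_on Dm DD" using app1(1) app2(1) by (simp add: clinear_on_def Dm_iff DD_def del: Domain_iff)
    show "bounded_on (H \<times> H) X" "bounded_on (H \<times> H) X'" "bounded_on (H \<times> H) d2" "bounded_on (H \<times> H) d2'"
      unfolding X_def[abs_def] X'_def[abs_def] d2_def[abs_def] d2'_def[abs_def]
      by (rule bp[OF x] bp[OF x'] bp[OF d] bp[OF d'])+
    show "X \<in> Dm \<rightarrow> Dm" "X' \<in> Dm \<rightarrow> Dm" using xD DA by (auto simp: X_def X'_def Dm_iff image_subset_iff simp del: Domain_iff)
    show "ip_pair (X u) v = ip_pair u (X' v)" if "u \<in> H \<times> H" "v \<in> H \<times> H" for u v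
      using that adj by (auto simp: ip_pair_def X_def X'_def)
    show "ip_pair (DD u) v = ip_pair u (DD v)" if "u \<in> Dm" "v \<in> Dm" for u v
    proof -
      have uv: "fst u \<in> Domain D" "fst v \<in> Domain D" "snd u \<in> Domain ?A" "snd v \<in> Domain ?A" using that by (simp_all add: Dm_iff)
      have "ip (D1 (fst u)) (snd v) = ip (fst u) (D2 (snd v))" "ip (D1 (fst v)) (snd u) = ip (fst v) (D2 (snd u))"
        using adjoint_relD(1)[OF app2(4) app1(4)] uv by auto
      moreover from arg_cong[OF this(2), of star] have "ip (D2 (snd u)) (fst v) = ip (snd u) (D1 (fst v))"
        using D1H D2H uv by (simp add: ip_star)
      ultimately show ?thesis by (simp add: ip_pair_def DD_def)
    qed
    show "DD (X u) = X (DD u) + d2 u" "DD (X' u) = X' (DD u) + d2' u" if "u \<in> Dm" for u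
    proof -
      have u: "fst u \<in> Domain D" "fst u \<in> Domain ?A" "snd u \<in> Domain ?A" using that DA by (simp_all add: Dm_iff)
      have "D1 (x v) = x (D2 v) + d v" "D1 (x' v) = x' (D2 v) + d' v" if "v \<in> Domain ?A" for v
        using app1(3)[OF comm(1)[OF app2(4)[OF that]]] app1(3)[OF comm(2)[OF app2(4)[OF that]]] by auto
      moreover have "x (snd u) \<in> Domain D" "x' (snd u) \<in> Domain D"
        using subsetD[OF xD(1) imageI[OF u(3)]] subsetD[OF xD(2) imageI[OF u(3)]] .
      ultimately show "DD (X u) = X (DD u) + d2 u" "DD (X' u) = X' (DD u) + d2' u"
        using u by (simp_all add: DD_def X_def X'_def d2_def d2'_def D21)
    qed
    fix \<sigma> :: real assume s: "\<sigma> = 1 \<or> \<sigma> = -1"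
    let ?i = "\<i> * complex_of_real \<sigma>"
    have ii: "?i * ?i = -1" using s by auto
    show "(\<lambda>u. DD u + ?i *\<^sub>C u) ` Dm = H \<times> H"
    proof
      show "(\<lambda>u. DD u + ?i *\<^sub>C u) ` Dm \<subseteq> H \<times> H"
        using D1H D2H by (intro image_subsetI) (simp add: DD_def Dm_iff mem_Times_iff)
      show "H \<times> H \<subseteq> (\<lambda>u. DD u + ?i *\<^sub>C u) ` Dm"
      proof (clarify)
        fix w1 w2 assume w: "w1 \<in> H" "w2 \<in> H"
        obtain a b c where abc: "(a, b) \<in> D" "(b, c) \<in> ?A" "a + c = w1" using reg w by blast
        obtain a' b' c' where abc': "(a', b') \<in> ?A" "(b', c') \<in> D" "a' + c' = w2" using reg' w by blast
        \<comment> \<open>The inverse of a selfadjoint \<open>T + i\<close> is \<open>(T - i)(1 + T\<^sup>2)\<^sup>-\<^sup>1\<close>, and the square is diagonal here.\<close>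
        let ?y1 = "b' - ?i *\<^sub>C a" and ?y2 = "b - ?i *\<^sub>C a'"
        have 1: "(?y1, c' - ?i *\<^sub>C b) \<in> D"
          by (intro csubspace_pairD(2,3) D(1) abc abc')
        have 2: "(?y2, c - ?i *\<^sub>C b') \<in> ?A"
          by (intro csubspace_pairD(2,3) Asub abc abc')
        have "(w1, w2) = DD (?y1, ?y2) + ?i *\<^sub>C (?y1, ?y2)"
        proof -
          have "?i *\<^sub>C ?y1 = ?i *\<^sub>C b' + a" "?i *\<^sub>C ?y2 = ?i *\<^sub>C b + a'"
            by (simp_all only: scaleC_diff_right scaleC_scaleC ii) simp_all
          then show ?thesis
            using abc(3) abc'(3) by (simp only: DD_def fst_conv snd_conv app1(3)[OF 1] app2(3)[OF 2] scaleC_Pair) (simp add: algebra_simps)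
        qed
        moreover have "(?y1, ?y2) \<in> Dm" using 1 2 unfolding Dm_def by (metis DomainI SigmaI)
        ultimately show "(w1, w2) \<in> (\<lambda>u. DD u + ?i *\<^sub>C u) ` Dm" by blast
      qed
    qed
  qed
  then obtain m where m: "0 < m" and ap: "\<And>\<sigma> w e. \<sigma> = 1 \<or> \<sigma> = -1 \<Longrightarrow> w \<in> H \<times> H \<Longrightarrow> 0 < e \<Longrightarrow> \<exists>y\<in>Dm.
    norm (X (DD (X' (X y)) + (\<i> * of_real \<sigma>) *\<^sub>C m *\<^sub>R y - w)) < e"
    by (meson order_refl)
  show ?thesis
  proof (intro exI[of _ m] conjI m allI impI ballI)
    fix \<sigma> :: real and w and e :: real assume s: "\<sigma> = 1 \<or> \<sigma> = -1" and w: "w \<in> H" and e: "0 < e"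
    let ?i = "\<i> * complex_of_real \<sigma>"
    let ?w = "(1/2) *\<^sub>R w"
    obtain y where y: "y \<in> Dm" "norm (X (DD (X' (X y)) + ?i *\<^sub>C m *\<^sub>R y - (?w, ?w))) < e / 2"
      using ap[OF s, of "(?w, ?w)" "e / 2"] w e by auto
    obtain y1 y2 where yy: "y = (y1, y2)" by (cases y)
    have ym: "y1 \<in> Domain D" "y1 \<in> Domain ?A" "y2 \<in> Domain ?A" using y(1) DA by (simp_all add: yy Dm_iff)
    have yH: "y1 \<in> H" "y2 \<in> H" using ym D1H D2H by auto
    have xm: "x y1 \<in> Domain D" "x y2 \<in> Domain D" "x' (x y1) \<in> Domain D" "x' (x y2) \<in> Domain D"
      using xD ym DA by (simp_all only: image_subset_iff)
    let ?p1 = "D1 (x' (x y2)) + ?i *\<^sub>C m *\<^sub>R y1 - ?w" and ?p2 = "D1 (x' (x y1)) + ?i *\<^sub>C m *\<^sub>R y2 - ?w"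
    have lt: "norm (x ?p1, x ?p2) < e / 2"
      using y(2) by (simp add: yy X_def X'_def DD_def D21 xm)
    note linx = clinear_onD[OF bounded_onD(2)[OF x]]
    have pH: "?p1 \<in> H" "?p2 \<in> H" using xm D1H yH w by simp_all
    have "norm (x ?p1 + x ?p2) \<le> norm (x ?p1) + norm (x ?p2)" by (rule norm_triangle_ineq)
    also have "\<dots> \<le> norm (x ?p1, x ?p2) + norm (x ?p1, x ?p2)"
      by (intro add_mono norm_fst_le norm_snd_le)
    also have "\<dots> < e" using lt by simp
    finally have lt2: "norm (x (?p1 + ?p2)) < e" using linx(1) pH by simp
    let ?y = "y1 + y2" and ?v = "D1 (x' (x y1)) + D1 (x' (x y2))"
    have vv: "(x' (x ?y), ?v) \<in> D"
    proof -
      have "x' (x ?y) = x' (x y1) + x' (x y2)"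
        using linx(1) clinear_onD(1)[OF bounded_onD(2)[OF x']] yH bounded_onD(1)[OF x] by simp
      then show ?thesis using csubspace_pairD(1)[OF D(1) app1(4) app1(4)] xm by simp
    qed
    have "?w + ?w = w" by (simp flip: scaleR_add_left)
    then have "?p1 + ?p2 = ?v + ?i *\<^sub>C m *\<^sub>R ?y - w"
      by (simp add: scaleC_add_right scaleR_add_right algebra_simps)
    moreover have "x (?v + ?i *\<^sub>C m *\<^sub>R ?y - w) = x ?v + ?i *\<^sub>C m *\<^sub>R x ?y - x w"
      using D1H xm yH w by (simp add: linx csub)
    ultimately have "norm (x ?v + ?i *\<^sub>C m *\<^sub>R x ?y - x w) < e" using lt2 by (simp only:)
    moreover have "x ?y \<in> Domain D" using xm yH csubspaceD(2)[OF app1(2)] by (simp add: linx)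
    ultimately show "\<exists>y\<in>H. \<exists>v. x y \<in> Domain D \<and> (x' (x y), v) \<in> D \<and> norm (x v + ?i *\<^sub>C m *\<^sub>R x y - x w) < e"
      using vv yH by (intro bexI[of _ ?y] exI[of _ ?v]) simp_all
  qed
qed

end

section \<open>Hilbert C*-modules and contractivity of the left action\<close>

lemma hilbert_moduleD:
  assumes "hilbert_module E"
  shows "submodule E (hcarrier E)" "complete (hcarrier E)"
    "u \<in> hcarrier E \<Longrightarrow> v \<in> hcarrier E \<Longrightarrow> hact E (u + v) b = hact E u b + hact E v b"
    "u \<in> hcarrier E \<Longrightarrow> hact E u (b + b') = hact E u b + hact E u b'"
    "u \<in> hcarrier E \<Longrightarrow> hact E u (b * b') = hact E (hact E u b) b'"
    "u \<in> hcarrier E \<Longrightarrow> hact E (c *\<^sub>C u) b = c *\<^sub>C hact E u b"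
    "u \<in> hcarrier E \<Longrightarrow> hact E u (c *\<^sub>C b) = c *\<^sub>C hact E u b"
    "u \<in> hcarrier E \<Longrightarrow> v \<in> hcarrier E \<Longrightarrow> w \<in> hcarrier E \<Longrightarrow> hinner E u (v + w) = hinner E u v + hinner E u w"
    "u \<in> hcarrier E \<Longrightarrow> v \<in> hcarrier E \<Longrightarrow> hinner E u (c *\<^sub>C v) = c *\<^sub>C hinner E u v"
    "u \<in> hcarrier E \<Longrightarrow> v \<in> hcarrier E \<Longrightarrow> hinner E u (hact E v b) = hinner E u v * b"
    "u \<in> hcarrier E \<Longrightarrow> v \<in> hcarrier E \<Longrightarrow> hinner E v u = star (hinner E u v)"
    "u \<in> hcarrier E \<Longrightarrow> positive_in UNIV (hinner E u u)"
    "u \<in> hcarrier E \<Longrightarrow> norm u = sqrt (norm (hinner E u u))"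
  using assms unfolding hilbert_module_def by blast+

lemma submoduleD:
  assumes "submodule E M"
  shows "M \<subseteq> hcarrier E" "0 \<in> M" "u \<in> M \<Longrightarrow> v \<in> M \<Longrightarrow> u + v \<in> M" "u \<in> M \<Longrightarrow> c *\<^sub>C u \<in> M"
    "u \<in> M \<Longrightarrow> hact E u b \<in> M"
  using assms unfolding submodule_def by blast+

lemma submodule_csubspace: "submodule E M \<Longrightarrow> csubspace M"
  unfolding submodule_def csubspace_def by blast

text \<open>
  The Cauchy-Schwarz inequality, for \<open>c = \<langle>u, v\<rangle>\<close> and \<open>s = \<parallel>u\<parallel>\<^sup>2\<close>, comes from positivity of
  \<open>\<langle>u c - s v, u c - s v\<rangle>\<close> and of \<open>s c* c - c* \<langle>u, u\<rangle> c\<close>.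
\<close>

lemma hilbert_module_inner_module:
  fixes E :: "('e::complex_normed_vector, 'b::cstar_algebra) module_data"
  assumes E: "hilbert_module E"
  shows "inner_module (hcarrier E) (hinner E) 1"
proof
  note hm = hilbert_moduleD[OF E]
  note mem = csubspaceD[OF submodule_csubspace[OF hm(1)]] submoduleD[OF hm(1)]
  show "csubspace (hcarrier E)" by (rule submodule_csubspace[OF hm(1)])
  show "complete (hcarrier E)" "(1::real) \<le> 1" using hm(2) by auto
  fix u v w c
  assume u: "u \<in> hcarrier E"
  show pu: "pos (hinner E u u)" by (rule positive_in_imp_pos[OF hm(12)[OF u]])
  show "(norm u)\<^sup>2 \<le> 1 * norm (hinner E u u)" using hm(13)[OF u] by simp
  assume v: "v \<in> hcarrier E"
  show "hinner E u (c *\<^sub>C v) = c *\<^sub>C hinner E u v" by (rule hm(9)[OF u v])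
  show "star (hinner E u v) = hinner E v u" by (rule hm(11)[OF u v, symmetric])
  {
    assume w: "w \<in> hcarrier E"
    show "hinner E u (v + w) = hinner E u v + hinner E u w" by (rule hm(8)[OF u v w])
  }
  have pv: "pos (hinner E v v)" by (rule positive_in_imp_pos[OF hm(12)[OF v]])
  let ?c = "hinner E u v" and ?s = "norm (hinner E u u)"
  show "norm ?c \<le> norm u * norm v"
  proof (cases "?s = 0")
    case True
    then have "u = 0" using hm(13)[OF u] by simp
    then have "?c = star (0 *\<^sub>C hinner E v u)" using hm(9)[OF v u, of 0] hm(11)[OF v u] by simp
    then show ?thesis by simp
  next
    case False
    define a where "a = hact E u ?c"
    define b where "b = (- ?s) *\<^sub>R v"
    have ab: "a \<in> hcarrier E" "b \<in> hcarrier E" using mem u v by (simp_all add: a_def b_def)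
    have ipr: "hinner E y b = (- ?s) *\<^sub>R hinner E y v" if "y \<in> hcarrier E" for y
      using hm(9)[OF that v, of "complex_of_real (- ?s)"] by (simp only: b_def scaleC_of_real)
    have ipl: "hinner E b y = (- ?s) *\<^sub>R hinner E v y" if "y \<in> hcarrier E" for y
      unfolding hm(11)[OF that ab(2)] ipr[OF that] hm(11)[OF that v] by (rule star_scaleR)
    have iar: "hinner E y a = hinner E y u * ?c" if "y \<in> hcarrier E" for y
      unfolding a_def by (rule hm(10)[OF that u])
    have ial: "hinner E a y = star ?c * hinner E u y" if "y \<in> hcarrier E" for y
      unfolding hm(11)[OF that ab(1)] iar[OF that] star_mult hm(11)[OF that u] ..
    have vu: "hinner E v u = star ?c" by (rule hm(11)[OF u v])
    have abm: "a + b \<in> hcarrier E" by (rule mem(2)[OF ab])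
    have "hinner E (a + b) (a + b) = hinner E a (a + b) + hinner E b (a + b)"
      unfolding hm(11)[OF abm ab(1)] hm(11)[OF abm ab(2)] star_add[symmetric] hm(8)[OF abm ab, symmetric]
      by (rule hm(11)[OF abm abm])
    also have "\<dots> = star ?c * hinner E u u * ?c - ?s *\<^sub>R (star ?c * ?c) - ?s *\<^sub>R (star ?c * ?c) + (?s * ?s) *\<^sub>R hinner E v v"
      using ab u v hm(8) by (simp add: ipr ipl iar ial vu mult.assoc)
    finally have eq: "hinner E (a + b) (a + b) = star ?c * hinner E u u * ?c - ?s *\<^sub>R (star ?c * ?c) - ?s *\<^sub>R (star ?c * ?c) + (?s * ?s) *\<^sub>R hinner E v v" .
    have "pos (hinner E (a + b) (a + b))" by (rule positive_in_imp_pos[OF hm(12)]) (use mem ab in simp)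
    from pos_add[OF this pos_norm_conj[OF pu, of ?c]]
    have p: "pos ((?s * ?s) *\<^sub>R hinner E v v - ?s *\<^sub>R (star ?c * ?c))"
    proof -
      have "(X - Y - Y + Z) + (Y - X) = Z - Y" for X Y Z :: 'b by simp
      then show ?thesis using \<open>pos (_ + _)\<close> unfolding eq by (simp only:)
    qed
    from pos_norm_mono[OF pos_scaleR[OF pos_star_mult_self[of ?c] norm_ge_zero[of "hinner E u u"]] p]
    have "?s * norm (star ?c * ?c) \<le> ?s * (?s * norm (hinner E v v))" by simp
    then have "norm (star ?c * ?c) \<le> ?s * norm (hinner E v v)" by (rule mult_left_le_imp_le) (use False in simp)
    then have "(norm ?c)\<^sup>2 \<le> ?s * norm (hinner E v v)" by (simp only: cstar_identity)
    also have "\<dots> = (norm u * norm v)\<^sup>2" using hm(13)[OF u] hm(13)[OF v] by (simp add: power_mult_distrib)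
    finally show ?thesis by (rule power2_le_imp_le) simp
  qed
qed

lemma norm_hact_le:
  assumes E: "hilbert_module E" and u: "u \<in> hcarrier E"
  shows "norm (hact E u b) \<le> norm u * norm b"
proof -
  note hm = hilbert_moduleD[OF E]
  have ub: "hact E u b \<in> hcarrier E" by (rule submoduleD(5)[OF hm(1) u])
  have "hinner E (hact E u b) (hact E u b) = star b * hinner E u u * b"
    unfolding hm(10)[OF ub u] hm(11)[OF u ub] hm(10)[OF u u] star_mult hm(11)[OF u u, symmetric] ..
  then have "(norm (hact E u b))\<^sup>2 = norm (star b * hinner E u u * b)" using hm(13)[OF ub] by simp
  also have "\<dots> \<le> norm (star b) * norm (hinner E u u) * norm b"
    by (meson norm_mult_ineq order_trans mult_right_mono norm_ge_zero)
  also have "\<dots> = (norm u * norm b)\<^sup>2" using hm(13)[OF u]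
    by (simp add: power_mult_distrib power2_eq_square[of "norm b"])
  finally show ?thesis by (rule power2_le_imp_le) simp
qed

lemma bounded_op_bounded_on: "bounded_op E T \<Longrightarrow> bounded_on (hcarrier E) T"
  unfolding bounded_op_def bounded_on_def clinear_on_def by blast

lemma bounded_opD:
  assumes "bounded_op E T" "u \<in> hcarrier E"
  shows "T u \<in> hcarrier E" "T (hact E u b) = hact E (T u) b"
  using assms unfolding bounded_op_def by auto

lemma hilbert_module_restrict:
  assumes E: "hilbert_module E" and M: "submodule E M" "closed M"
  shows "hilbert_module (E\<lparr>hcarrier := M\<rparr>)"
proof -
  have "complete M"
    using complete_closed_subset[OF M(2) submoduleD(1)[OF M(1)] hilbert_moduleD(2)[OF E]] .
  moreover have "submodule (E\<lparr>hcarrier := M\<rparr>) M" using M(1) by (auto simp: submodule_def)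
  moreover have "u \<in> hcarrier E" if "u \<in> M" for u using that submoduleD(1)[OF M(1)] by auto
  moreover have eq: "hcarrier (E\<lparr>hcarrier := M\<rparr>) = M" "hinner (E\<lparr>hcarrier := M\<rparr>) = hinner E"
    "hact (E\<lparr>hcarrier := M\<rparr>) = hact E" by simp_all
  ultimately show ?thesis unfolding hilbert_module_def eq
    by (intro conjI ballI allI hilbert_moduleD(3-13)[OF E])
qed

lemma bounded_on_tendsto:
  assumes T: "bounded_on H T" and H: "csubspace H" and u: "\<And>n. u n \<in> H" "l \<in> H" "u \<longlonglongrightarrow> l"
  shows "(\<lambda>n. T (u n)) \<longlonglongrightarrow> T l"
proof -
  obtain C where C: "\<And>v. v \<in> H \<Longrightarrow> norm (T v) \<le> C * norm v" using bounded_onD(3)[OF T] by auto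
  have le: "norm (T (u n) - T l) \<le> C * norm (u n - l)" for n
    using C[of "u n - l"] csubspaceD(6)[OF H u(1,2)] clinear_onD(6)[OF bounded_onD(2)[OF T] H u(1,2)] by simp
  have "(\<lambda>n. C * norm (u n - l)) \<longlonglongrightarrow> 0"
    using tendsto_mult_right_zero[OF tendsto_norm_zero[OF LIM_zero[OF u(3)]]] .
  then have "(\<lambda>n. T (u n) - T l) \<longlonglongrightarrow> 0"
    by (rule Lim_null_comparison[OF always_eventually, rotated]) (intro allI le)
  then show ?thesis by (rule LIM_zero_cancel)
qed

lemma submodule_closure:
  assumes E: "hilbert_module E" and M: "submodule E M"
  shows "submodule E (closure M)"
proof -
  note hm = hilbert_moduleD[OF E]
  have closed: "closed (hcarrier E)" using hm(2) by (rule complete_imp_closed)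
  have cH: "csubspace (hcarrier E)" by (rule submodule_csubspace[OF hm(1)])
  have sub: "closure M \<subseteq> hcarrier E" using closure_minimal[OF submoduleD(1)[OF M] closed] .
  have act: "bounded_on (hcarrier E) (\<lambda>u. hact E u b)" for b
    unfolding bounded_on_def clinear_on_def using hm(3,6) submoduleD(5)[OF hm(1)] norm_hact_le[OF E]
    by (intro conjI exI[of _ "norm b"]) (auto simp: mult.commute)
  show ?thesis unfolding submodule_def
  proof (intro conjI ballI allI sub)
    show "0 \<in> closure M" using submoduleD(2)[OF M] closure_subset by auto
    fix u assume u: "u \<in> closure M"
    then obtain s where s: "\<And>n. s n \<in> M" "s \<longlonglongrightarrow> u" using closure_sequential by metis
    show "c *\<^sub>C u \<in> closure M" for c unfolding closure_sequential
      by (intro exI[of _ "\<lambda>n. c *\<^sub>C s n"] conjI allI submoduleD(4)[OF M] s(1) tendsto_scaleC s(2))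
    show "hact E u b \<in> closure M" for b unfolding closure_sequential
    proof (intro exI[of _ "\<lambda>n. hact E (s n) b"] conjI allI submoduleD(5)[OF M] s(1))
      show "(\<lambda>n. hact E (s n) b) \<longlonglongrightarrow> hact E u b"
        by (rule bounded_on_tendsto[OF act cH _ _ s(2)]) (use s(1) submoduleD(1)[OF M] sub u in auto)
    qed
    fix v assume v: "v \<in> closure M"
    then obtain t where t: "\<And>n. t n \<in> M" "t \<longlonglongrightarrow> v" using closure_sequential by metis
    show "u + v \<in> closure M" unfolding closure_sequential
      by (intro exI[of _ "\<lambda>n. s n + t n"] conjI allI submoduleD(3)[OF M] s t tendsto_add)
  qed
qed

lift_definition upart :: "'a::cstar_algebra unitization \<Rightarrow> 'a" is fst .
lift_definition uscal :: "'a::cstar_algebra unitization \<Rightarrow> complex" is snd .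

lemma upart_simps [simp]:
  "upart (y + z) = upart y + upart z" "upart 1 = 0" "upart (uembed a) = a"
  "upart (r *\<^sub>R y) = r *\<^sub>R upart y" "upart (star y) = star (upart y)" "upart (y - z) = upart y - upart z"
  "upart (y * z) = upart y * upart z + uscal y *\<^sub>C upart z + uscal z *\<^sub>C upart y"
  by (transfer; simp add: umult_def ustar_def)+

lemma uscal_simps [simp]:
  "uscal (y + z) = uscal y + uscal z" "uscal 1 = 1" "uscal (uembed a) = 0"
  "uscal (r *\<^sub>R y) = r *\<^sub>R uscal y" "uscal (star y) = cnj (uscal y)" "uscal (y - z) = uscal y - uscal z"
  "uscal (y * z) = uscal y * uscal z"
  by (transfer; simp add: umult_def ustar_def)+

lemma bounded_linear_upart: "bounded_linear upart"
proof (rule bounded_linear_intro[of _ 2])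
  show "norm (upart y) \<le> norm y * 2" for y :: "'a unitization"
    using norm_fst_le_unorm[of "Rep_unitization y"]
    by (simp add: upart.rep_eq norm_unitization.rep_eq mult.commute)
qed simp_all

text \<open>
  The unital extension of the action, defined on those \<open>(a, \<lambda>)\<close> for which \<open>a\<close> acts.
\<close>

definition uact :: "('a::cstar_algebra \<Rightarrow> 'e \<Rightarrow> 'e::complex_normed_vector) \<Rightarrow> 'a unitization \<Rightarrow> 'e \<Rightarrow> 'e" where
  "uact \<phi> y u = \<phi> (upart y) u + uscal y *\<^sub>C u"

lemma star_subalgebraD:
  assumes "star_subalgebra A"
  shows "0 \<in> A" "a \<in> A \<Longrightarrow> star a \<in> A" "a \<in> A \<Longrightarrow> c *\<^sub>C a \<in> A" "a \<in> A \<Longrightarrow> b \<in> A \<Longrightarrow> a + b \<in> A"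
    "a \<in> A \<Longrightarrow> b \<in> A \<Longrightarrow> a * b \<in> A" "a \<in> A \<Longrightarrow> r *\<^sub>R a \<in> A" "a \<in> A \<Longrightarrow> - a \<in> A"
    "a \<in> A \<Longrightarrow> b \<in> A \<Longrightarrow> a - b \<in> A"
proof -
  show 1: "0 \<in> A" "a \<in> A \<Longrightarrow> star a \<in> A" "a \<in> A \<Longrightarrow> c *\<^sub>C a \<in> A" "a \<in> A \<Longrightarrow> b \<in> A \<Longrightarrow> a + b \<in> A"
    "a \<in> A \<Longrightarrow> b \<in> A \<Longrightarrow> a * b \<in> A" for a b c using assms unfolding star_subalgebra_def by blast+
  show "a \<in> A \<Longrightarrow> r *\<^sub>R a \<in> A" for a r by (simp add: scaleR_scaleC 1)
  show 2: "a \<in> A \<Longrightarrow> - a \<in> A" for a using 1(3)[of a "-1"] by simp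
  show "a \<in> A \<Longrightarrow> b \<in> A \<Longrightarrow> a - b \<in> A" using 1(4)[OF _ 2, of a b] by simp
qed

lemma closed_unital_upart:
  assumes "cstar_subalgebra A"
  shows "closed_unital {y. upart y \<in> A}"
proof -
  have A: "star_subalgebra A" "closed A" using assms by (auto simp: cstar_subalgebra_def)
  have "closed (upart -` A)"
    by (rule continuous_closed_vimage[OF A(2)])
       (simp add: linear_continuous_at[OF bounded_linear_upart])
  then show ?thesis using star_subalgebraD[OF A(1)] by (simp add: closed_unital_def vimage_def)
qed

lemma correspondenceD:
  assumes "correspondence A E \<phi>"
  shows "hilbert_module E" "a \<in> A \<Longrightarrow> adjointable E (\<phi> a)" "a \<in> A \<Longrightarrow> bounded_op E (\<phi> a)"
    "a \<in> A \<Longrightarrow> b \<in> A \<Longrightarrow> u \<in> hcarrier E \<Longrightarrow> \<phi> (a + b) u = \<phi> a u + \<phi> b u"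
    "a \<in> A \<Longrightarrow> b \<in> A \<Longrightarrow> u \<in> hcarrier E \<Longrightarrow> \<phi> (a * b) u = \<phi> a (\<phi> b u)"
    "a \<in> A \<Longrightarrow> u \<in> hcarrier E \<Longrightarrow> \<phi> (c *\<^sub>C a) u = c *\<^sub>C \<phi> a u"
    "a \<in> A \<Longrightarrow> u \<in> hcarrier E \<Longrightarrow> v \<in> hcarrier E \<Longrightarrow> hinner E (\<phi> a u) v = hinner E u (\<phi> (star a) v)"
    "a \<in> A \<Longrightarrow> u \<in> hcarrier E \<Longrightarrow> \<phi> a u \<in> hcarrier E"
    "a \<in> A \<Longrightarrow> bounded_on (hcarrier E) (\<phi> a)" "a \<in> A \<Longrightarrow> clinear_on (hcarrier E) (\<phi> a)"
proof -
  show 1: "hilbert_module E" "a \<in> A \<Longrightarrow> adjointable E (\<phi> a)" "a \<in> A \<Longrightarrow> bounded_op E (\<phi> a)" for a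
    using assms unfolding correspondence_def adjointable_def by blast+
  show "a \<in> A \<Longrightarrow> b \<in> A \<Longrightarrow> u \<in> hcarrier E \<Longrightarrow> \<phi> (a + b) u = \<phi> a u + \<phi> b u"
    "a \<in> A \<Longrightarrow> b \<in> A \<Longrightarrow> u \<in> hcarrier E \<Longrightarrow> \<phi> (a * b) u = \<phi> a (\<phi> b u)"
    "a \<in> A \<Longrightarrow> u \<in> hcarrier E \<Longrightarrow> \<phi> (c *\<^sub>C a) u = c *\<^sub>C \<phi> a u"
    "a \<in> A \<Longrightarrow> u \<in> hcarrier E \<Longrightarrow> v \<in> hcarrier E \<Longrightarrow> hinner E (\<phi> a u) v = hinner E u (\<phi> (star a) v)"
    using assms unfolding correspondence_def by blast+
  show 2: "a \<in> A \<Longrightarrow> bounded_on (hcarrier E) (\<phi> a)" using bounded_op_bounded_on 1 by blast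
  then show "a \<in> A \<Longrightarrow> u \<in> hcarrier E \<Longrightarrow> \<phi> a u \<in> hcarrier E" "a \<in> A \<Longrightarrow> clinear_on (hcarrier E) (\<phi> a)"
    using bounded_onD by blast+
qed

lemma
  assumes A: "star_subalgebra A" and c: "correspondence A E \<phi>" and y: "upart y \<in> A" and u: "u \<in> hcarrier E"
  shows uact_mem: "uact \<phi> y u \<in> hcarrier E"
    and uact_mult: "upart z \<in> A \<Longrightarrow> uact \<phi> (y * z) u = uact \<phi> y (uact \<phi> z u)"
    and uact_star: "v \<in> hcarrier E \<Longrightarrow> hinner E (uact \<phi> y u) v = hinner E u (uact \<phi> (star y) v)"
    and uact_diff: "upart z \<in> A \<Longrightarrow> uact \<phi> (y - z) u = uact \<phi> y u - uact \<phi> z u"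
    and uact_bounded: "bounded_op E (uact \<phi> y)"
proof -
  note cD = correspondenceD[OF c] and AD = star_subalgebraD[OF A]
  interpret inner_module "hcarrier E" "hinner E" 1 by (rule hilbert_module_inner_module[OF cD(1)])
  show mm: "uact \<phi> y u \<in> hcarrier E" using y u cD by (simp add: uact_def)
  have comm_ext: "\<phi> (a - b) u = \<phi> a u - \<phi> b u" if "a \<in> A" "b \<in> A" for a b
    using cD(4)[of a "- b" u] cD(6)[of b u "-1"] that u AD by simp
  show "uact \<phi> (y * z) u = uact \<phi> y (uact \<phi> z u)" if "upart z \<in> A"
    using y u that cD AD by (simp add: uact_def clinear_onD[OF cD(10)] scaleC_add_right scaleC_add_left scaleC_scaleC)
  show "hinner E (uact \<phi> y u) v = hinner E u (uact \<phi> (star y) v)" if "v \<in> hcarrier E"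
    using y u that cD AD by (simp add: uact_def ip_add_left ip_add ip_scaleC_left ip_scaleC)
  show "uact \<phi> (y - z) u = uact \<phi> y u - uact \<phi> z u" if "upart z \<in> A"
    using y u that comm_ext by (simp add: uact_def scaleC_diff_left)
  obtain C where C: "\<And>u. u \<in> hcarrier E \<Longrightarrow> norm (\<phi> (upart y) u) \<le> C * norm u"
    using bounded_onD(3)[OF cD(9)[OF y]] by auto
  have b: "norm (uact \<phi> y u) \<le> (C + cmod (uscal y)) * norm u" if "u \<in> hcarrier E" for u
    unfolding uact_def using C[OF that] norm_triangle_ineq[of "\<phi> (upart y) u" "uscal y *\<^sub>C u"]
    by (simp add: norm_scaleC distrib_right)
  note hm = hilbert_moduleD[OF cD(1)]
  show "bounded_op E (uact \<phi> y)" unfolding bounded_op_def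
  proof (intro conjI ballI allI funcsetI exI[of _ "C + cmod (uscal y)"] b)
    fix u assume u: "u \<in> hcarrier E"
    show "uact \<phi> y u \<in> hcarrier E" using y u cD by (simp add: uact_def)
    show "uact \<phi> y (c *\<^sub>C u) = c *\<^sub>C uact \<phi> y u" for c
      using u by (simp add: uact_def clinear_onD[OF cD(10)[OF y]] scaleC_add_right scaleC_scaleC mult.commute)
    have \<phi>u: "\<phi> (upart y) u \<in> hcarrier E" using y u cD by simp
    show "uact \<phi> y (hact E u b) = hact E (uact \<phi> y u) b" for b
      using u \<phi>u hm(3)[of "\<phi> (upart y) u" "uscal y *\<^sub>C u" b] hm(6)[of u "uscal y" b] bounded_opD(2)[OF cD(3)[OF y] u, of b] by (simp add: uact_def)
    show "uact \<phi> y (u + v) = uact \<phi> y u + uact \<phi> y v" if "v \<in> hcarrier E" for v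
      using u that by (simp add: uact_def clinear_onD[OF cD(10)[OF y]] scaleC_add_right)
  qed
qed

text \<open>
  The element \<open>\<parallel>a\<parallel>\<^sup>2 - a* a\<close> is the square of a selfadjoint \<open>q\<close>, and then
  \<open>\<parallel>a\<parallel>\<^sup>2 \<langle>u, u\<rangle> - \<langle>a u, a u\<rangle> = \<langle>q u, q u\<rangle>\<close>.
\<close>

lemma correspondence_contractive:
  assumes A: "cstar_subalgebra A" and c: "correspondence A E \<phi>" and a: "a \<in> A" and u: "u \<in> hcarrier E"
  shows "norm (\<phi> a u) \<le> norm a * norm u"
proof -
  have A': "star_subalgebra A" using A by (simp add: cstar_subalgebra_def)
  note cD = correspondenceD[OF c] and AD = star_subalgebraD[OF A']
  interpret inner_module "hcarrier E" "hinner E" 1 by (rule hilbert_module_inner_module[OF cD(1)])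
  let ?n = "(norm a)\<^sup>2"
  let ?p = "?n *\<^sub>R 1 - uembed (star a * a)"
  have "cpos ?p"
    by (rule cpos_norm_minus) (simp_all add: star_mult star_star cstar_identity flip: uembed_star)
  then obtain q where q: "q \<in> {y. upart y \<in> A}" "cpos q" "q * q = ?p"
    by (rule cpos_sqrt[OF _ closed_unital_upart[OF A]]) (use a AD in simp)
  then have qA: "upart q \<in> A" by simp
  have \<phi>au: "\<phi> a u \<in> hcarrier E" using a u cD by simp
  have zz: "\<phi> 0 u = 0" using cD(6)[OF AD(1) u, of 0] by simp
  have "hinner E (uact \<phi> q u) (uact \<phi> q u) = hinner E u (uact \<phi> q (uact \<phi> q u))"
    using uact_star[OF A' c qA u uact_mem[OF A' c qA u]] cpos_selfadj[OF q(2)] by simp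
  also have "uact \<phi> q (uact \<phi> q u) = uact \<phi> ?p u"
    using uact_mult[OF A' c qA u qA] q(3) by simp
  also have "\<dots> = ?n *\<^sub>R u - \<phi> (star a) (\<phi> a u)"
  proof -
    have "uact \<phi> (?n *\<^sub>R 1) u = ?n *\<^sub>R u"
      unfolding uact_def upart_simps uscal_simps scaleR_zero_right zz
      by (simp only: scaleR_conv_of_real[of _ "1::complex"] mult_1_right scaleC_of_real add_0_left)
    moreover have "uact \<phi> (uembed (star a * a)) u = \<phi> (star a) (\<phi> a u)"
      using u a AD cD by (simp add: uact_def)
    moreover have "upart (?n *\<^sub>R 1) \<in> A" "upart (uembed (star a * a)) \<in> A" using a AD by simp_all
    ultimately show ?thesis using uact_diff[OF A' c _ u] by simp
  qed
  also have "hinner E u \<dots> = ?n *\<^sub>R hinner E u u - hinner E (\<phi> a u) (\<phi> a u)"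
    using u a cD AD by (simp add: ip_diff ip_scaleR)
  finally have "pos (?n *\<^sub>R hinner E u u - hinner E (\<phi> a u) (\<phi> a u))"
    using ip_pos[OF uact_mem[OF A' c qA u]] by simp
  from pos_norm_mono[OF ip_pos[OF \<phi>au] this]
  have "norm (hinner E (\<phi> a u) (\<phi> a u)) \<le> ?n * norm (hinner E u u)" by simp
  then have "(norm (\<phi> a u))\<^sup>2 \<le> (norm a * norm u)\<^sup>2"
    using hilbert_moduleD(13)[OF cD(1)] u \<phi>au by (simp add: power_mult_distrib)
  then show ?thesis by (rule power2_le_imp_le) simp
qed

section \<open>Regularity and commutators of a half-closed operator\<close>

context inner_module
begin

lemma ip_tendsto:
  assumes u: "\<And>n. u n \<in> H" "a \<in> H" "u \<longlonglongrightarrow> a" and v: "\<And>n. v n \<in> H" "b \<in> H" "v \<longlonglongrightarrow> b"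
  shows "(\<lambda>n. ip (u n) (v n)) \<longlonglongrightarrow> ip a b"
proof -
  have le: "norm (ip (u n) (v n) - ip a b) \<le> norm (u n - a) * norm (v n) + norm a * norm (v n - b)" for n
  proof -
    have "ip (u n) (v n) - ip a b = ip (u n - a) (v n) + ip a (v n - b)"
      using u v by (simp add: ip_diff ip_diff_left)
    also have "norm \<dots> \<le> norm (u n - a) * norm (v n) + norm a * norm (v n - b)"
      using u v by (intro norm_triangle_le add_mono ip_le) simp_all
    finally show ?thesis .
  qed
  have "(\<lambda>n. norm (u n - a) * norm (v n) + norm a * norm (v n - b)) \<longlonglongrightarrow> 0 * norm b + norm a * 0"
    by (intro tendsto_add tendsto_mult tendsto_norm v(3) tendsto_const tendsto_norm_zero LIM_zero u(3))
  then have "(\<lambda>n. ip (u n) (v n) - ip a b) \<longlonglongrightarrow> 0"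
    by (intro Lim_null_comparison[OF always_eventually[OF allI[OF le]]]) simp
  then show ?thesis by (rule LIM_zero_cancel)
qed

lemma closed_adjoint_rel:
  assumes D: "D \<subseteq> H \<times> H"
  shows "closed (adjoint_rel H ip D)"
  unfolding closed_sequential_limits
proof (intro allI impI, elim conjE)
  fix p :: "nat \<Rightarrow> 'e \<times> 'e" and l assume p: "\<forall>n. p n \<in> adjoint_rel H ip D" "p \<longlonglongrightarrow> l"
  define y z where "y n = fst (p n)" and "z n = snd (p n)" for n
  have yz: "(y n, z n) \<in> adjoint_rel H ip D" for n using p(1) by (simp add: y_def z_def)
  have lim: "y \<longlonglongrightarrow> fst l" "z \<longlonglongrightarrow> snd l"
    unfolding y_def[abs_def] z_def[abs_def] by (rule tendsto_fst[OF p(2)], rule tendsto_snd[OF p(2)])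
  have H: "fst l \<in> H" "snd l \<in> H"
    using closed_sequentially[OF closed_H _ lim(1)] closed_sequentially[OF closed_H _ lim(2)] adjoint_relD[OF yz] by auto
  have "ip v (fst l) = ip u (snd l)" if uv: "(u, v) \<in> D" for u v
  proof -
    have uvH: "u \<in> H" "v \<in> H" using uv D by auto
    have "(\<lambda>n. ip v (y n)) \<longlonglongrightarrow> ip v (fst l)" "(\<lambda>n. ip u (z n)) \<longlonglongrightarrow> ip u (snd l)"
      using adjoint_relD[OF yz] H uvH lim by (auto intro!: ip_tendsto)
    moreover have "ip v (y n) = ip u (z n)" for n using adjoint_relD(1)[OF yz uv] .
    ultimately show ?thesis using LIMSEQ_unique by auto
  qed
  then have "(fst l, snd l) \<in> adjoint_rel H ip D" using H by (intro adjoint_relI)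
  then show "l \<in> adjoint_rel H ip D" by simp
qed

text \<open>
  With \<open>w = S u\<close> and \<open>v = S* w\<close> this bounds \<open>u\<close> and \<open>S u\<close> by \<open>(\<kappa> + S* S) u\<close>. The only input is the pairing
  identity, because \<open>\<langle>u, (\<kappa> + S* S) u\<rangle> = \<kappa> \<langle>u, u\<rangle> + \<langle>S u, S u\<rangle>\<close>.
\<close>

lemma composite_bounds:
  assumes H: "u \<in> H" "w \<in> H" "v \<in> H" and eq: "ip u v = ip w w" and k: "0 \<le> \<kappa>"
  shows "\<kappa> * norm u \<le> K * norm (\<kappa> *\<^sub>R u + v)" "\<kappa> * (norm w)\<^sup>2 \<le> K * K * (norm (\<kappa> *\<^sub>R u + v))\<^sup>2"
proof -
  let ?z = "\<kappa> *\<^sub>R u + v"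
  have z: "?z \<in> H" using H by simp
  have e: "ip u ?z = \<kappa> *\<^sub>R ip u u + ip w w" using H by (simp add: ip_add ip_scaleR eq)
  have p: "pos (\<kappa> *\<^sub>R ip u u)" "pos (ip w w)" using H k by (auto intro: pos_scaleR ip_pos)
  have 1: "\<kappa> * norm (ip u u) \<le> norm u * norm ?z"
    using pos_norm_mono[OF p] ip_le[OF H(1) z] k unfolding e by simp
  have 2: "norm (ip w w) \<le> norm u * norm ?z"
    using pos_norm_mono[OF p(2,1)] ip_le[OF H(1) z] unfolding e by (simp add: add.commute)
  have "\<kappa> * (norm u)\<^sup>2 \<le> \<kappa> * (K * norm (ip u u))" using k norm_le_ip[OF H(1)] by (intro mult_left_mono)
  also have "\<dots> = K * (\<kappa> * norm (ip u u))" by (rule mult.left_commute)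
  also have "\<dots> \<le> K * (norm u * norm ?z)" using 1 K by (intro mult_left_mono) simp_all
  finally have "norm u * (\<kappa> * norm u) \<le> norm u * (K * norm ?z)" by (simp add: power2_eq_square mult_ac)
  then show 3: "\<kappa> * norm u \<le> K * norm ?z"
    by (cases "norm u = 0") (use K in \<open>auto simp: mult_le_cancel_left\<close>)
  have "(norm w)\<^sup>2 \<le> K * (norm u * norm ?z)"
    using norm_le_ip[OF H(2)] 2 K by (meson mult_left_mono order_trans zero_le_one)
  then have "\<kappa> * (norm w)\<^sup>2 \<le> \<kappa> * (K * (norm u * norm ?z))" using k by (intro mult_left_mono)
  also have "\<dots> = (\<kappa> * norm u) * (K * norm ?z)" by (simp add: mult_ac)
  also have "\<dots> \<le> (K * norm ?z) * (K * norm ?z)" using 3 K by (intro mult_right_mono) simp_all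
  finally show "\<kappa> * (norm w)\<^sup>2 \<le> K * K * (norm ?z)\<^sup>2" by (simp add: power2_eq_square mult_ac)
qed

text \<open>
  By the previous bounds, solutions of \<open>(1 + T S) u = z\<close> depend continuously on \<open>z\<close>, so the closed graphs carry solvability
  from a dense set to the whole module.
\<close>

lemma composite_surj:
  assumes S: "csubspace S" "closed S" "S \<subseteq> H \<times> H" and T: "csubspace T" "closed T" "T \<subseteq> H \<times> H"
    and pair: "\<And>u w w' v. (u, w) \<in> S \<Longrightarrow> (w', v) \<in> T \<Longrightarrow> ip u v = ip w w'"
    and dense: "closure Z = H" "\<And>z. z \<in> Z \<Longrightarrow> \<exists>u w v. (u, w) \<in> S \<and> (w, v) \<in> T \<and> u + v = z"
    and z: "z \<in> H"
  shows "\<exists>u w v. (u, w) \<in> S \<and> (w, v) \<in> T \<and> u + v = z"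
proof -
  obtain s where s: "\<And>n. s n \<in> Z" "s \<longlonglongrightarrow> z" using z dense(1) closure_sequential by metis
  obtain u w v where uwv: "\<And>n. (u n, w n) \<in> S" "\<And>n. (w n, v n) \<in> T" "\<And>n. u n + v n = s n"
    using dense(2)[OF s(1)] by metis
  have d: "norm (u m - u n) \<le> K * norm (s m - s n)" "norm (w m - w n) \<le> K * norm (s m - s n)" for m n
  proof -
    have S': "(u m - u n, w m - w n) \<in> S" "(w m - w n, v m - v n) \<in> T"
      using csubspace_pairD(2)[OF S(1) uwv(1,1)] csubspace_pairD(2)[OF T(1) uwv(2,2)] .
    then have H: "u m - u n \<in> H" "w m - w n \<in> H" "v m - v n \<in> H" using S T by auto
    have e: "1 *\<^sub>R (u m - u n) + (v m - v n) = s m - s n" by (simp flip: uwv(3))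
    note b = composite_bounds[OF H pair[OF S'], of 1, unfolded e]
    show "norm (u m - u n) \<le> K * norm (s m - s n)" using b(1) by simp
    have "(norm (w m - w n))\<^sup>2 \<le> (K * norm (s m - s n))\<^sup>2" using b(2) by (simp add: power2_eq_square mult_ac)
    then show "norm (w m - w n) \<le> K * norm (s m - s n)" by (rule power2_le_imp_le) (use K in simp)
  qed
  have "Cauchy u" "Cauchy w"
    by (rule Cauchy_dominated[OF LIMSEQ_imp_Cauchy[OF s(2)], of _ K], simp add: dist_norm d)+
  moreover have "u n \<in> H" "w n \<in> H" for n using uwv S by auto
  ultimately obtain a b where ab: "u \<longlonglongrightarrow> a" "w \<longlonglongrightarrow> b" using complete unfolding complete_def by meson
  have "(\<lambda>n. s n - u n) \<longlonglongrightarrow> z - a" by (intro tendsto_diff s ab)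
  moreover have "(\<lambda>n. s n - u n) = v" by (simp flip: uwv(3))
  ultimately have v: "v \<longlonglongrightarrow> z - a" by simp
  have "(a, b) \<in> S" by (rule closed_sequentially[OF S(2) _ tendsto_Pair[OF ab]]) (rule uwv)
  moreover have "(b, z - a) \<in> T" by (rule closed_sequentially[OF T(2) _ tendsto_Pair[OF ab(2) v]]) (rule uwv)
  ultimately show ?thesis by (intro exI[of _ a] exI[of _ b] exI[of _ "z - a"]) simp
qed

lemma composite_surj_scaled:
  assumes S: "csubspace S" "S \<subseteq> H \<times> H" and T: "csubspace T" "T \<subseteq> H \<times> H"
    and pair: "\<And>u w w' v. (u, w) \<in> S \<Longrightarrow> (w', v) \<in> T \<Longrightarrow> ip u v = ip w w'"
    and surj: "\<And>z. z \<in> H \<Longrightarrow> \<exists>u w v. (u, w) \<in> S \<and> (w, v) \<in> T \<and> u + v = z"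
    and z: "z \<in> H" and k: "1 \<le> \<kappa>"
  shows "\<exists>u w v. (u, w) \<in> S \<and> (w, v) \<in> T \<and> \<kappa> *\<^sub>R u + v = z"
proof -
  define I where "I = {p. (fst p, fst (snd p)) \<in> S \<and> snd p \<in> T}"
  have I: "csubspace I" unfolding csubspace_def I_def
    using csubspaceD(1-3)[OF S(1)] csubspaceD(1-3)[OF T(1)] csubspace_pairD[OF S(1)] by (simp add: zero_prod_def)
  have IH: "fst p \<in> H" "fst (snd p) \<in> H" "snd (snd p) \<in> H" if "p \<in> I" for p
    using that S(2) T(2) by (auto simp: I_def)
  have "(\<lambda>p. (fst p + snd (snd p)) + (\<kappa> - 1) *\<^sub>R fst p) ` I = H"
  proof (rule surj_homotopy[OF complete csub I, where L = "(\<kappa> - 1) * K"])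
    show "(\<lambda>p. fst p + snd (snd p)) ` I = H"
    proof
      show "(\<lambda>p. fst p + snd (snd p)) ` I \<subseteq> H" using IH by (intro image_subsetI) simp
      show "H \<subseteq> (\<lambda>p. fst p + snd (snd p)) ` I"
      proof
        fix z assume "z \<in> H"
        then obtain u w v where "(u, w) \<in> S" "(w, v) \<in> T" "u + v = z" using surj by blast
        then show "z \<in> (\<lambda>p. fst p + snd (snd p)) ` I"
          by (intro image_eqI[of _ _ "(u, w, v)"]) (simp_all add: I_def)
      qed
    qed
    show "(\<lambda>p. (\<kappa> - 1) *\<^sub>R fst p) ` I \<subseteq> H" using IH by (intro image_subsetI) simp
    show "clinear_on I (\<lambda>p. fst p + snd (snd p))" "clinear_on I (\<lambda>p. (\<kappa> - 1) *\<^sub>R fst p)"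
      by (simp_all add: clinear_on_def scaleC_add_right scaleR_add_right scaleC_scaleR)
    fix t :: real and p assume t: "0 \<le> t" "t \<le> 1" and p: "p \<in> I"
    let ?k = "1 + t * (\<kappa> - 1)"
    have k0: "1 \<le> ?k" using t k by simp
    have "ip (fst p) (snd (snd p)) = ip (fst (snd p)) (fst (snd p))"
      using pair[of "fst p" "fst (snd p)" "fst (snd p)" "snd (snd p)"] p by (simp add: I_def)
    from composite_bounds(1)[OF IH(1)[OF p] IH(2)[OF p] IH(3)[OF p] this, of ?k]
    have "?k * norm (fst p) \<le> K * norm (?k *\<^sub>R fst p + snd (snd p))" using k0 by simp
    moreover have "1 * norm (fst p) \<le> ?k * norm (fst p)" using k0 by (intro mult_right_mono) simp_all
    moreover have "?k *\<^sub>R fst p + snd (snd p) = fst p + snd (snd p) + t *\<^sub>R (\<kappa> - 1) *\<^sub>R fst p"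
      by (simp add: scaleR_add_left)
    ultimately have "norm (fst p) \<le> K * norm (fst p + snd (snd p) + t *\<^sub>R (\<kappa> - 1) *\<^sub>R fst p)" by simp
    then have "(\<kappa> - 1) * norm (fst p) \<le> (\<kappa> - 1) * (K * norm (fst p + snd (snd p) + t *\<^sub>R (\<kappa> - 1) *\<^sub>R fst p))"
      using k by (intro mult_left_mono) simp_all
    then show "norm ((\<kappa> - 1) *\<^sub>R fst p) \<le> (\<kappa> - 1) * K * norm (fst p + snd (snd p) + t *\<^sub>R (\<kappa> - 1) *\<^sub>R fst p)"
      using k by (simp add: mult.assoc)
  qed
  then have "z \<in> (\<lambda>p. (fst p + snd (snd p)) + (\<kappa> - 1) *\<^sub>R fst p) ` I" using z by (simp only:)
  then obtain p where p: "p \<in> I" "z = (fst p + snd (snd p)) + (\<kappa> - 1) *\<^sub>R fst p" by (rule imageE)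
  then have "\<kappa> *\<^sub>R fst p + snd (snd p) = z" by (simp add: scaleR_diff_left)
  then show ?thesis using p(1)
    by (intro exI[of _ "fst p"] exI[of _ "fst (snd p)"] exI[of _ "snd (snd p)"]) (simp add: I_def)
qed

end

locale half_closed =
  fixes A :: "'a::cstar_algebra set" and \<A> :: "'a set"
    and E :: "('e::complex_normed_vector, 'b::cstar_algebra) module_data"
    and \<phi> :: "'a \<Rightarrow> 'e \<Rightarrow> 'e" and D :: "('e \<times> 'e) set"
    and g :: "('e \<Rightarrow> 'e) option"
  assumes chain: "half_closed_chain A \<A> E \<phi> D g"
begin

lemma chainD:
  shows "cstar_subalgebra A" "dense_star_subalgebra \<A> A" "correspondence A E \<phi>" "countably_generated E"
    "regular_op E D" "symmetric_op E D"
    "a \<in> A \<Longrightarrow> compact_graph E ((shift 1 (D O adjoint_graph E D))\<inverse> O op_graph E (\<phi> a))"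
    "a \<in> \<A> \<Longrightarrow> \<phi> a ` Domain (adjoint_graph E D) \<subseteq> Domain D"
    "a \<in> \<A> \<Longrightarrow> \<exists>d. bounded_op E d \<and> (\<forall>u\<in>Domain D. d u = app D (\<phi> a u) - \<phi> a (app D u))"
    "parity_ok A E \<phi> D g"
  using chain unfolding half_closed_chain_def by blast+

lemmas cD = correspondenceD[OF chainD(3)]
lemmas hm = hilbert_moduleD[OF cD(1)]

sublocale inner_module "hcarrier E" "hinner E" 1
  by (rule hilbert_module_inner_module[OF cD(1)])

abbreviation "Dst \<equiv> adjoint_rel (hcarrier E) (hinner E) D"

lemma Dst_eq: "adjoint_graph E D = Dst"
  by (simp add: adjoint_graph_def adjoint_rel_def)

lemma starA: "star_subalgebra A" and closedA: "closed A"
  using chainD(1) by (auto simp: cstar_subalgebra_def)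

lemma star\<A>: "star_subalgebra \<A>" and \<A>A: "\<A> \<subseteq> A" and \<A>dense: "A \<subseteq> closure \<A>"
  using chainD(2) by (auto simp: dense_star_subalgebra_def)

lemmas AD = star_subalgebraD[OF starA]
lemmas \<A>D = star_subalgebraD[OF star\<A>]

lemma D_unb: "unbounded_op E D" and D_closed: "closed D" and D_dense: "closure (Domain D) = hcarrier E"
  and Dst_dense: "closure (Domain Dst) = hcarrier E"
  and D_reg: "closure (Range (shift 1 (D O Dst))) = hcarrier E"
  using chainD(5) by (auto simp: regular_op_def densely_defined_def Dst_eq)

lemma D_sub: "D \<subseteq> hcarrier E \<times> hcarrier E" and D_sv: "single_valued D"
  using D_unb by (auto simp: unbounded_op_def)

lemma D_csub: "csubspace D"
proof -
  have 0: "(0, 0) \<in> D" and 1: "\<forall>(u, v)\<in>D. \<forall>(u', v')\<in>D. (u + u', v + v') \<in> D"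
    and 2: "\<forall>(u, v)\<in>D. (\<forall>c. (c *\<^sub>C u, c *\<^sub>C v) \<in> D) \<and> (\<forall>b. (hact E u b, hact E v b) \<in> D)"
    using D_unb unfolding unbounded_op_def by blast+
  show ?thesis unfolding csubspace_def
  proof (intro conjI ballI allI)
    show "0 \<in> D" using 0 by (simp add: zero_prod_def)
    fix p assume p: "p \<in> D"
    show "c *\<^sub>C p \<in> D" for c using bspec[OF 2 p] by (cases p) simp
    show "p + q \<in> D" if "q \<in> D" for q using bspec[OF 1 p] that by (cases p; cases q) auto
  qed
qed

lemma D_Dst: "D \<subseteq> Dst"
  using chainD(6) by (simp add: symmetric_op_def Dst_eq)

lemma Dst_sub: "Dst \<subseteq> hcarrier E \<times> hcarrier E"
  by (auto simp: adjoint_rel_def)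

lemma D_mem: "(u, v) \<in> D \<Longrightarrow> u \<in> hcarrier E" "(u, v) \<in> D \<Longrightarrow> v \<in> hcarrier E"
  using D_sub by auto

lemmas Dst_csub = adjoint_rel_csubspace[OF D_sub]
lemmas Dst_closed = closed_adjoint_rel[OF D_sub]

lemma D_pair: "(u, w) \<in> D \<Longrightarrow> (w', v) \<in> Dst \<Longrightarrow> hinner E u v = hinner E w w'"
  by (rule adjoint_relD(1)[symmetric])

lemma Dst_pair: "(u, w) \<in> Dst \<Longrightarrow> (w', v) \<in> D \<Longrightarrow> hinner E u v = hinner E w w'"
  using adjoint_relD(1)[of u w _ _ D w' v] adjoint_relD(2,3)[of u w _ _ D] D_mem[of w' v]
  by (metis ip_star)

lemma one_plus_DstD: "z \<in> hcarrier E \<Longrightarrow> \<exists>u w v. (u, w) \<in> D \<and> (w, v) \<in> Dst \<and> u + v = z"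
  by (rule composite_surj[OF D_csub D_closed D_sub Dst_csub Dst_closed Dst_sub D_pair D_reg])
     (auto simp: shift_def)

text \<open>
  Regularity of \<open>D*\<close>. For \<open>z\<close> in the domain of \<open>D*\<close> let \<open>(1 + D* D) y = D* z\<close>; then \<open>u = z - D y\<close> satisfies
  \<open>D* u = y\<close>, so \<open>D D* u = D y = z - u\<close>.
\<close>

lemma one_plus_DDst: "z \<in> hcarrier E \<Longrightarrow> \<exists>u w v. (u, w) \<in> Dst \<and> (w, v) \<in> D \<and> u + v = z"
proof (rule composite_surj[OF Dst_csub Dst_closed Dst_sub D_csub D_closed D_sub Dst_pair Dst_dense])
  fix z assume "z \<in> Domain Dst"
  then obtain z1 where z1: "(z, z1) \<in> Dst" by blast
  obtain y w v where y: "(y, w) \<in> D" "(w, v) \<in> Dst" "y + v = z1"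
    using one_plus_DstD[OF adjoint_relD(3)[OF z1]] by blast
  have "(z - w, z1 - v) \<in> Dst" by (rule csubspace_pairD(2)[OF Dst_csub z1 y(2)])
  moreover have "z1 - v = y" by (simp flip: y(3))
  ultimately have "(z - w, y) \<in> Dst" by simp
  then show "\<exists>u w v. (u, w) \<in> Dst \<and> (w, v) \<in> D \<and> u + v = z"
    using y(1) by (intro exI[of _ "z - w"] exI[of _ y] exI[of _ w]) simp
qed

text \<open>
  The operator \<open>d(a)\<close>, the bounded extension of \<open>[D, a]\<close>.
\<close>

definition comm_ext :: "'a \<Rightarrow> 'e \<Rightarrow> 'e" where
  "comm_ext a = (SOME d. bounded_op E d \<and> (\<forall>u\<in>Domain D. d u = app D (\<phi> a u) - \<phi> a (app D u)))"

lemmas appD = clinear_on_app[OF D_csub D_sv]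

lemma comm_ext_bounded_op: "a \<in> \<A> \<Longrightarrow> bounded_op E (comm_ext a)"
  and comm_ext_eq: "a \<in> \<A> \<Longrightarrow> u \<in> Domain D \<Longrightarrow> comm_ext a u = app D (\<phi> a u) - \<phi> a (app D u)"
  using someI_ex[OF chainD(9), of a] unfolding comm_ext_def by blast+

lemma comm_ext_bounded: "a \<in> \<A> \<Longrightarrow> bounded_on (hcarrier E) (comm_ext a)"
  by (rule bounded_op_bounded_on[OF comm_ext_bounded_op])

lemma comm_ext_mem: "a \<in> \<A> \<Longrightarrow> u \<in> hcarrier E \<Longrightarrow> comm_ext a u \<in> hcarrier E"
  using bounded_onD(1)[OF comm_ext_bounded] .

lemma \<phi>_Dst_Dom: "a \<in> \<A> \<Longrightarrow> (u, w) \<in> Dst \<Longrightarrow> \<phi> a u \<in> Domain D"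
  using chainD(8)[of a] unfolding Dst_eq by blast

lemma comm_ext_D:
  assumes a: "a \<in> \<A>" and uw: "(u, w) \<in> D"
  shows "(\<phi> a u, \<phi> a w + comm_ext a u) \<in> D"
proof -
  have "(\<phi> a u, app D (\<phi> a u)) \<in> D" by (rule appD(4)[OF \<phi>_Dst_Dom[OF a subsetD[OF D_Dst uw]]])
  moreover have "comm_ext a u = app D (\<phi> a u) - \<phi> a w" using comm_ext_eq[OF a DomainI[OF uw]] appD(3)[OF uw] by simp
  ultimately show ?thesis by simp
qed

text \<open>
  On the domain of \<open>D\<close> this is the Leibniz rule, and both sides are continuous.
\<close>

lemma comm_ext_adj:
  assumes a: "a \<in> \<A>" and uv: "u \<in> hcarrier E" "v \<in> hcarrier E"
  shows "hinner E (comm_ext a u) v = - hinner E u (comm_ext (star a) v)"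
proof -
  have aA: "a \<in> A" "star a \<in> A" "star a \<in> \<A>" using a \<A>A AD \<A>D by auto
  have core: "hinner E (comm_ext a s) t = - hinner E s (comm_ext (star a) t)" if "(s, s') \<in> D" "(t, t') \<in> D" for s s' t t'
  proof -
    note sD = D_mem[OF that(1)] and tD = D_mem[OF that(2)]
    note 1 = comm_ext_D[OF a that(1)] and 2 = comm_ext_D[OF aA(3) that(2)]
    have "hinner E (\<phi> a s' + comm_ext a s) t = hinner E (\<phi> a s) t'"
      using D_pair[OF 1 subsetD[OF D_Dst that(2)]] by simp
    moreover have "hinner E s' (\<phi> (star a) t) = hinner E s (\<phi> (star a) t' + comm_ext (star a) t)"
      using D_pair[OF that(1) subsetD[OF D_Dst 2]] by simp
    ultimately show ?thesis using sD tD aA comm_ext_mem[OF a sD(1)] comm_ext_mem[OF aA(3) tD(1)]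
      by (simp add: ip_add ip_add_left cD(7,8)) (simp add: algebra_simps eq_neg_iff_add_eq_0)
  qed
  obtain s where s: "\<And>n. s n \<in> Domain D" "s \<longlonglongrightarrow> u" using uv D_dense closure_sequential by metis
  obtain t where t: "\<And>n. t n \<in> Domain D" "t \<longlonglongrightarrow> v" using uv D_dense closure_sequential by metis
  have sH: "s n \<in> hcarrier E" and tH: "t n \<in> hcarrier E" for n using s(1)[of n] t(1)[of n] D_mem by auto
  have "(\<lambda>n. hinner E (comm_ext a (s n)) (t n)) \<longlonglongrightarrow> hinner E (comm_ext a u) v"
    by (intro ip_tendsto comm_ext_mem a sH tH uv t(2) bounded_on_tendsto[OF comm_ext_bounded csub] s(2))
  moreover have "(\<lambda>n. - hinner E (s n) (comm_ext (star a) (t n))) \<longlonglongrightarrow> - hinner E u (comm_ext (star a) v)"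
    by (intro tendsto_minus ip_tendsto comm_ext_mem aA sH tH uv t(2) bounded_on_tendsto[OF comm_ext_bounded csub] s(2))
  moreover have "hinner E (comm_ext a (s n)) (t n) = - hinner E (s n) (comm_ext (star a) (t n))" for n
    using core s(1)[of n] t(1)[of n] by blast
  ultimately show ?thesis using LIMSEQ_unique by simp
qed

text \<open>
  Thus \<open>d(a)\<close> is also the commutator of \<open>a\<close> with \<open>D*\<close>: both candidates for \<open>D (a u)\<close> have the same inner products with
  the domain of \<open>D\<close>.
\<close>

lemma comm_ext_Dst:
  assumes a: "a \<in> \<A>" and uw: "(u, w) \<in> Dst"
  shows "(\<phi> a u, \<phi> a w + comm_ext a u) \<in> D"
proof -
  have aA: "a \<in> A" "star a \<in> A" "star a \<in> \<A>" using a \<A>A AD \<A>D by auto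
  obtain y where y: "(\<phi> a u, y) \<in> D" using \<phi>_Dst_Dom[OF a uw] by blast
  note uwH = adjoint_relD(2,3)[OF uw]
  have yH: "y \<in> hcarrier E" using D_mem y by blast
  have mem: "\<phi> a w \<in> hcarrier E" "comm_ext a u \<in> hcarrier E" using uwH aA a comm_ext_mem cD(8) by auto
  have "y - (\<phi> a w + comm_ext a u) = 0"
  proof (rule dense_orthogonal_zero[OF _ D_dense])
    show "Domain D \<subseteq> hcarrier E" using D_mem by auto
    show "y - (\<phi> a w + comm_ext a u) \<in> hcarrier E" using yH mem by simp
    fix s assume "s \<in> Domain D"
    then obtain t where st: "(s, t) \<in> D" by blast
    note stH = D_mem[OF st]
    have "hinner E s y = hinner E t (\<phi> a u)" using D_pair[OF st subsetD[OF D_Dst y]] .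
    also have "\<dots> = hinner E (\<phi> (star a) t) u" using cD(7)[OF aA(2) stH(2) uwH(1)] by (simp add: star_star)
    also have "\<phi> (star a) t = (\<phi> (star a) t + comm_ext (star a) s) - comm_ext (star a) s" by simp
    also have "hinner E \<dots> u = hinner E (\<phi> (star a) t + comm_ext (star a) s) u - hinner E (comm_ext (star a) s) u"
      using stH aA uwH by (intro ip_diff_left) (simp_all add: comm_ext_mem cD(8))
    also have "hinner E (\<phi> (star a) t + comm_ext (star a) s) u = hinner E (\<phi> (star a) s) w"
      using D_pair[OF comm_ext_D[OF aA(3) st] uw] by simp
    also have "\<dots> = hinner E s (\<phi> a w)" using cD(7)[OF aA(2) stH(1) uwH(2)] by (simp add: star_star)
    also have "hinner E (comm_ext (star a) s) u = - hinner E s (comm_ext a u)"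
      using comm_ext_adj[OF aA(3) stH(1) uwH(1)] by (simp add: star_star)
    finally show "hinner E s (y - (\<phi> a w + comm_ext a u)) = 0" using stH yH mem by (simp add: ip_diff ip_add)
  qed
  then show ?thesis using y by simp
qed

end

section \<open>Selfadjointness and regularity of the localized operator\<close>

lemma csubspace_closure:
  assumes S: "csubspace S" shows "csubspace (closure S)"
  unfolding csubspace_def
proof (intro conjI ballI allI)
  show "0 \<in> closure S" using csubspaceD(1)[OF S] closure_subset by auto
  fix u assume "u \<in> closure S"
  then obtain s where s: "\<And>n. s n \<in> S" "s \<longlonglongrightarrow> u" using closure_sequential by metis
  show "c *\<^sub>C u \<in> closure S" for c unfolding closure_sequential
    by (intro exI[of _ "\<lambda>n. c *\<^sub>C s n"] conjI allI csubspaceD(3)[OF S] s(1) tendsto_scaleC s(2))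
  fix v assume "v \<in> closure S"
  then obtain t where t: "\<And>n. t n \<in> S" "t \<longlonglongrightarrow> v" using closure_sequential by metis
  show "u + v \<in> closure S" unfolding closure_sequential
    by (intro exI[of _ "\<lambda>n. s n + t n"] conjI allI csubspaceD(2)[OF S] s t tendsto_add)
qed

lemma (in inner_module) adjoint_rel_closure:
  assumes D: "D \<subseteq> H \<times> H"
  shows "adjoint_rel H ip (closure D) = adjoint_rel H ip D"
proof
  show "adjoint_rel H ip (closure D) \<subseteq> adjoint_rel H ip D"
    using closure_subset[of D] unfolding adjoint_rel_def by blast
  show "adjoint_rel H ip D \<subseteq> adjoint_rel H ip (closure D)"
  proof clarify
    fix y z assume yz: "(y, z) \<in> adjoint_rel H ip D"
    note H = adjoint_relD(2,3)[OF yz]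
    show "(y, z) \<in> adjoint_rel H ip (closure D)"
    proof (rule adjoint_relI[OF H])
      fix u v assume "(u, v) \<in> closure D"
      then obtain s where s: "\<And>n. s n \<in> D" "s \<longlonglongrightarrow> (u, v)" using closure_sequential by metis
      have sH: "fst (s n) \<in> H" "snd (s n) \<in> H" for n using s(1)[of n] D by auto
      have lim: "(\<lambda>n. fst (s n)) \<longlonglongrightarrow> u" "(\<lambda>n. snd (s n)) \<longlonglongrightarrow> v"
        using tendsto_fst[OF s(2)] tendsto_snd[OF s(2)] by simp_all
      have uvH: "u \<in> H" "v \<in> H"
        by (rule closed_sequentially[OF closed_H _ lim(1)], rule sH, rule closed_sequentially[OF closed_H _ lim(2)], rule sH)
      have "ip (snd (s n)) y = ip (fst (s n)) z" for n
        using adjoint_relD(1)[OF yz, of "fst (s n)" "snd (s n)"] s(1)[of n] by simp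
      moreover have "(\<lambda>n. ip (snd (s n)) y) \<longlonglongrightarrow> ip v y" "(\<lambda>n. ip (fst (s n)) z) \<longlonglongrightarrow> ip u z"
        by (intro ip_tendsto sH uvH H lim tendsto_const)+
      ultimately show "ip v y = ip u z" using LIMSEQ_unique by simp
    qed
  qed
qed

locale localization = half_closed A \<A> E \<phi> D g
  for A :: "'a::cstar_algebra set" and \<A> :: "'a set"
    and E :: "('e::complex_normed_vector, 'b::cstar_algebra) module_data"
    and \<phi> :: "'a \<Rightarrow> 'e \<Rightarrow> 'e" and D :: "('e \<times> 'e) set"
    and g :: "('e \<Rightarrow> 'e) option" +
  fixes x :: 'a
  assumes x\<A>: "x \<in> \<A>" and sigma: "sigma_unital A"
begin

abbreviation "Hx \<equiv> closure (\<phi> x ` hcarrier E)"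
abbreviation "Eloc \<equiv> loc_module E \<phi> x"
abbreviation "Ax \<equiv> loc_algebra A x"
abbreviation "Dx \<equiv> loc_operator E \<phi> D x"

lemma x_mem: "x \<in> A" "star x \<in> A" "star x \<in> \<A>"
  using x\<A> \<A>A AD \<A>D by auto

lemma Eloc_simps [simp]: "hcarrier Eloc = Hx" "hinner Eloc = hinner E" "hact Eloc = hact E"
  by (simp_all add: loc_module_def)

lemma \<phi>_diff: "a \<in> A \<Longrightarrow> b \<in> A \<Longrightarrow> u \<in> hcarrier E \<Longrightarrow> \<phi> (a - b) u = \<phi> a u - \<phi> b u"
  using cD(4)[of a "- b" u] cD(6)[of b u "-1"] AD by simp

lemma \<phi>_le: "a \<in> A \<Longrightarrow> u \<in> hcarrier E \<Longrightarrow> norm (\<phi> a u) \<le> norm a * norm u"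
  by (rule correspondence_contractive[OF chainD(1,3)])

lemma \<phi>_tendsto: "a \<in> A \<Longrightarrow> (\<And>n. u n \<in> hcarrier E) \<Longrightarrow> l \<in> hcarrier E \<Longrightarrow> u \<longlonglongrightarrow> l \<Longrightarrow> (\<lambda>n. \<phi> a (u n)) \<longlonglongrightarrow> \<phi> a l"
  by (rule bounded_on_tendsto[OF cD(9) csub])

lemma submodule_Hx: "submodule E Hx"
proof (rule submodule_closure[OF cD(1)])
  note lin = clinear_onD[OF cD(10)[OF x_mem(1)]]
  show "submodule E (\<phi> x ` hcarrier E)" unfolding submodule_def
  proof (intro conjI ballI allI)
    show "\<phi> x ` hcarrier E \<subseteq> hcarrier E" using cD(8) x_mem by blast
    show "0 \<in> \<phi> x ` hcarrier E" using lin(5)[OF csub] by (metis imageI mem(1))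
    fix u assume "u \<in> \<phi> x ` hcarrier E"
    then obtain u' where u': "u' \<in> hcarrier E" "u = \<phi> x u'" by blast
    show "c *\<^sub>C u \<in> \<phi> x ` hcarrier E" for c using u' lin(2)[of u' c, symmetric] by simp
    show "hact E u b \<in> \<phi> x ` hcarrier E" for b
      using u' bounded_opD(2)[OF cD(3)[OF x_mem(1)], of u' b, symmetric] submoduleD(5)[OF hm(1), of u' b] by simp
    fix v assume "v \<in> \<phi> x ` hcarrier E"
    then obtain v' where v': "v' \<in> hcarrier E" "v = \<phi> x v'" by blast
    show "u + v \<in> \<phi> x ` hcarrier E" using u' v' lin(1)[of u' v', symmetric] by simp
  qed
qed

lemma hilbert_Eloc: "hilbert_module Eloc"
  unfolding loc_module_def by (rule hilbert_module_restrict[OF cD(1) submodule_Hx closed_closure])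

lemma Hx_sub: "Hx \<subseteq> hcarrier E"
  by (rule submoduleD(1)[OF submodule_Hx])

lemma HxH: "u \<in> Hx \<Longrightarrow> u \<in> hcarrier E"
  using Hx_sub by blast

lemma \<phi>x_Hx: "u \<in> hcarrier E \<Longrightarrow> \<phi> x u \<in> Hx"
  by (rule subsetD[OF closure_subset imageI])

text \<open>
  Every estimate is used both on \<open>E\<close> and, with the prefix \<open>X\<close>, on \<open>E\<^sub>x\<close>.
\<close>

sublocale X: inner_module Hx "hinner E" 1
  using hilbert_module_inner_module[OF hilbert_Eloc] by simp

lemma Ax_approx: "a \<in> Ax \<Longrightarrow> 0 < e \<Longrightarrow> \<exists>c\<in>A. norm (a - x * c * star x) < e"
proof -
  assume a: "a \<in> Ax" and e: "0 < e"
  then obtain b where "b \<in> {x * c * star x | c. c \<in> A}" "dist b a < e"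
    unfolding loc_algebra_def closure_approachable by blast
  then show ?thesis by (auto simp: dist_norm norm_minus_commute)
qed

lemma mult_Ax: "c \<in> A \<Longrightarrow> x * c * star x \<in> Ax"
  unfolding loc_algebra_def using closure_subset[of "{x * a * star x | a. a \<in> A}"] by auto

lemma star_subalgebra_closure:
  assumes "star_subalgebra S" shows "star_subalgebra (closure S)"
  unfolding star_subalgebra_def
proof (intro conjI ballI allI)
  note SD = star_subalgebraD[OF assms]
  show "0 \<in> closure S" using SD(1) closure_subset by blast
  fix a assume "a \<in> closure S"
  then obtain s where s: "\<And>n. s n \<in> S" "s \<longlonglongrightarrow> a" using closure_sequential by metis
  show "star a \<in> closure S" unfolding closure_sequential
    by (intro exI[of _ "\<lambda>n. star (s n)"] conjI allI SD s tendsto_star)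
  show "c *\<^sub>C a \<in> closure S" for c unfolding closure_sequential
    by (intro exI[of _ "\<lambda>n. c *\<^sub>C s n"] conjI allI SD s tendsto_scaleC)
  fix b assume "b \<in> closure S"
  then obtain t where t: "\<And>n. t n \<in> S" "t \<longlonglongrightarrow> b" using closure_sequential by metis
  show "a + b \<in> closure S" unfolding closure_sequential
    by (intro exI[of _ "\<lambda>n. s n + t n"] conjI allI SD s t tendsto_add)
  show "a * b \<in> closure S" unfolding closure_sequential
    by (intro exI[of _ "\<lambda>n. s n * t n"] conjI allI SD s t tendsto_mult)
qed

lemma cstar_Ax: "cstar_subalgebra Ax"
proof -
  have "star_subalgebra {x * a * star x | a. a \<in> A}"
    unfolding star_subalgebra_def
  proof (intro conjI ballI allI)
    show "0 \<in> {x * a * star x | a. a \<in> A}" using AD(1) by force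
    fix b assume "b \<in> {x * a * star x | a. a \<in> A}"
    then obtain a where a: "a \<in> A" "b = x * a * star x" by blast
    show "star b \<in> {x * a * star x | a. a \<in> A}"
      using a AD(2) by (auto simp: star_mult star_star mult.assoc intro!: exI[of _ "star a"])
    show "c *\<^sub>C b \<in> {x * a * star x | a. a \<in> A}" for c
      using a AD(3) by (auto simp: mult_scaleC_left mult_scaleC_right intro!: exI[of _ "c *\<^sub>C a"])
    fix b' assume "b' \<in> {x * a * star x | a. a \<in> A}"
    then obtain a' where a': "a' \<in> A" "b' = x * a' * star x" by blast
    show "b + b' \<in> {x * a * star x | a. a \<in> A}"
      using a a' AD(4) by (auto simp: algebra_simps intro!: exI[of _ "a + a'"])
    show "b * b' \<in> {x * a * star x | a. a \<in> A}"
      using a a' AD(5) x_mem by (auto simp: mult.assoc intro!: exI[of _ "a * (star x * x) * a'"])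
  qed
  then show ?thesis unfolding cstar_subalgebra_def loc_algebra_def by (auto intro: star_subalgebra_closure)
qed

lemma Ax_A: "Ax \<subseteq> A"
  unfolding loc_algebra_def using x_mem AD by (intro closure_minimal closedA) auto

lemma Ax_mem: "a \<in> Ax \<Longrightarrow> a \<in> A"
  using Ax_A by blast

lemma star_Ax: "star_subalgebra Ax"
  using cstar_Ax by (simp add: cstar_subalgebra_def)

lemmas AxD = star_subalgebraD[OF star_Ax]

text \<open>
  An approximate unit \<open>u\<^sub>n\<close> of \<open>A\<close> gives \<open>x x* = lim x u\<^sub>n x*\<close>.
\<close>

lemma \<Delta>_Ax: "x * star x \<in> Ax"
proof -
  obtain u :: "nat \<Rightarrow> 'a" where u: "\<And>n. u n \<in> A" "\<And>a. a \<in> A \<Longrightarrow> (\<lambda>n. a * u n) \<longlonglongrightarrow> a"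
    using sigma unfolding sigma_unital_def by blast
  have "(\<lambda>n. x * u n * star x) \<longlonglongrightarrow> x * star x"
    by (intro tendsto_mult u(2) x_mem tendsto_const)
  moreover have "closed Ax" using cstar_Ax by (simp add: cstar_subalgebra_def)
  ultimately show ?thesis using closed_sequentially[of Ax "\<lambda>n. x * u n * star x"] mult_Ax u(1) by blast
qed

lemma \<phi>_mult_Hx: "c \<in> A \<Longrightarrow> u \<in> hcarrier E \<Longrightarrow> \<phi> (x * c) u \<in> Hx"
  using cD(5)[OF x_mem(1), of c u] \<phi>x_Hx cD(8) by simp

lemma \<phi>_Ax_Hx:
  assumes a: "a \<in> Ax" and u: "u \<in> hcarrier E" shows "\<phi> a u \<in> Hx"
proof -
  have "\<phi> a u \<in> closure Hx" unfolding closure_approachable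
  proof (intro allI impI)
    fix e :: real assume e: "0 < e"
    obtain c where c: "c \<in> A" "norm (a - x * c * star x) < e / (norm u + 1)"
      using Ax_approx[OF a, of "e / (norm u + 1)"] e by (auto simp: add_nonneg_pos)
    have xc: "x * c * star x = x * (c * star x)" "c * star x \<in> A" using c x_mem AD by (auto simp: mult.assoc)
    have "\<phi> a u - \<phi> (x * c * star x) u = \<phi> (a - x * c * star x) u"
      using a c u x_mem AD Ax_mem by (simp add: \<phi>_diff)
    then have "norm (\<phi> a u - \<phi> (x * c * star x) u) \<le> norm (a - x * c * star x) * norm u"
      using \<phi>_le[of "a - x * c * star x" u] a c u x_mem AD Ax_mem by simp
    also have "\<dots> \<le> norm (a - x * c * star x) * (norm u + 1)" by (intro mult_left_mono) simp_all
    also have "\<dots> < e" using c(2) by (simp add: pos_less_divide_eq add_nonneg_pos)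
    finally show "\<exists>y\<in>Hx. dist y (\<phi> a u) < e"
      using \<phi>_mult_Hx[OF xc(2) u] by (intro bexI[of _ "\<phi> (x * c * star x) u"]) (simp_all add: xc dist_norm norm_minus_commute)
  qed
  then show ?thesis by simp
qed

lemma dense_Ax: "dense_star_subalgebra (\<A> \<inter> Ax) Ax"
  unfolding dense_star_subalgebra_def
proof (intro conjI)
  show "star_subalgebra (\<A> \<inter> Ax)"
    unfolding star_subalgebra_def using \<A>D(1-5) AxD(1-5) by simp
  show "\<A> \<inter> Ax \<subseteq> Ax" by blast
  show "Ax \<subseteq> closure (\<A> \<inter> Ax)"
  proof -
    have "x * a * star x \<in> closure (\<A> \<inter> Ax)" if a: "a \<in> A" for a
    proof -
      obtain s where s: "\<And>n. s n \<in> \<A>" "s \<longlonglongrightarrow> a" using subsetD[OF \<A>dense a] unfolding closure_sequential by blast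
      have "x * s n * star x \<in> \<A> \<inter> Ax" for n
        using \<A>D(5)[OF \<A>D(5)[OF x\<A> s(1)] x_mem(3)] mult_Ax[OF subsetD[OF \<A>A s(1)]] by (rule IntI)
      moreover have "(\<lambda>n. x * s n * star x) \<longlonglongrightarrow> x * a * star x"
        by (intro tendsto_mult tendsto_const s)
      ultimately show ?thesis unfolding closure_sequential
        by (intro exI[of _ "\<lambda>n. x * s n * star x"] conjI allI)
    qed
    then show ?thesis unfolding loc_algebra_def[of A x] by (intro closure_minimal) auto
  qed
qed

text \<open>
  The operator \<open>x D x*\<close> before closing.
\<close>

definition core_graph :: "('e \<times> 'e) set" where
  "core_graph = {(u, \<phi> x (app D (\<phi> (star x) u))) | u. u \<in> Domain D \<inter> Hx}"

lemma Dx_eq: "Dx = closure core_graph"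
  unfolding loc_operator_def core_graph_def by simp

lemma \<phi>_Dom: "a \<in> \<A> \<Longrightarrow> u \<in> Domain D \<Longrightarrow> \<phi> a u \<in> Domain D"
  using \<phi>_Dst_Dom D_Dst by blast

lemma core_graphI: "u \<in> Domain D \<Longrightarrow> u \<in> Hx \<Longrightarrow> (\<phi> (star x) u, v) \<in> D \<Longrightarrow> (u, \<phi> x v) \<in> core_graph"
  unfolding core_graph_def using appD(3)[of "\<phi> (star x) u" v] by auto

lemma core_graphE:
  assumes "(u, z) \<in> core_graph"
  obtains v where "u \<in> Domain D" "u \<in> Hx" "(\<phi> (star x) u, v) \<in> D" "z = \<phi> x v"
  using assms appD(4)[OF \<phi>_Dom[OF x_mem(3)], of u] unfolding core_graph_def by auto

lemma core_graph_sub: "core_graph \<subseteq> Hx \<times> Hx"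
proof clarify
  fix u z assume "(u, z) \<in> core_graph"
  then show "u \<in> Hx \<and> z \<in> Hx" by (rule core_graphE) (auto intro: \<phi>x_Hx D_mem)
qed

lemma core_graph_csub: "csubspace core_graph"
  unfolding csubspace_def
proof (intro conjI ballI allI)
  note lin = clinear_onD[OF cD(10)[OF x_mem(1)]] and lins = clinear_onD[OF cD(10)[OF x_mem(2)]]
  have z: "\<phi> x 0 = 0" "\<phi> (star x) 0 = 0" using lin(5) lins(5) csub by auto
  have "(0, \<phi> x 0) \<in> core_graph" using csubspace_pairD(5)[OF D_csub] by (intro core_graphI) (auto simp: z)
  then show "0 \<in> core_graph" by (simp add: z zero_prod_def)
  fix p assume p: "p \<in> core_graph"
  obtain u w where uw: "p = (u, w)" by (cases p)
  obtain v where v: "u \<in> Domain D" "u \<in> Hx" "(\<phi> (star x) u, v) \<in> D" "w = \<phi> x v" using p uw by (metis core_graphE)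
  note H = HxH[OF v(2)] D_mem[OF v(3)]
  have "(c *\<^sub>C u, \<phi> x (c *\<^sub>C v)) \<in> core_graph" for c
    using csubspaceD(3)[OF appD(2) v(1)] csubspace_pairD(3)[OF D_csub v(3)] v(2) H by (intro core_graphI) (simp_all add: lins)
  then show "c *\<^sub>C p \<in> core_graph" for c using H v by (simp add: uw lin)
  fix q assume q: "q \<in> core_graph"
  obtain u' w' where uw': "q = (u', w')" by (cases q)
  obtain v' where v': "u' \<in> Domain D" "u' \<in> Hx" "(\<phi> (star x) u', v') \<in> D" "w' = \<phi> x v'" using q uw' by (metis core_graphE)
  note H' = HxH[OF v'(2)] D_mem[OF v'(3)]
  have "(u + u', \<phi> x (v + v')) \<in> core_graph"
    using csubspaceD(2)[OF appD(2) v(1) v'(1)] csubspace_pairD(1)[OF D_csub v(3) v'(3)] v(2) v'(2) H H'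
    by (intro core_graphI) (simp_all add: lins)
  then show "p + q \<in> core_graph" using H v H' v' by (simp add: uw uw' lin)
qed

lemma Dx_csub: "csubspace Dx"
  unfolding Dx_eq by (rule csubspace_closure[OF core_graph_csub])

lemma Dx_closed: "closed Dx"
  unfolding Dx_eq by simp

lemma core_graph_Dx: "core_graph \<subseteq> Dx"
  unfolding Dx_eq by (rule closure_subset)

lemma Dx_sub: "Dx \<subseteq> Hx \<times> Hx"
  unfolding Dx_eq by (intro closure_minimal core_graph_sub closed_Times closed_closure)

lemma Dx_mem: "(u, v) \<in> Dx \<Longrightarrow> u \<in> Hx" "(u, v) \<in> Dx \<Longrightarrow> v \<in> Hx"
  using Dx_sub by auto

lemma core_graph_symmetric: "core_graph \<subseteq> adjoint_rel Hx (hinner E) core_graph"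
proof clarify
  fix y z assume yz: "(y, z) \<in> core_graph"
  obtain v where v: "y \<in> Domain D" "y \<in> Hx" "(\<phi> (star x) y, v) \<in> D" "z = \<phi> x v" using yz by (rule core_graphE)
  show "(y, z) \<in> adjoint_rel Hx (hinner E) core_graph"
  proof (rule adjoint_relI)
    show "y \<in> Hx" "z \<in> Hx" using yz core_graph_sub by auto
    fix u w assume uw: "(u, w) \<in> core_graph"
    obtain t where t: "u \<in> Domain D" "u \<in> Hx" "(\<phi> (star x) u, t) \<in> D" "w = \<phi> x t" using uw by (rule core_graphE)
    have "hinner E w y = hinner E t (\<phi> (star x) y)"
      unfolding t(4) by (rule cD(7)[OF x_mem(1) D_mem(2)[OF t(3)] HxH[OF v(2)]])
    also have "\<dots> = hinner E (\<phi> (star x) u) v" by (rule D_pair[OF t(3) subsetD[OF D_Dst v(3)], symmetric])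
    also have "\<dots> = hinner E u z"
      unfolding v(4) using cD(7)[OF x_mem(2) HxH[OF t(2)] D_mem(2)[OF v(3)]] by (simp add: star_star)
    finally show "hinner E w y = hinner E u z" .
  qed
qed

text \<open>
  An adjoint is closed and does not change when the operator is closed.
\<close>

lemma Dx_symmetric: "Dx \<subseteq> adjoint_rel Hx (hinner E) Dx"
  unfolding Dx_eq X.adjoint_rel_closure[OF core_graph_sub]
  by (rule closure_minimal[OF core_graph_symmetric X.closed_adjoint_rel[OF core_graph_sub]])

lemma Hx_approx: "w \<in> Hx \<Longrightarrow> 0 < e \<Longrightarrow> \<exists>u\<in>hcarrier E. norm (\<phi> x u - w) < e"
  unfolding closure_approachable by (auto simp: dist_norm)

lemma Dx_range_dense:
  "\<exists>m>0. \<forall>\<sigma>. (\<sigma> = 1 \<or> \<sigma> = -1) \<longrightarrow> (\<forall>w\<in>Hx. \<forall>e>0. \<exists>(u, v)\<in>Dx. norm (v + (\<i> * of_real \<sigma>) *\<^sub>C m *\<^sub>R u - w) < e)"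
proof -
  have "\<exists>m>0. \<forall>\<sigma>. (\<sigma> = 1 \<or> \<sigma> = -1) \<longrightarrow> (\<forall>w\<in>hcarrier E. \<forall>e>0. \<exists>y\<in>hcarrier E. \<exists>v.
      \<phi> x y \<in> Domain D \<and> (\<phi> (star x) (\<phi> x y), v) \<in> D \<and>
      norm (\<phi> x v + (\<i> * of_real \<sigma>) *\<^sub>C m *\<^sub>R \<phi> x y - \<phi> x w) < e)"
    by (rule half_closed_localized[where x = "\<phi> x" and x' = "\<phi> (star x)" and d = "comm_ext x" and d' = "comm_ext (star x)"])
      (use D_csub D_sub D_dense D_Dst one_plus_DstD one_plus_DDst cD(9) cD(7) x_mem x\<A> chainD(8) comm_ext_bounded comm_ext_Dst in \<open>simp_all add: Dst_eq\<close>)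
  then obtain m where m: "0 < m" and ap: "\<And>\<sigma> w e. \<sigma> = 1 \<or> \<sigma> = -1 \<Longrightarrow> w \<in> hcarrier E \<Longrightarrow> 0 < e \<Longrightarrow> \<exists>y\<in>hcarrier E. \<exists>v.
      \<phi> x y \<in> Domain D \<and> (\<phi> (star x) (\<phi> x y), v) \<in> D \<and>
      norm (\<phi> x v + (\<i> * of_real \<sigma>) *\<^sub>C m *\<^sub>R \<phi> x y - \<phi> x w) < e" by metis
  show ?thesis
  proof (intro exI[of _ m] conjI m allI impI ballI)
    fix \<sigma> :: real and w and e :: real assume s: "\<sigma> = 1 \<or> \<sigma> = -1" and w: "w \<in> Hx" and e: "0 < e"
    obtain w' where w': "w' \<in> hcarrier E" "norm (\<phi> x w' - w) < e / 2" using Hx_approx[OF w, of "e / 2"] e by auto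
    obtain y v where yv: "y \<in> hcarrier E" "\<phi> x y \<in> Domain D" "(\<phi> (star x) (\<phi> x y), v) \<in> D"
      "norm (\<phi> x v + (\<i> * of_real \<sigma>) *\<^sub>C m *\<^sub>R \<phi> x y - \<phi> x w') < e / 2"
      using ap[OF s w'(1), of "e / 2"] e by auto
    have "(\<phi> x y, \<phi> x v) \<in> Dx" using core_graphI[OF yv(2) \<phi>x_Hx[OF yv(1)] yv(3)] core_graph_Dx by blast
    moreover have "norm (\<phi> x v + (\<i> * of_real \<sigma>) *\<^sub>C m *\<^sub>R \<phi> x y - w) < e"
      using norm_triangle_lt[OF add_strict_mono[OF yv(4) w'(2)]] by simp
    ultimately show "\<exists>(u, v)\<in>Dx. norm (v + (\<i> * of_real \<sigma>) *\<^sub>C m *\<^sub>R u - w) < e" by blast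
  qed
qed

lemma Dx_surj: "\<sigma> = 1 \<or> \<sigma> = -1 \<Longrightarrow> z \<in> Hx \<Longrightarrow> \<exists>(u, v)\<in>Dx. v + (\<i> * of_real \<sigma>) *\<^sub>C u = z"
proof -
  assume s: "\<sigma> = 1 \<or> \<sigma> = -1" and z: "z \<in> Hx"
  obtain m where m: "0 < m" and ap: "\<And>\<sigma> w e. \<sigma> = 1 \<or> \<sigma> = -1 \<Longrightarrow> w \<in> Hx \<Longrightarrow> 0 < e \<Longrightarrow>
      \<exists>(u, v)\<in>Dx. norm (v + (\<i> * of_real \<sigma>) *\<^sub>C m *\<^sub>R u - w) < e"
    using Dx_range_dense by metis
  show ?thesis
    by (rule X.symmetric_graph_range[OF Dx_csub Dx_closed Dx_sub Dx_symmetric m ap[OF s] s z])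
qed

lemma Dx_selfadjoint: "adjoint_rel Hx (hinner E) Dx = Dx"
  using X.symmetric_graph_selfadjoint[OF Dx_csub Dx_sub Dx_symmetric Dx_surj] by simp

lemma adjoint_graph_Dx: "adjoint_graph Eloc Dx = Dx"
  using Dx_selfadjoint by (simp add: adjoint_graph_def adjoint_rel_def)

lemma Dx_dense: "closure (Domain Dx) = Hx"
proof
  show "closure (Domain Dx) \<subseteq> Hx" using Dx_sub by (intro closure_minimal) auto
  have "\<phi> x u \<in> closure (Domain Dx)" if u: "u \<in> hcarrier E" for u
  proof -
    obtain s where s: "\<And>n. s n \<in> Domain D" "s \<longlonglongrightarrow> u" using u D_dense closure_sequential by metis
    have sH: "s n \<in> hcarrier E" for n using s(1)[of n] D_mem by auto
    have "\<phi> x (s n) \<in> Domain Dx" for n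
    proof -
      have 1: "\<phi> x (s n) \<in> Domain D" by (rule \<phi>_Dom[OF x\<A> s(1)])
      obtain v where "(\<phi> (star x) (\<phi> x (s n)), v) \<in> D" using \<phi>_Dom[OF x_mem(3) 1] by blast
      from core_graphI[OF 1 \<phi>x_Hx[OF sH] this] show ?thesis using core_graph_Dx by blast
    qed
    moreover have "(\<lambda>n. \<phi> x (s n)) \<longlonglongrightarrow> \<phi> x u" by (rule \<phi>_tendsto[OF x_mem(1) sH u s(2)])
    ultimately show ?thesis unfolding closure_sequential
      by (intro exI[of _ "\<lambda>n. \<phi> x (s n)"] conjI allI)
  qed
  then show "Hx \<subseteq> closure (Domain Dx)" by (intro closure_minimal) auto
qed

lemma hact_tendsto: "(\<And>n. u n \<in> hcarrier E) \<Longrightarrow> l \<in> hcarrier E \<Longrightarrow> u \<longlonglongrightarrow> l \<Longrightarrow> (\<lambda>n. hact E (u n) b) \<longlonglongrightarrow> hact E l b"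
proof (rule bounded_on_tendsto[where T = "\<lambda>u. hact E u b", OF _ csub])
  show "bounded_on (hcarrier E) (\<lambda>u. hact E u b)"
    unfolding bounded_on_def clinear_on_def using hm(3,6) submoduleD(5)[OF hm(1)] norm_hact_le[OF cD(1)]
    by (intro conjI exI[of _ "norm b"]) (auto simp: mult.commute)
qed

lemma Dx_unbounded: "unbounded_op Eloc Dx"
  unfolding unbounded_op_def Eloc_simps
proof (intro conjI)
  show "Dx \<subseteq> Hx \<times> Hx" by (rule Dx_sub)
  show "single_valued Dx" using X.adjoint_rel_single_valued[OF Dx_sub Dx_dense] by (simp add: Dx_selfadjoint)
  show "(0, 0) \<in> Dx" by (rule csubspace_pairD(5)[OF Dx_csub])
  show "\<forall>(u, v)\<in>Dx. \<forall>(u', v')\<in>Dx. (u + u', v + v') \<in> Dx"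
    by clarify (rule csubspace_pairD(1)[OF Dx_csub])
  have "(hact E u b, hact E v b) \<in> Dx" if uv: "(u, v) \<in> Dx" for u v b
  proof -
    obtain s where s: "\<And>n. s n \<in> core_graph" "s \<longlonglongrightarrow> (u, v)" using uv unfolding Dx_eq closure_sequential by blast
    have sH: "fst (s n) \<in> Hx" "snd (s n) \<in> Hx" for n using s(1)[of n] core_graph_sub by auto
    have "(hact E (fst (s n)) b, hact E (snd (s n)) b) \<in> core_graph" for n
    proof -
      have "(fst (s n), snd (s n)) \<in> core_graph" using s(1)[of n] by simp
      then obtain t where t: "fst (s n) \<in> Domain D" "fst (s n) \<in> Hx" "(\<phi> (star x) (fst (s n)), t) \<in> D" "snd (s n) = \<phi> x t"
        by (rule core_graphE)
      have "\<forall>(u, v)\<in>D. (\<forall>c. (c *\<^sub>C u, c *\<^sub>C v) \<in> D) \<and> (\<forall>b. (hact E u b, hact E v b) \<in> D)"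
        using D_unb unfolding unbounded_op_def by (elim conjE)
      then have act: "(hact E u b, hact E v b) \<in> D" if "(u, v) \<in> D" for u v
        using that by auto
      have 1: "hact E (fst (s n)) b \<in> Domain D" using t(1) act by blast
      have 2: "hact E (fst (s n)) b \<in> Hx" by (rule submoduleD(5)[OF submodule_Hx t(2)])
      have 3: "(\<phi> (star x) (hact E (fst (s n)) b), hact E t b) \<in> D"
        using act[OF t(3)] bounded_opD(2)[OF cD(3)[OF x_mem(2)] HxH[OF t(2)]] by simp
      show ?thesis
        using core_graphI[OF 1 2 3] bounded_opD(2)[OF cD(3)[OF x_mem(1)] D_mem(2)[OF t(3)]] t(4) by simp
    qed
    moreover have "(\<lambda>n. (hact E (fst (s n)) b, hact E (snd (s n)) b)) \<longlonglongrightarrow> (hact E u b, hact E v b)"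
      by (intro tendsto_Pair hact_tendsto HxH sH Dx_mem[OF uv]
          tendsto_fst[OF s(2), simplified] tendsto_snd[OF s(2), simplified])
    ultimately show ?thesis unfolding Dx_eq closure_sequential
      by (intro exI[of _ "\<lambda>n. (hact E (fst (s n)) b, hact E (snd (s n)) b)"] conjI allI)
  qed
  then show "\<forall>(u, v)\<in>Dx. (\<forall>c. (c *\<^sub>C u, c *\<^sub>C v) \<in> Dx) \<and> (\<forall>b. (hact E u b, hact E v b) \<in> Dx)"
    by clarify (intro conjI allI csubspace_pairD(3)[OF Dx_csub])
qed

lemma Dx_regular: "regular_op Eloc Dx"
  unfolding regular_op_def densely_defined_def adjoint_graph_Dx Eloc_simps
proof (intro conjI Dx_unbounded Dx_closed Dx_dense)
  have "Range (shift 1 (Dx O Dx)) = Hx"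
  proof
    show "Range (shift 1 (Dx O Dx)) \<subseteq> Hx" using Dx_mem by (fastforce simp: shift_def)
    show "Hx \<subseteq> Range (shift 1 (Dx O Dx))"
    proof
      fix z assume z: "z \<in> Hx"
      obtain u v t where "(u, v) \<in> Dx" "(v, t) \<in> Dx" "u + t = z"
        using X.selfadjoint_one_plus_square[OF Dx_csub Dx_surj Dx_sub z] by blast
      then have "(u, z) \<in> shift 1 (Dx O Dx)" unfolding shift_def by force
      then show "z \<in> Range (shift 1 (Dx O Dx))" by blast
    qed
  qed
  then show "closure (Range (shift 1 (Dx O Dx))) = Hx" by simp
qed

lemma Dx_selfadjoint_unbounded: "selfadjoint_unbounded Eloc Dx"
  unfolding selfadjoint_unbounded_def by (rule adjoint_graph_Dx[symmetric])

end

section \<open>Compactness of the localized resolvent\<close>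

lemma op_norm_le:
  assumes "0 \<in> hcarrier E" "0 \<le> C" "\<And>u. u \<in> hcarrier E \<Longrightarrow> norm (f u) \<le> C * norm u"
  shows "op_norm E f \<le> C"
  unfolding op_norm_def
proof (rule cSUP_least)
  show "{u \<in> hcarrier E. norm u \<le> 1} \<noteq> {}" using assms(1) by force
  fix u assume "u \<in> {u \<in> hcarrier E. norm u \<le> 1}"
  then have "norm (f u) \<le> C * norm u" "C * norm u \<le> C" using assms by (auto intro: mult_left_le)
  then show "norm (f u) \<le> C" by (rule order_trans)
qed

text \<open>
  The supremum of an unbounded set of reals has no meaning, so some bound has to be known beforehand.
\<close>

lemma op_norm_ge:
  assumes sub: "csubspace (hcarrier E)" and hom: "\<And>r u. u \<in> hcarrier E \<Longrightarrow> f (r *\<^sub>R u) = r *\<^sub>R f u"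
    and bd: "\<And>u. u \<in> hcarrier E \<Longrightarrow> norm (f u) \<le> C * norm u" and u: "u \<in> hcarrier E"
  shows "norm (f u) \<le> op_norm E f * norm u"
proof (cases "u = 0")
  case True
  then show ?thesis using bd[OF u] by simp
next
  case False
  have "norm (f v) \<le> \<bar>C\<bar>" if "v \<in> hcarrier E" "norm v \<le> 1" for v
  proof -
    have "norm (f v) \<le> \<bar>C\<bar> * norm v" by (rule order_trans[OF bd[OF that(1)]]) (simp add: mult_right_mono)
    also have "\<dots> \<le> \<bar>C\<bar>" using that(2) by (simp add: mult_left_le)
    finally show ?thesis .
  qed
  then have bdd: "bdd_above ((\<lambda>u. norm (f u)) ` {u \<in> hcarrier E. norm u \<le> 1})"
    by (intro bdd_aboveI2[of _ _ "\<bar>C\<bar>"]) auto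
  let ?v = "inverse (norm u) *\<^sub>R u"
  have "?v \<in> {u \<in> hcarrier E. norm u \<le> 1}" using csubspaceD(4)[OF sub u] False by simp
  then have "norm (f ?v) \<le> op_norm E f" unfolding op_norm_def by (rule cSUP_upper[OF _ bdd])
  then have "inverse (norm u) * norm (f u) \<le> op_norm E f" by (simp add: hom u)
  then show ?thesis using False by (simp add: field_simps)
qed

lemma compact_op_approx:
  assumes E: "hilbert_module E" and T: "compact_op E T" and e: "0 < e"
  obtains n u v where "\<forall>i<(n::nat). u i \<in> hcarrier E \<and> v i \<in> hcarrier E"
    "\<And>w. w \<in> hcarrier E \<Longrightarrow> norm (T w - (\<Sum>i<n. hact E (u i) (hinner E (v i) w))) \<le> e * norm w"
proof -
  interpret inner_module "hcarrier E" "hinner E" 1 by (rule hilbert_module_inner_module[OF E])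
  note hm = hilbert_moduleD[OF E]
  obtain F where F: "finite_rank_op E F" "op_norm E (\<lambda>u. T u - F u) < e"
    using T e unfolding compact_op_def by blast
  obtain n u v where uv: "\<forall>i<(n::nat). u i \<in> hcarrier E \<and> v i \<in> hcarrier E"
    "\<And>w. w \<in> hcarrier E \<Longrightarrow> F w = (\<Sum>i<n. hact E (u i) (hinner E (v i) w))"
    using F(1) unfolding finite_rank_op_def by metis
  have bT: "bounded_on (hcarrier E) T" using T bounded_op_bounded_on by (auto simp: compact_op_def adjointable_def)
  obtain C where C: "\<And>w. w \<in> hcarrier E \<Longrightarrow> norm (T w) \<le> C * norm w" using bounded_onD(3)[OF bT] by auto
  have hactR: "hact E a (r *\<^sub>R b) = r *\<^sub>R hact E a b" if "a \<in> hcarrier E" for a r b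
    using hm(7)[OF that, of "complex_of_real r" b] by (simp add: scaleC_of_real)
  have hom: "T (r *\<^sub>R w) - F (r *\<^sub>R w) = r *\<^sub>R (T w - F w)" if w: "w \<in> hcarrier E" for r w
    using uv w by (simp add: clinear_onD(3)[OF bounded_onD(2)[OF bT]] ip_scaleR hactR scaleR_sum_right scaleR_diff_right)
  define C' where "C' = C + (\<Sum>i<n. norm (u i) * norm (v i))"
  have bd: "norm (T w - F w) \<le> C' * norm w" if w: "w \<in> hcarrier E" for w
  proof -
    have "norm (F w) \<le> (\<Sum>i<n. norm (u i) * norm (v i) * norm w)" unfolding uv(2)[OF w]
    proof (rule sum_norm_le)
      fix i assume "i \<in> {..<n}"
      then have H: "u i \<in> hcarrier E" "v i \<in> hcarrier E" using uv by auto
      have "norm (hact E (u i) (hinner E (v i) w)) \<le> norm (u i) * norm (hinner E (v i) w)" by (rule norm_hact_le[OF E H(1)])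
      also have "\<dots> \<le> norm (u i) * (norm (v i) * norm w)" by (intro mult_left_mono ip_le H w) simp
      finally show "norm (hact E (u i) (hinner E (v i) w)) \<le> norm (u i) * norm (v i) * norm w" by (simp add: mult.assoc)
    qed
    then show ?thesis using norm_triangle_ineq4[of "T w" "F w"] C[OF w]
      by (simp add: C'_def distrib_right sum_distrib_right)
  qed
  have "norm (T w - (\<Sum>i<n. hact E (u i) (hinner E (v i) w))) \<le> e * norm w" if w: "w \<in> hcarrier E" for w
  proof -
    have "norm (T w - F w) \<le> op_norm E (\<lambda>u. T u - F u) * norm w"
      by (rule op_norm_ge[OF csub hom bd w])
    also have "\<dots> \<le> e * norm w" using F(2) by (intro mult_right_mono) simp_all
    finally show ?thesis using uv(2)[OF w] by simp
  qed
  then show thesis using that uv(1) by blast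
qed

text \<open>
  The element \<open>b = x* (x x* + \<delta>)\<^sup>-\<^sup>1\<close>, obtained inside \<open>A\<close> as a fixed point since \<open>\<parallel>t - x x*\<parallel> \<le> t\<close> for \<open>t = \<parallel>x x*\<parallel>\<close>.
  It shows that \<open>x*\<close> is a limit of the elements \<open>b x x*\<close>, which end in \<open>x x*\<close>. The bound follows from
  \<open>(b x)(b x)* + \<delta> b b* = (b x)*\<close>, where both summands are positive.
\<close>

lemma regularized_left_inverse:
  fixes x :: "'a::cstar_algebra"
  assumes A: "cstar_subalgebra A" and x: "x \<in> A" and d: "0 < \<delta>"
  obtains b where "b \<in> A" "b * (x * star x) + \<delta> *\<^sub>R b = star x" "norm (\<delta> *\<^sub>R b) \<le> sqrt \<delta>"
proof -
  have A': "star_subalgebra A" "closed A" using A by (auto simp: cstar_subalgebra_def)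
  note AD = star_subalgebraD[OF A'(1)]
  let ?D = "x * star x"
  let ?t = "norm ?D"
  have "cpos (star (uembed (star x)) * uembed (star x))" by (rule cpos_star_mult_self)
  then have "cpos (uembed ?D)" by (simp add: uembed_mult uembed_star star_star)
  then have nt: "norm (?t *\<^sub>R 1 - uembed ?D) \<le> ?t" by (rule cpos_norm_minus_le) simp
  have le: "norm (?t *\<^sub>R y - y * ?D) \<le> ?t * norm y" for y
  proof -
    have "norm (?t *\<^sub>R y - y * ?D) = norm (uembed y * (?t *\<^sub>R 1 - uembed ?D))"
      unfolding norm_uembed[symmetric, of "?t *\<^sub>R y - y * ?D"] by (simp add: uembed_minus uembed_scaleR uembed_mult right_diff_distrib)
    also have "\<dots> \<le> norm y * ?t" using nt norm_mult_ineq[of "uembed y" "?t *\<^sub>R 1 - uembed ?D"]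
      by (simp add: mult_left_mono order_trans)
    finally show ?thesis by (simp add: mult.commute)
  qed
  define f where "f y = inverse (?t + \<delta>) *\<^sub>R (star x + (?t *\<^sub>R y - y * ?D))" for y
  have t0: "0 < ?t + \<delta>" using d by (simp add: add_nonneg_pos)
  have "\<exists>!y\<in>A. f y = y"
  proof (rule Banach_fix[where c = "?t / (?t + \<delta>)"])
    show "complete A" using A'(2) by (simp add: complete_eq_closed)
    show "A \<noteq> {}" using x by blast
    show "f ` A \<subseteq> A" using AD x by (auto simp: f_def)
    show "dist (f y) (f z) \<le> ?t / (?t + \<delta>) * dist y z" for y z
    proof -
      have "f y - f z = inverse (?t + \<delta>) *\<^sub>R (?t *\<^sub>R (y - z) - (y - z) * ?D)"
        unfolding f_def scaleR_diff_right[symmetric] by (simp add: algebra_simps)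
      then show ?thesis using le[of "y - z"] t0 by (simp add: dist_norm divide_inverse mult_left_mono mult.commute mult.left_commute mult.assoc)
    qed
  qed (use t0 d in auto)
  then obtain b where b: "b \<in> A" "f b = b" by blast
  have "(?t + \<delta>) *\<^sub>R f b = star x + (?t *\<^sub>R b - b * ?D)" using t0 by (simp add: f_def)
  then have eq: "b * ?D + \<delta> *\<^sub>R b = star x" unfolding b(2) by (simp add: scaleR_add_left algebra_simps)
  let ?c = "star (b * x)"
  have "star ?c * ?c + \<delta> *\<^sub>R (star (star b) * star b) = (b * ?D + \<delta> *\<^sub>R b) * star b"
    by (simp add: star_mult star_star distrib_right mult.assoc)
  also have "\<dots> = ?c" by (simp add: eq star_mult)
  finally have sum: "star ?c * ?c + \<delta> *\<^sub>R (star (star b) * star b) = ?c" .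
  have p: "pos (star ?c * ?c)" "pos (\<delta> *\<^sub>R (star (star b) * star b))"
    using d by (auto intro: pos_scaleR pos_star_mult_self)
  have 1: "(norm ?c)\<^sup>2 \<le> norm ?c" using pos_norm_mono[OF p] unfolding sum cstar_identity .
  have 2: "\<delta> * (norm b)\<^sup>2 \<le> norm ?c"
    using pos_norm_mono[OF p(2,1)] d unfolding add.commute[of "\<delta> *\<^sub>R (star (star b) * star b)"] sum norm_scaleR cstar_identity by simp
  have "norm ?c \<le> 1" using 1 by (cases "norm ?c = 0") (simp_all add: power2_eq_square)
  with 2 have "\<delta> * (\<delta> * (norm b)\<^sup>2) \<le> \<delta> * 1" using d by (intro mult_left_mono) simp_all
  then have "(norm (\<delta> *\<^sub>R b))\<^sup>2 \<le> (sqrt \<delta>)\<^sup>2" using d by (simp add: power2_eq_square mult_ac)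
  then have "norm (\<delta> *\<^sub>R b) \<le> sqrt \<delta>" by (rule power2_le_imp_le) (use d in simp)
  then show thesis using that b(1) eq by blast
qed

context half_closed
begin

text \<open>
  The operator \<open>(\<kappa> + D* D)\<^sup>-\<^sup>1\<close>.
\<close>

definition rho :: "real \<Rightarrow> 'e \<Rightarrow> 'e" where
  "rho \<kappa> z = (SOME u. \<exists>w v. (u, w) \<in> D \<and> (w, v) \<in> Dst \<and> \<kappa> *\<^sub>R u + v = z)"

lemma rhoE:
  assumes "1 \<le> \<kappa>" "z \<in> hcarrier E"
  obtains w v where "(rho \<kappa> z, w) \<in> D" "(w, v) \<in> Dst" "\<kappa> *\<^sub>R rho \<kappa> z + v = z"
proof -
  have "\<exists>u w v. (u, w) \<in> D \<and> (w, v) \<in> Dst \<and> \<kappa> *\<^sub>R u + v = z"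
    by (rule composite_surj_scaled[OF D_csub D_sub Dst_csub Dst_sub D_pair one_plus_DstD assms(2,1)])
  from someI_ex[OF this] show thesis using that unfolding rho_def by blast
qed

lemma DDst_bound:
  assumes "(u, w) \<in> D" "(w, v) \<in> Dst" "0 \<le> \<kappa>"
  shows "\<kappa> * norm u \<le> norm (\<kappa> *\<^sub>R u + v)"
  using composite_bounds(1)[OF D_mem[OF assms(1)] adjoint_relD(3)[OF assms(2)] D_pair[OF assms(1,2)] assms(3)] by simp

lemma rho_unique:
  assumes k: "1 \<le> \<kappa>" and u: "(u, w) \<in> D" "(w, v) \<in> Dst" and z: "\<kappa> *\<^sub>R u + v = z"
  shows "rho \<kappa> z = u"
proof -
  have zH: "z \<in> hcarrier E" using z[symmetric] D_mem[OF u(1)] adjoint_relD(3)[OF u(2)] by simp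
  obtain w' v' where r: "(rho \<kappa> z, w') \<in> D" "(w', v') \<in> Dst" "\<kappa> *\<^sub>R rho \<kappa> z + v' = z" by (rule rhoE[OF k zH])
  have "\<kappa> * norm (rho \<kappa> z - u) \<le> norm (\<kappa> *\<^sub>R (rho \<kappa> z - u) + (v' - v))"
    by (rule DDst_bound[OF csubspace_pairD(2)[OF D_csub r(1) u(1)] csubspace_pairD(2)[OF Dst_csub r(2) u(2)]]) (use k in simp)
  also have "\<kappa> *\<^sub>R (rho \<kappa> z - u) + (v' - v) = (\<kappa> *\<^sub>R rho \<kappa> z + v') - (\<kappa> *\<^sub>R u + v)" by (simp add: algebra_simps)
  finally have "\<kappa> * norm (rho \<kappa> z - u) \<le> 0" by (simp add: r(3) z)
  then show ?thesis using k by (simp add: mult_le_0_iff)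
qed

lemma
  assumes k: "1 \<le> \<kappa>" and z: "z \<in> hcarrier E"
  shows rho_mem: "rho \<kappa> z \<in> hcarrier E" and rho_le: "\<kappa> * norm (rho \<kappa> z) \<le> norm z"
proof -
  obtain w v where r: "(rho \<kappa> z, w) \<in> D" "(w, v) \<in> Dst" "\<kappa> *\<^sub>R rho \<kappa> z + v = z" by (rule rhoE[OF k z])
  show "rho \<kappa> z \<in> hcarrier E" by (rule D_mem(1)[OF r(1)])
  show "\<kappa> * norm (rho \<kappa> z) \<le> norm z" using DDst_bound[OF r(1,2), of \<kappa>] k by (simp add: r(3))
qed

lemma rho_selfadj:
  assumes k: "1 \<le> \<kappa>" and z: "z \<in> hcarrier E" "z' \<in> hcarrier E"
  shows "hinner E (rho \<kappa> z) z' = hinner E z (rho \<kappa> z')"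
proof -
  obtain w v where r: "(rho \<kappa> z, w) \<in> D" "(w, v) \<in> Dst" "\<kappa> *\<^sub>R rho \<kappa> z + v = z" by (rule rhoE[OF k z(1)])
  obtain w' v' where r': "(rho \<kappa> z', w') \<in> D" "(w', v') \<in> Dst" "\<kappa> *\<^sub>R rho \<kappa> z' + v' = z'" by (rule rhoE[OF k z(2)])
  note H = D_mem[OF r(1)] adjoint_relD(3)[OF r(2)] D_mem[OF r'(1)] adjoint_relD(3)[OF r'(2)]
  have "hinner E (rho \<kappa> z) (\<kappa> *\<^sub>R rho \<kappa> z' + v') = \<kappa> *\<^sub>R hinner E (rho \<kappa> z) (rho \<kappa> z') + hinner E w w'"
    using H D_pair[OF r(1) r'(2)] by (simp add: ip_add ip_scaleR)
  moreover have "hinner E (\<kappa> *\<^sub>R rho \<kappa> z + v) (rho \<kappa> z') = \<kappa> *\<^sub>R hinner E (rho \<kappa> z) (rho \<kappa> z') + hinner E w w'"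
  proof -
    have "hinner E v (rho \<kappa> z') = star (hinner E (rho \<kappa> z') v)" by (rule ip_star[OF H(4) H(3), symmetric])
    also have "\<dots> = star (hinner E w' w)" by (simp add: adjoint_relD(1)[OF r(2) r'(1)])
    also have "\<dots> = hinner E w w'" by (rule ip_star[OF H(5,2)])
    finally show ?thesis using H by (simp add: ip_add_left ip_scaleR_left)
  qed
  ultimately show ?thesis by (simp add: r(3) r'(3))
qed

text \<open>
  The resolvent identity, in the form that transfers compactness from \<open>\<kappa> = 1\<close> to all \<open>\<kappa>\<close>.
\<close>

lemma rho_rho_one:
  assumes k: "1 \<le> \<kappa>" and z: "z \<in> hcarrier E"
  shows "rho 1 (z - (\<kappa> - 1) *\<^sub>R rho \<kappa> z) = rho \<kappa> z"
proof -
  obtain w v where r: "(rho \<kappa> z, w) \<in> D" "(w, v) \<in> Dst" "\<kappa> *\<^sub>R rho \<kappa> z + v = z" by (rule rhoE[OF k z])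
  have "1 *\<^sub>R rho \<kappa> z + v = z - (\<kappa> - 1) *\<^sub>R rho \<kappa> z"
    using r(3) by (simp add: scaleR_diff_left algebra_simps)
  from rho_unique[OF _ r(1,2) this] show ?thesis by simp
qed

text \<open>
  With \<open>e = y - \<kappa> \<rho> y = D* D \<rho> y\<close> and \<open>w = D \<rho> y\<close> one finds \<open>\<langle>e, e\<rangle> + \<kappa> \<langle>w, w\<rangle> = \<langle>D y, w\<rangle>\<close>, which bounds first \<open>w\<close> and
  then \<open>e\<close>.
\<close>

lemma rho_approx_identity:
  assumes k: "1 \<le> \<kappa>" and y: "(y, y') \<in> D"
  shows "sqrt \<kappa> * norm (y - \<kappa> *\<^sub>R rho \<kappa> y) \<le> norm y'"
proof -
  note yH = D_mem[OF y]
  obtain w e where r: "(rho \<kappa> y, w) \<in> D" "(w, e) \<in> Dst" "\<kappa> *\<^sub>R rho \<kappa> y + e = y" by (rule rhoE[OF k yH(1)])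
  note H = D_mem[OF r(1)] adjoint_relD(3)[OF r(2)]
  have e: "e = y - \<kappa> *\<^sub>R rho \<kappa> y" using r(3) by (simp add: algebra_simps)
  have eD: "(e, y' - \<kappa> *\<^sub>R w) \<in> D"
    unfolding e by (rule csubspace_pairD(2)[OF D_csub y csubspace_pairD(4)[OF D_csub r(1)]])
  have "hinner E (y' - \<kappa> *\<^sub>R w) w = hinner E e e" by (rule adjoint_relD(1)[OF r(2) eD])
  then have sum: "hinner E e e + \<kappa> *\<^sub>R hinner E w w = hinner E y' w"
    using H yH by (simp add: ip_diff_left ip_scaleR_left algebra_simps)
  have p: "pos (hinner E e e)" "pos (\<kappa> *\<^sub>R hinner E w w)" using H k by (auto intro: ip_pos pos_scaleR)
  have sq: "(norm u)\<^sup>2 = norm (hinner E u u)" if "u \<in> hcarrier E" for u using hm(13)[OF that] by simp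
  have ny: "norm (hinner E y' w) \<le> norm y' * norm w" by (rule ip_le[OF yH(2) H(2)])
  have "\<kappa> * (norm w)\<^sup>2 \<le> norm y' * norm w"
    using pos_norm_mono[OF p(2,1)] ny k sum by (simp add: sq[OF H(2)] add.commute)
  then have "norm w * (\<kappa> * norm w) \<le> norm w * norm y'" by (simp add: power2_eq_square mult_ac)
  then have w: "\<kappa> * norm w \<le> norm y'" by (cases "norm w = 0") (auto simp: mult_le_cancel_left)
  have "(norm e)\<^sup>2 \<le> norm y' * norm w"
    using pos_norm_mono[OF p] ny sum by (simp add: sq[OF H(3)])
  then have "\<kappa> * (norm e)\<^sup>2 \<le> \<kappa> * (norm y' * norm w)" using k by (intro mult_left_mono) simp_all
  also have "\<dots> = norm y' * (\<kappa> * norm w)" by (rule mult.left_commute)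
  also have "\<dots> \<le> norm y' * norm y'" using w by (intro mult_left_mono) simp_all
  finally have "(sqrt \<kappa> * norm e)\<^sup>2 \<le> (norm y')\<^sup>2" using k by (simp add: power_mult_distrib power2_eq_square[of "norm y'"])
  then show ?thesis unfolding e by (rule power2_le_imp_le) simp
qed

lemma compact_phi_rho:
  assumes b: "b \<in> A"
  shows "\<exists>T. compact_op E T \<and> (\<forall>z\<in>hcarrier E. T z = \<phi> b (rho 1 z))"
proof -
  obtain T where T: "compact_op E T" "(shift 1 (D O Dst))\<inverse> O op_graph E (\<phi> b) = op_graph E T"
    using chainD(7)[OF b] unfolding compact_graph_def Dst_eq by blast
  have "T z = \<phi> b (rho 1 z)" if z: "z \<in> hcarrier E" for z
  proof -
    obtain w v where r: "(rho 1 z, w) \<in> D" "(w, v) \<in> Dst" "1 *\<^sub>R rho 1 z + v = z" using rhoE[OF _ z, of 1] by auto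
    then have "(rho 1 z, z) \<in> shift 1 (D O Dst)" unfolding shift_def by force
    then have "(z, \<phi> b (rho 1 z)) \<in> op_graph E T"
      unfolding T(2)[symmetric] using D_mem(1)[OF r(1)] by (auto simp: op_graph_def)
    then show ?thesis by (auto simp: op_graph_def)
  qed
  then show ?thesis using T(1) by blast
qed

end

context localization
begin

lemma Dx_bound:
  assumes uv: "(u, v) \<in> Dx" and s: "\<sigma> = 1 \<or> \<sigma> = -1"
  shows "norm u \<le> norm (v + (\<i> * of_real \<sigma>) *\<^sub>C u)"
proof -
  note H = Dx_mem[OF uv]
  have "hinner E v u = hinner E u v" using adjoint_relD(1)[OF subsetD[OF Dx_symmetric uv] uv] .
  then have 1: "star (hinner E u v) = hinner E u v" using H by (simp add: X.ip_star)
  have 2: "pos (hinner E u u - 1 *\<^sub>R hinner E u u)" using pos_scaleR[OF X.ip_pos[OF H(1)], of 0] by simp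
  show ?thesis using X.bounded_below[OF H(1) H(2) H(1) 1 2 _ s] by simp
qed

text \<open>
  The operator \<open>(D\<^sub>x + i\<sigma>)\<^sup>-\<^sup>1\<close>, for \<open>\<sigma> = \<plusminus> 1\<close>.
\<close>

definition Rx :: "real \<Rightarrow> 'e \<Rightarrow> 'e" where
  "Rx \<sigma> z = (SOME u. (u, z - (\<i> * of_real \<sigma>) *\<^sub>C u) \<in> Dx)"

lemma Rx_Dx:
  assumes s: "\<sigma> = 1 \<or> \<sigma> = -1" and z: "z \<in> Hx"
  shows "(Rx \<sigma> z, z - (\<i> * of_real \<sigma>) *\<^sub>C Rx \<sigma> z) \<in> Dx"
proof -
  obtain u v where uv: "(u, v) \<in> Dx" "v + (\<i> * of_real \<sigma>) *\<^sub>C u = z" using Dx_surj[OF s z] by blast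
  have "z - (\<i> * of_real \<sigma>) *\<^sub>C u = v" unfolding uv(2)[symmetric] by (rule add_diff_cancel_right')
  with uv(1) have "(u, z - (\<i> * of_real \<sigma>) *\<^sub>C u) \<in> Dx" by (simp only:)
  then show ?thesis unfolding Rx_def by (rule someI)
qed

lemma Rx_unique:
  assumes s: "\<sigma> = 1 \<or> \<sigma> = -1" and uv: "(u, v) \<in> Dx" and z: "v + (\<i> * of_real \<sigma>) *\<^sub>C u = z"
  shows "Rx \<sigma> z = u"
proof -
  have zH: "z \<in> Hx" unfolding z[symmetric] by (intro X.mem Dx_mem[OF uv])
  let ?i = "\<i> * complex_of_real \<sigma>"
  have "norm (Rx \<sigma> z - u) \<le> norm ((z - ?i *\<^sub>C Rx \<sigma> z - v) + ?i *\<^sub>C (Rx \<sigma> z - u))"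
    by (rule Dx_bound[OF csubspace_pairD(2)[OF Dx_csub Rx_Dx[OF s zH] uv] s])
  also have "(z - ?i *\<^sub>C Rx \<sigma> z - v) + ?i *\<^sub>C (Rx \<sigma> z - u) = 0"
    using z by (simp add: scaleC_diff_right algebra_simps)
  finally show ?thesis by simp
qed

lemma Rx_mem: "\<sigma> = 1 \<or> \<sigma> = -1 \<Longrightarrow> z \<in> Hx \<Longrightarrow> Rx \<sigma> z \<in> Hx"
  by (rule Dx_mem(1)[OF Rx_Dx])

lemma Rx_le: "\<sigma> = 1 \<or> \<sigma> = -1 \<Longrightarrow> z \<in> Hx \<Longrightarrow> norm (Rx \<sigma> z) \<le> norm z"
  using Dx_bound[OF Rx_Dx, of \<sigma> z \<sigma>] by simp

lemma Rx_adj: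
  assumes z: "z \<in> Hx" "w \<in> Hx"
  shows "hinner E (Rx 1 z) w = hinner E z (Rx (-1) w)"
proof -
  define u where "u = Rx 1 z"
  define a where "a = Rx (-1) w"
  have u: "(u, z - \<i> *\<^sub>C u) \<in> Dx" using Rx_Dx[of 1 z] z by (simp add: u_def)
  have a: "(a, w + \<i> *\<^sub>C a) \<in> Dx" using Rx_Dx[of "-1" w] z by (simp add: a_def scaleC_minus_left)
  note H = Dx_mem(1)[OF u] Dx_mem(1)[OF a]
  have "hinner E (z - \<i> *\<^sub>C u) a = hinner E u (w + \<i> *\<^sub>C a)"
    using adjoint_relD(1)[OF subsetD[OF Dx_symmetric a] u] .
  then show ?thesis unfolding u_def[symmetric] a_def[symmetric] using H z
    by (simp add: X.ip_diff_left X.ip_scaleC_left X.ip_add X.ip_scaleC scaleC_minus_left)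
qed

lemma Rx_bounded_op: "bounded_op Eloc (Rx 1)"
  unfolding bounded_op_def Eloc_simps
proof (intro conjI ballI allI funcsetI exI[of _ 1])
  fix u assume u: "u \<in> Hx"
  note R = Rx_Dx[of 1, simplified]
  show "Rx 1 u \<in> Hx" "norm (Rx 1 u) \<le> 1 * norm u" using Rx_mem[of 1] Rx_le[of 1] u by auto
  show "Rx 1 (c *\<^sub>C u) = c *\<^sub>C Rx 1 u" for c
    by (rule Rx_unique[OF _ csubspace_pairD(3)[OF Dx_csub R[OF u]]])
       (simp_all add: scaleC_diff_right scaleC_scaleC mult.commute)
  show "Rx 1 (u + v) = Rx 1 u + Rx 1 v" if v: "v \<in> Hx" for v
    by (rule Rx_unique[OF _ csubspace_pairD(1)[OF Dx_csub R[OF u] R[OF v]]])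
       (simp_all add: scaleC_add_right)
  show "Rx 1 (hact E u b) = hact E (Rx 1 u) b" for b
  proof (rule Rx_unique)
    have "\<forall>(u, v)\<in>Dx. (\<forall>c. (c *\<^sub>C u, c *\<^sub>C v) \<in> Dx) \<and> (\<forall>b. (hact E u b, hact E v b) \<in> Dx)"
      using Dx_unbounded unfolding unbounded_op_def Eloc_simps by (elim conjE)
    then show "(hact E (Rx 1 u) b, hact E (u - \<i> *\<^sub>C Rx 1 u) b) \<in> Dx" using R[OF u] by auto
    have H: "u - \<i> *\<^sub>C Rx 1 u \<in> hcarrier E" "\<i> *\<^sub>C Rx 1 u \<in> hcarrier E" "Rx 1 u \<in> hcarrier E"
      using HxH[OF Dx_mem(2)[OF R[OF u]]] HxH[OF X.mem(3)[OF Dx_mem(1)[OF R[OF u]]]] HxH[OF Dx_mem(1)[OF R[OF u]]] .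
    show "hact E (u - \<i> *\<^sub>C Rx 1 u) b + (\<i> * of_real 1) *\<^sub>C hact E (Rx 1 u) b = hact E u b"
      using hm(3)[OF H(1,2), of b] hm(6)[OF H(3), of \<i> b] by simp
  qed simp
qed

lemma \<Delta>_eq: "u \<in> hcarrier E \<Longrightarrow> \<phi> (x * star x) u = \<phi> x (\<phi> (star x) u)"
  by (rule cD(5)[OF x_mem(1,2)])

text \<open>
  On the core, \<open>D \<Delta> u = D x (x* u) = x D x* u + d(x) x* u\<close>; pass to the limit since \<open>D\<close> is closed.
\<close>

lemma \<Delta>_Dx:
  assumes uv: "(u, v) \<in> Dx"
  shows "(\<phi> (x * star x) u, v + comm_ext x (\<phi> (star x) u)) \<in> D"
proof -
  obtain s where s: "\<And>n. s n \<in> core_graph" "s \<longlonglongrightarrow> (u, v)" using uv unfolding Dx_eq closure_sequential by blast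
  note uvH = HxH[OF Dx_mem(1)[OF uv]] HxH[OF Dx_mem(2)[OF uv]]
  have "fst (s n) \<in> Hx" "snd (s n) \<in> Hx" for n using s(1)[of n] core_graph_sub by auto
  then have sH: "fst (s n) \<in> hcarrier E" "snd (s n) \<in> hcarrier E" for n by (simp_all only: HxH)
  have lim: "(\<lambda>n. fst (s n)) \<longlonglongrightarrow> u" "(\<lambda>n. snd (s n)) \<longlonglongrightarrow> v"
    using tendsto_fst[OF s(2)] tendsto_snd[OF s(2)] by simp_all
  have "(\<phi> (x * star x) (fst (s n)), snd (s n) + comm_ext x (\<phi> (star x) (fst (s n)))) \<in> D" for n
  proof -
    have "(fst (s n), snd (s n)) \<in> core_graph" using s(1)[of n] by simp
    then obtain t where t: "fst (s n) \<in> Domain D" "fst (s n) \<in> Hx" "(\<phi> (star x) (fst (s n)), t) \<in> D" "snd (s n) = \<phi> x t"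
      by (rule core_graphE)
    show ?thesis using comm_ext_D[OF x\<A> t(3)] by (simp add: t(4) \<Delta>_eq sH)
  qed
  moreover have "(\<lambda>n. (\<phi> (x * star x) (fst (s n)), snd (s n) + comm_ext x (\<phi> (star x) (fst (s n)))))
      \<longlonglongrightarrow> (\<phi> (x * star x) u, v + comm_ext x (\<phi> (star x) u))"
    by (intro tendsto_Pair tendsto_add lim \<phi>_tendsto bounded_on_tendsto[OF comm_ext_bounded[OF x\<A>] csub] sH uvH cD(8) x_mem AD)
  ultimately show ?thesis by (rule closed_sequentially[OF D_closed])
qed

text \<open>
  Write \<open>R\<close> for the resolvent of \<open>D\<^sub>x\<close>. In \<open>a R\<close>, replace \<open>a\<close> by some \<open>x c x*\<close>, then \<open>x*\<close> by \<open>b \<Delta>\<close>, then \<open>\<Delta> R\<close> by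
  \<open>\<kappa> (\<kappa> + D* D)\<^sup>-\<^sup>1 \<Delta> R\<close>, and finally the compact \<open>b (1 + D* D)\<^sup>-\<^sup>1\<close> by an operator of finite rank. The factor
  \<open>x c\<close> on the left moves the range of the latter into \<open>E\<^sub>x\<close>, and \<open>R* \<Delta>\<close> does the same for the vectors on the right.
\<close>

lemma \<phi>_Rx_approx:
  assumes a: "a \<in> Ax" and e: "0 < e"
  shows "\<exists>F. finite_rank_op Eloc F \<and> (\<forall>z\<in>Hx. norm (\<phi> a (Rx 1 z) - F z) \<le> e * norm z)"
proof -
  let ?\<Delta> = "x * star x"
  have \<Delta>A: "?\<Delta> \<in> A" and aA: "a \<in> A" using x_mem AD a Ax_mem by auto
  define \<eta> where "\<eta> = e / 4"
  have \<eta>: "0 < \<eta>" using e by (simp add: \<eta>_def)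
  obtain c where c: "c \<in> A" "norm (a - x * c * star x) < \<eta>" using Ax_approx[OF a \<eta>] by blast
  define h where "h = x * c"
  have hA: "h \<in> A" using c x_mem AD by (simp add: h_def)
  define M where "M = norm h + 1"
  have M: "norm h \<le> M" "0 < M" by (simp_all add: M_def add_nonneg_pos)
  \<comment> \<open>The parameters are fixed from left to right, each making one replacement cost at most \<open>\<eta> \<parallel>z\<parallel>\<close>.\<close>
  define \<delta> where "\<delta> = (\<eta> / M)\<^sup>2"
  have \<delta>: "0 < \<delta>" "sqrt \<delta> = \<eta> / M" using \<eta> M by (simp_all add: \<delta>_def)
  obtain b where b: "b \<in> A" "b * ?\<Delta> + \<delta> *\<^sub>R b = star x" "norm (\<delta> *\<^sub>R b) \<le> \<eta> / M"
    using regularized_left_inverse[OF chainD(1) x_mem(1) \<delta>(1)] unfolding \<delta>(2) by blast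
  obtain C where C: "0 \<le> C" "\<And>u. u \<in> hcarrier E \<Longrightarrow> norm (comm_ext x u) \<le> C * norm u"
    using bounded_onD(3)[OF comm_ext_bounded[OF x\<A>]] by auto
  define y where "y z = \<phi> ?\<Delta> (Rx 1 z)" for z
  define y' where "y' z = (z - \<i> *\<^sub>C Rx 1 z) + comm_ext x (\<phi> (star x) (Rx 1 z))" for z
  define C1 where "C1 = 2 + C * norm x"
  have R: "Rx 1 z \<in> Hx" "Rx 1 z \<in> hcarrier E" "norm (Rx 1 z) \<le> norm z" if "z \<in> Hx" for z
    using Rx_mem[of 1, OF _ that] HxH[OF Rx_mem[of 1, OF _ that]] Rx_le[of 1, OF _ that] by simp_all
  have yD: "(y z, y' z) \<in> D" if "z \<in> Hx" for z
    using \<Delta>_Dx[OF Rx_Dx[of 1, OF _ that]] by (simp add: y_def y'_def)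
  have y'le: "norm (y' z) \<le> C1 * norm z" if z: "z \<in> Hx" for z
  proof -
    have "norm (comm_ext x (\<phi> (star x) (Rx 1 z))) \<le> C * norm (\<phi> (star x) (Rx 1 z))"
      using C(2) cD(8) x_mem R z by simp
    also have "\<dots> \<le> C * (norm x * norm z)"
      using \<phi>_le[OF x_mem(2) R(2)[OF z]] mult_left_mono[OF R(3)[OF z] norm_ge_zero[of x]] C(1)
      by (intro mult_left_mono) (simp_all add: order_trans)
    finally have "norm (comm_ext x (\<phi> (star x) (Rx 1 z))) \<le> C * norm x * norm z" by (simp add: mult.assoc)
    moreover have "norm (z - \<i> *\<^sub>C Rx 1 z) \<le> norm z + norm z"
      using R(3)[OF z] norm_triangle_ineq4[of z "\<i> *\<^sub>C Rx 1 z"] by (simp add: norm_scaleC)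
    ultimately show ?thesis unfolding y'_def C1_def
      using norm_triangle_ineq[of "z - \<i> *\<^sub>C Rx 1 z" "comm_ext x (\<phi> (star x) (Rx 1 z))"] by (simp add: distrib_right)
  qed
  have C1: "0 \<le> C1" using C by (simp add: C1_def)
  define B where "B = M * norm b * C1 / \<eta>"
  define \<kappa> where "\<kappa> = 1 + B\<^sup>2"
  have B: "0 \<le> B" using M \<eta> C1 by (simp add: B_def)
  have \<kappa>: "1 \<le> \<kappa>" by (simp add: \<kappa>_def)
  have B\<kappa>: "B \<le> sqrt \<kappa>" using B by (simp add: \<kappa>_def real_le_rsqrt)
  obtain T where T: "compact_op E T" "\<And>z. z \<in> hcarrier E \<Longrightarrow> T z = \<phi> b (rho 1 z)" using compact_phi_rho[OF b(1)] by blast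
  define q where "q z = y z - (\<kappa> - 1) *\<^sub>R rho \<kappa> (y z)" for z
  define L where "L = M * \<kappa> * (2 * norm ?\<Delta>) + 1"
  have L: "0 < L" using M \<kappa> by (simp add: L_def add_nonneg_pos)
  obtain n u v where uv: "\<forall>i<(n::nat). u i \<in> hcarrier E \<and> v i \<in> hcarrier E"
    "\<And>w. w \<in> hcarrier E \<Longrightarrow> norm (T w - (\<Sum>i<n. hact E (u i) (hinner E (v i) w))) \<le> \<eta> / L * norm w"
    using compact_op_approx[OF cD(1) T(1), of "\<eta> / L"] \<eta> L by auto
  define Qs where "Qs w = \<kappa> *\<^sub>R Rx (-1) (\<phi> ?\<Delta> (w - (\<kappa> - 1) *\<^sub>R rho \<kappa> w))" for w
  define F where "F z = (\<Sum>i<n. hact E (\<phi> h (u i)) (hinner E (Qs (v i)) z))" for z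
  have Qs_mem: "Qs w \<in> Hx" if "w \<in> hcarrier E" for w
    using \<phi>_Ax_Hx[OF \<Delta>_Ax] that rho_mem[OF \<kappa>] by (simp add: Qs_def Rx_mem)
  have "finite_rank_op Eloc F" unfolding finite_rank_op_def Eloc_simps
    using uv(1) \<phi>_mult_Hx[OF c(1)] Qs_mem
    by (intro exI[of _ n] exI[of _ "\<lambda>i. \<phi> h (u i)"] exI[of _ "\<lambda>i. Qs (v i)"]) (simp add: F_def h_def)
  moreover have "norm (\<phi> a (Rx 1 z) - F z) \<le> e * norm z" if z: "z \<in> Hx" for z
  proof -
    note Rz = R[OF z]
    have yH: "y z \<in> hcarrier E" "y' z \<in> hcarrier E" using D_mem[OF yD[OF z]] by auto
    have rH: "rho \<kappa> (y z) \<in> hcarrier E" by (rule rho_mem[OF \<kappa> yH(1)])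
    have qH: "q z \<in> hcarrier E" using yH rH by (simp add: q_def)
    have xsA: "star x \<in> A" "b * ?\<Delta> \<in> A" "x * c * star x \<in> A" using x_mem b \<Delta>A c AD by auto
    let ?S = "\<Sum>i<n. hact E (u i) (hinner E (v i) (q z))"
    have SH: "(\<Sum>i<m. hact E (u i) (s i)) \<in> hcarrier E \<and> \<phi> h (\<Sum>i<m. hact E (u i) (s i)) = (\<Sum>i<m. hact E (\<phi> h (u i)) (s i))"
      if "m \<le> n" for m s
      using that
    proof (induction m)
      case 0
      show ?case using clinear_onD(5)[OF cD(10)[OF hA] csub] by simp
    next
      case (Suc m)
      then have um: "u m \<in> hcarrier E" using uv by simp
      have hu: "hact E (u m) (s m) \<in> hcarrier E" by (rule submoduleD(5)[OF hm(1) um])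
      show ?case using Suc hu clinear_onD(1)[OF cD(10)[OF hA], of "\<Sum>i<m. hact E (u i) (s i)" "hact E (u m) (s m)"]
          bounded_opD(2)[OF cD(3)[OF hA] um] by simp
    qed
    have "hinner E (Qs w) z = \<kappa> *\<^sub>R hinner E w (q z)" if w: "w \<in> hcarrier E" for w
    proof -
      let ?w = "w - (\<kappa> - 1) *\<^sub>R rho \<kappa> w"
      have wH: "rho \<kappa> w \<in> hcarrier E" "?w \<in> hcarrier E" using w rho_mem[OF \<kappa>] by auto
      have \<Delta>w: "\<phi> ?\<Delta> ?w \<in> Hx" by (rule \<phi>_Ax_Hx[OF \<Delta>_Ax wH(2)])
      have "hinner E (Qs w) z = \<kappa> *\<^sub>R hinner E (Rx (-1) (\<phi> ?\<Delta> ?w)) z"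
        using X.ip_scaleR_left[OF z Rx_mem[of "-1", OF _ \<Delta>w]] by (simp add: Qs_def)
      also have "hinner E (Rx (-1) (\<phi> ?\<Delta> ?w)) z = hinner E (\<phi> ?\<Delta> ?w) (Rx 1 z)"
        using arg_cong[OF Rx_adj[OF z \<Delta>w], of star] z Rz(1) \<Delta>w Rx_mem[of "-1" "\<phi> ?\<Delta> ?w"] by (simp add: X.ip_star)
      also have "\<dots> = hinner E ?w (y z)"
        using cD(7)[OF \<Delta>A wH(2) Rz(2)] by (simp add: y_def star_mult star_star)
      also have "\<dots> = hinner E w (q z)"
        using w wH(1) yH(1) rH rho_selfadj[OF \<kappa> w yH(1)] by (simp add: q_def ip_diff ip_diff_left ip_scaleR ip_scaleR_left)
      finally show ?thesis .
    qed
    then have "F z = (\<Sum>i<n. hact E (\<phi> h (u i)) (\<kappa> *\<^sub>R hinner E (v i) (q z)))"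
      unfolding F_def using uv(1) by (intro sum.cong) auto
    also have "\<dots> = (\<Sum>i<n. \<kappa> *\<^sub>R hact E (\<phi> h (u i)) (hinner E (v i) (q z)))"
    proof (rule sum.cong)
      fix i assume "i \<in> {..<n}"
      then have "\<phi> h (u i) \<in> hcarrier E" using uv(1) cD(8)[OF hA] by auto
      from hm(7)[OF this, of "complex_of_real \<kappa>"]
      show "hact E (\<phi> h (u i)) (\<kappa> *\<^sub>R hinner E (v i) (q z)) = \<kappa> *\<^sub>R hact E (\<phi> h (u i)) (hinner E (v i) (q z))"
        by (simp add: scaleC_of_real)
    qed simp
    also have "\<dots> = \<kappa> *\<^sub>R \<phi> h ?S" using SH[of n] by (simp add: scaleR_sum_right)
    finally have Fz: "F z = \<kappa> *\<^sub>R \<phi> h ?S" .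
    have SE: "?S \<in> hcarrier E" using SH[of n] by simp
    have Tq: "T (q z) = \<phi> b (rho \<kappa> (y z))" using T(2)[OF qH] rho_rho_one[OF \<kappa> yH(1)] by (simp add: q_def)
    have TqH: "T (q z) \<in> hcarrier E" unfolding Tq by (rule cD(8)[OF b(1) rH])
    have lh: "norm (\<phi> h w) \<le> M * norm w" if "w \<in> hcarrier E" for w
      using \<phi>_le[OF hA that] mult_right_mono[OF M(1) norm_ge_zero[of w]] by linarith
    note linh = clinear_onD[OF cD(10)[OF hA]]
    note linb = clinear_onD[OF cD(10)[OF b(1)]]
    have e1: "norm (\<phi> a (Rx 1 z) - \<phi> h (\<phi> (star x) (Rx 1 z))) \<le> \<eta> * norm z"
    proof -
      have "\<phi> a (Rx 1 z) - \<phi> h (\<phi> (star x) (Rx 1 z)) = \<phi> (a - x * c * star x) (Rx 1 z)"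
        using \<phi>_diff[OF aA xsA(3) Rz(2)] cD(5)[OF hA xsA(1) Rz(2)] by (simp add: h_def)
      also have "norm \<dots> \<le> norm (a - x * c * star x) * norm (Rx 1 z)"
        by (rule \<phi>_le[OF _ Rz(2)]) (use aA xsA AD in simp)
      also have "\<dots> \<le> \<eta> * norm z" using c(2) Rz(3) \<eta> by (intro mult_mono) simp_all
      finally show ?thesis .
    qed
    have e2: "norm (\<phi> h (\<phi> (star x) (Rx 1 z)) - \<phi> h (\<phi> b (y z))) \<le> \<eta> * norm z"
    proof -
      have "\<delta> *\<^sub>R b = star x - b * ?\<Delta>" using b(2) by (simp add: algebra_simps)
      then have "\<phi> (star x) (Rx 1 z) - \<phi> b (y z) = \<phi> (\<delta> *\<^sub>R b) (Rx 1 z)"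
        using \<phi>_diff[OF xsA(1,2) Rz(2)] cD(5)[OF b(1) \<Delta>A Rz(2)] by (simp add: y_def)
      then have "norm (\<phi> (star x) (Rx 1 z) - \<phi> b (y z)) \<le> norm (\<delta> *\<^sub>R b) * norm (Rx 1 z)"
        using \<phi>_le[OF _ Rz(2), of "\<delta> *\<^sub>R b"] b(1) AD by simp
      also have "\<dots> \<le> \<eta> / M * norm z" using b(3) Rz(3) \<eta> M by (intro mult_mono) simp_all
      finally have *: "norm (\<phi> (star x) (Rx 1 z) - \<phi> b (y z)) \<le> \<eta> / M * norm z" .
      have mem: "\<phi> (star x) (Rx 1 z) \<in> hcarrier E" "\<phi> b (y z) \<in> hcarrier E" using cD(8) x_mem b Rz yH by auto
      have "norm (\<phi> h (\<phi> (star x) (Rx 1 z) - \<phi> b (y z))) \<le> M * (\<eta> / M * norm z)"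
        by (rule order_trans[OF lh mult_left_mono[OF *]]) (use mem M in simp_all)
      then show ?thesis using linh(6)[OF csub mem] M by simp
    qed
    have e3: "norm (\<phi> h (\<phi> b (y z)) - \<phi> h (\<kappa> *\<^sub>R T (q z))) \<le> \<eta> * norm z"
    proof -
      let ?d = "y z - \<kappa> *\<^sub>R rho \<kappa> (y z)"
      have dH: "?d \<in> hcarrier E" using yH rH by simp
      have "\<phi> b (y z) - \<kappa> *\<^sub>R T (q z) = \<phi> b ?d" using linb yH rH csub by (simp add: Tq)
      moreover have mem: "\<phi> b (y z) \<in> hcarrier E" "\<kappa> *\<^sub>R T (q z) \<in> hcarrier E" using cD(8) b yH TqH by auto
      ultimately have "norm (\<phi> h (\<phi> b (y z)) - \<phi> h (\<kappa> *\<^sub>R T (q z))) = norm (\<phi> h (\<phi> b ?d))"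
        using linh(6)[OF csub mem] by simp
      also have "\<dots> \<le> M * (norm b * norm ?d)"
        by (rule order_trans[OF lh mult_left_mono[OF \<phi>_le]]) (use dH b cD(8) M in simp_all)
      finally have 1: "norm (\<phi> h (\<phi> b (y z)) - \<phi> h (\<kappa> *\<^sub>R T (q z))) \<le> M * (norm b * norm ?d)" .
      show ?thesis
      proof (cases "norm b = 0")
        case True
        then show ?thesis using 1 \<eta> by (simp add: order_trans[of _ 0])
      next
        case False
        have "B * norm ?d \<le> sqrt \<kappa> * norm ?d" using B\<kappa> by (intro mult_right_mono) simp_all
        also have "\<dots> \<le> C1 * norm z" using rho_approx_identity[OF \<kappa> yD[OF z]] y'le[OF z] by linarith
        finally have "B * norm ?d * \<eta> \<le> C1 * norm z * \<eta>" using \<eta> by (intro mult_right_mono) simp_all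
        then have "C1 * (M * (norm b * norm ?d)) \<le> C1 * (\<eta> * norm z)" using \<eta> by (simp add: B_def mult_ac)
        moreover have "0 < C1" using C by (simp add: C1_def add_pos_nonneg)
        ultimately have "M * (norm b * norm ?d) \<le> \<eta> * norm z" by simp
        with 1 show ?thesis by linarith
      qed
    qed
    have e4: "norm (\<phi> h (\<kappa> *\<^sub>R T (q z)) - F z) \<le> \<eta> * norm z"
    proof -
      have yle: "norm (y z) \<le> norm ?\<Delta> * norm z"
        unfolding y_def using \<phi>_le[OF \<Delta>A Rz(2)] mult_left_mono[OF Rz(3) norm_ge_zero[of ?\<Delta>]] by linarith
      have "(\<kappa> - 1) * norm (rho \<kappa> (y z)) \<le> \<kappa> * norm (rho \<kappa> (y z))" by (intro mult_right_mono) simp_all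
      also have "\<dots> \<le> norm (y z)" by (rule rho_le[OF \<kappa> yH(1)])
      finally have "norm (q z) \<le> 2 * norm (y z)"
        unfolding q_def using norm_triangle_ineq4[of "y z" "(\<kappa> - 1) *\<^sub>R rho \<kappa> (y z)"] \<kappa> by simp
      then have qle: "norm (q z) \<le> 2 * norm ?\<Delta> * norm z" using yle by simp
      have "\<phi> h (\<kappa> *\<^sub>R T (q z)) - F z = \<kappa> *\<^sub>R \<phi> h (T (q z) - ?S)"
        unfolding Fz using linh(3)[OF TqH, of \<kappa>] linh(6)[OF csub TqH SE] by (simp add: scaleR_diff_right)
      then have "norm (\<phi> h (\<kappa> *\<^sub>R T (q z)) - F z) = \<kappa> * norm (\<phi> h (T (q z) - ?S))" using \<kappa> by simp
      also have "\<dots> \<le> \<kappa> * (M * norm (T (q z) - ?S))" using \<kappa> TqH SE by (intro mult_left_mono lh) simp_all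
      also have "\<dots> \<le> \<kappa> * (M * (\<eta> / L * (2 * norm ?\<Delta> * norm z)))"
        using \<kappa> M uv(2)[OF qH] mult_left_mono[OF qle, of "\<eta> / L"] \<eta> L by (intro mult_left_mono) simp_all
      also have "\<dots> = (\<eta> * norm z) * ((M * \<kappa> * (2 * norm ?\<Delta>)) / L)" by simp
      also have "\<dots> \<le> (\<eta> * norm z) * 1" using L \<eta> by (intro mult_left_mono) (simp_all add: L_def)
      finally show ?thesis by simp
    qed
    have "norm (\<phi> a (Rx 1 z) - F z) \<le> \<eta> * norm z + \<eta> * norm z + \<eta> * norm z + \<eta> * norm z"
    proof -
      have tri: "norm (p - s) \<le> r1 + r2 + r3 + r4" if "norm (p - q1) \<le> r1" "norm (q1 - q2) \<le> r2" "norm (q2 - q3) \<le> r3" "norm (q3 - s) \<le> r4"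
        for p q1 q2 q3 s :: 'e and r1 r2 r3 r4
      proof -
        have "p - s = (p - q1) + (q1 - q2) + (q2 - q3) + (q3 - s)" by simp
        then show ?thesis using that
          by (metis (no_types) add_mono norm_triangle_le)
      qed
      show ?thesis by (rule tri[OF e1 e2 e3 e4])
    qed
    also have "\<dots> = e * norm z" by (simp add: \<eta>_def)
    finally show ?thesis .
  qed
  ultimately show ?thesis by blast
qed

end

section \<open>The unbounded modular cycle\<close>

lemma op_norm_nonneg:
  assumes "0 \<in> hcarrier E" "\<And>u. u \<in> hcarrier E \<Longrightarrow> norm (f u) \<le> C * norm u"
  shows "0 \<le> op_norm E f"
proof -
  have "norm (f u) \<le> \<bar>C\<bar>" if "u \<in> hcarrier E" "norm u \<le> 1" for u
  proof -
    have "norm (f u) \<le> \<bar>C\<bar> * norm u" by (rule order_trans[OF assms(2)[OF that(1)]]) (simp add: mult_right_mono)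
    also have "\<dots> \<le> \<bar>C\<bar>" using that(2) by (simp add: mult_left_le)
    finally show ?thesis .
  qed
  then have bdd: "bdd_above ((\<lambda>u. norm (f u)) ` {u \<in> hcarrier E. norm u \<le> 1})"
    by (intro bdd_aboveI2[of _ _ "\<bar>C\<bar>"]) auto
  have "0 \<in> {u \<in> hcarrier E. norm u \<le> 1}" using assms(1) by simp
  from cSUP_upper[OF this bdd] have "norm (f 0) \<le> op_norm E f" unfolding op_norm_def .
  then show ?thesis by (rule order_trans[OF norm_ge_zero])
qed

lemma bounded_op_comp:
  assumes S: "bounded_op E S" and T: "bounded_op E T"
  shows "bounded_op E (\<lambda>u. S (T u))"
proof -
  have "bounded_on (hcarrier E) (\<lambda>u. S (T u))"
    by (rule bounded_on_comp[OF bounded_op_bounded_on[OF S] bounded_op_bounded_on[OF T]])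
  moreover have "S (T (hact E u b)) = hact E (S (T u)) b" if "u \<in> hcarrier E" for u b
    using bounded_opD(2)[OF T that] bounded_opD(2)[OF S bounded_opD(1)[OF T that]] by simp
  ultimately show ?thesis unfolding bounded_op_def bounded_on_def clinear_on_def by simp
qed

lemma (in inner_module) bounded_positive_resolvent:
  assumes T: "bounded_on H T" and pos: "\<And>u. u \<in> H \<Longrightarrow> pos (ip u (T u))" and d: "0 < \<delta>" and z: "z \<in> H"
    and v: "v = inv_into H (\<lambda>u. T u + \<delta> *\<^sub>R u) z"
  shows "v \<in> H" "T v + \<delta> *\<^sub>R v = z" "\<delta> * norm v \<le> K * norm z"
proof -
  have zi: "z \<in> (\<lambda>u. T u + \<delta> *\<^sub>R u) ` H" using positive_shift_surj[OF T pos d] z by simp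
  show 1: "v \<in> H" unfolding v by (rule inv_into_into[OF zi])
  show 2: "T v + \<delta> *\<^sub>R v = z" unfolding v by (rule f_inv_into_f[OF zi])
  show "\<delta> * norm v \<le> K * norm z"
    using positive_shift_bounded_below[of v T \<delta>] 1 bounded_onD(1)[OF T 1] pos[OF 1] d by (simp add: 2)
qed

context localization
begin

abbreviation "act \<equiv> loc_action A E \<phi> x"
abbreviation "\<Delta> \<equiv> x * star x"

lemma act_eq: "a \<in> Ax \<Longrightarrow> u \<in> Hx \<Longrightarrow> act a u = \<phi> a u"
  by (simp add: loc_action_def)

lemma act_mem: "a \<in> Ax \<Longrightarrow> u \<in> Hx \<Longrightarrow> act a u \<in> Hx"
  by (subst act_eq) (assumption | rule \<phi>_Ax_Hx HxH)+

lemma \<Delta>A: "\<Delta> \<in> A"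
  by (rule Ax_mem[OF \<Delta>_Ax])

lemma bounded_op_Eloc:
  assumes T: "bounded_op E T" and mem: "\<And>u. u \<in> Hx \<Longrightarrow> T u \<in> Hx" and eq: "\<And>u. u \<in> Hx \<Longrightarrow> T' u = T u"
  shows "bounded_op Eloc T'"
proof -
  have m: "u + v \<in> Hx" "c *\<^sub>C u \<in> Hx" "hact E u b \<in> Hx" if "u \<in> Hx" "v \<in> Hx" for u v c b
    using submoduleD(3-5)[OF submodule_Hx] that by auto
  obtain C where C: "\<And>u. u \<in> hcarrier E \<Longrightarrow> norm (T u) \<le> C * norm u" using T unfolding bounded_op_def by blast
  note lin = clinear_onD(1,2)[OF bounded_onD(2)[OF bounded_op_bounded_on[OF T]]]
  show ?thesis unfolding bounded_op_def Eloc_simps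
  proof (intro conjI ballI allI funcsetI exI[of _ C])
    fix u assume u: "u \<in> Hx"
    show "T' u \<in> Hx" "norm (T' u) \<le> C * norm u" "T' (c *\<^sub>C u) = c *\<^sub>C T' u" "T' (hact E u b) = hact E (T' u) b" for c b
      using mem[OF u] C[OF HxH[OF u]] lin(2)[OF HxH[OF u]] bounded_opD(2)[OF T HxH[OF u]] m[OF u u]
      by (simp_all add: eq u)
    show "T' (u + v) = T' u + T' v" if v: "v \<in> Hx" for v
      using lin(1)[OF HxH[OF u] HxH[OF v]] m[OF u v] by (simp add: eq u v)
  qed
qed

lemma adjointable_Eloc:
  assumes T: "bounded_op E T" and mem: "\<And>u. u \<in> Hx \<Longrightarrow> T u \<in> Hx" and eq: "\<And>u. u \<in> Hx \<Longrightarrow> T' u = T u"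
    and S: "\<And>v. v \<in> Hx \<Longrightarrow> S v \<in> Hx" and adj: "\<And>u v. u \<in> Hx \<Longrightarrow> v \<in> Hx \<Longrightarrow> hinner E (T u) v = hinner E u (S v)"
  shows "adjointable Eloc T'"
  unfolding adjointable_def Eloc_simps
  using bounded_op_Eloc[OF T mem eq] S adj by (intro conjI bexI[of _ S]) (simp_all add: eq)

lemma correspondence_Eloc: "correspondence Ax Eloc act"
  unfolding correspondence_def Eloc_simps
proof (intro conjI ballI allI hilbert_Eloc)
  fix a assume a: "a \<in> Ax"
  note aA = Ax_mem[OF a]
  show "adjointable Eloc (act a)"
  proof (rule adjointable_Eloc[OF cD(3)[OF aA], where S = "\<phi> (star a)"])
    show "\<phi> a u \<in> Hx" if "u \<in> Hx" for u by (rule \<phi>_Ax_Hx[OF a HxH[OF that]])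
    show "act a u = \<phi> a u" if "u \<in> Hx" for u by (rule act_eq[OF a that])
    show "\<phi> (star a) v \<in> Hx" if "v \<in> Hx" for v by (rule \<phi>_Ax_Hx[OF AxD(2)[OF a] HxH[OF that]])
    show "hinner E (\<phi> a u) v = hinner E u (\<phi> (star a) v)" if "u \<in> Hx" "v \<in> Hx" for u v
      by (rule cD(7)[OF aA HxH[OF that(1)] HxH[OF that(2)]])
  qed
  fix u assume u: "u \<in> Hx"
  note uH = HxH[OF u]
  show "act (c *\<^sub>C a) u = c *\<^sub>C act a u" for c
    unfolding act_eq[OF a u] act_eq[OF AxD(3)[OF a] u] by (rule cD(6)[OF aA uH])
  show "hinner E (act a u) v = hinner E u (act (star a) v)" if "v \<in> Hx" for v
    unfolding act_eq[OF a u] act_eq[OF AxD(2)[OF a] that] by (rule cD(7)[OF aA uH HxH[OF that]])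
  fix b assume b: "b \<in> Ax"
  show "act (a + b) u = act a u + act b u" "act (a * b) u = act a (act b u)"
    unfolding act_eq[OF a act_mem[OF b u]]
    unfolding act_eq[OF a u] act_eq[OF b u] act_eq[OF AxD(4)[OF a b] u] act_eq[OF AxD(5)[OF a b] u]
    by (rule cD(4)[OF aA Ax_mem[OF b] uH], rule cD(5)[OF aA Ax_mem[OF b] uH])
qed

text \<open>
  The images under \<open>x\<close> of generators of \<open>E\<close> generate \<open>E\<^sub>x\<close>.
\<close>

lemma countably_generated_Eloc: "countably_generated Eloc"
proof -
  obtain S where S: "countable S" "S \<subseteq> hcarrier E" "closure (submodule E hull S) = hcarrier E"
    using chainD(4) unfolding countably_generated_def by blast
  let ?S = "\<phi> x ` S"
  let ?N = "submodule Eloc hull ?S"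
  have SH: "?S \<subseteq> Hx" using S(2) \<phi>x_Hx by blast
  have whole: "submodule Eloc Hx" using submodule_Hx unfolding submodule_def Eloc_simps by blast
  have NH: "?N \<subseteq> Hx" by (rule hull_minimal[where S = "submodule Eloc", OF SH whole])
  have N: "submodule Eloc ?N" unfolding submodule_def[of Eloc ?N] Eloc_simps
  proof (intro conjI ballI allI NH)
    show "0 \<in> ?N" unfolding hull_def submodule_def by blast
    fix u assume u: "u \<in> ?N"
    show "c *\<^sub>C u \<in> ?N" for c using u unfolding hull_def by (auto simp: submodule_def)
    show "hact E u b \<in> ?N" for b using u unfolding hull_def by (auto simp: submodule_def)
    show "u + v \<in> ?N" if "v \<in> ?N" for v using u that unfolding hull_def by (auto simp: submodule_def)
  qed
  let ?M = "{u \<in> hcarrier E. \<phi> x u \<in> ?N}"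
  note lin = clinear_onD[OF cD(10)[OF x_mem(1)]]
  have "submodule E ?M" unfolding submodule_def[of E ?M]
  proof (intro conjI ballI allI)
    show "0 \<in> ?M" using lin(5)[OF csub] submoduleD(2)[OF N] by simp
    fix u assume u: "u \<in> ?M"
    show "c *\<^sub>C u \<in> ?M" for c using u lin(2)[of u c] submoduleD(4)[OF N, of "\<phi> x u" c] by simp
    show "hact E u b \<in> ?M" for b
      using u bounded_opD(2)[OF cD(3)[OF x_mem(1)], of u b] submoduleD(5)[OF N, of "\<phi> x u" b] submoduleD(5)[OF hm(1), of u b] by simp
    show "u + v \<in> ?M" if "v \<in> ?M" for v using u that lin(1)[of u v] submoduleD(3)[OF N, of "\<phi> x u" "\<phi> x v"] by simp
  qed blast
  then have hull: "submodule E hull S \<subseteq> ?M"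
    by (rule hull_minimal[where S = "submodule E", rotated]) (use S(2) hull_subset[of ?S "submodule Eloc"] in blast)
  have "\<phi> x u \<in> closure ?N" if u: "u \<in> hcarrier E" for u
  proof -
    obtain s where s: "\<And>n. s n \<in> submodule E hull S" "s \<longlonglongrightarrow> u" using u S(3) closure_sequential by metis
    have sM: "s n \<in> hcarrier E" "\<phi> x (s n) \<in> ?N" for n using subsetD[OF hull s(1)[of n]] by simp_all
    show ?thesis unfolding closure_sequential
      by (intro exI[of _ "\<lambda>n. \<phi> x (s n)"] conjI allI sM \<phi>_tendsto[OF x_mem(1) _ u s(2)])
  qed
  then have "Hx \<subseteq> closure ?N" by (intro closure_minimal image_subsetI closed_closure)
  then have "closure ?N = Hx" using closure_minimal[OF NH closed_closure] by (rule antisym[rotated])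
  then show ?thesis unfolding countably_generated_def Eloc_simps using S(1) SH by blast
qed

lemma ip_\<Delta>: "u \<in> hcarrier E \<Longrightarrow> v \<in> hcarrier E \<Longrightarrow> hinner E u (\<phi> \<Delta> v) = hinner E (\<phi> (star x) u) (\<phi> (star x) v)"
  using cD(7)[OF x_mem(2), of u "\<phi> (star x) v"] cD(8)[OF x_mem(2)] by (simp add: \<Delta>_eq star_star)

lemma positive_\<Delta>: "positive_op Eloc (act \<Delta>)"
  unfolding positive_op_def selfadjoint_op_def Eloc_simps
proof (intro conjI ballI)
  show "adjointable Eloc (act \<Delta>)"
    using correspondenceD(2)[OF correspondence_Eloc \<Delta>_Ax] .
  fix u assume u: "u \<in> Hx"
  show "hinner E (act \<Delta> u) v = hinner E u (act \<Delta> v)" if v: "v \<in> Hx" for v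
    using cD(7)[OF \<Delta>A HxH[OF u] HxH[OF v]] u v by (simp add: act_eq \<Delta>_Ax star_mult star_star)
  show "positive_in UNIV (hinner E u (act \<Delta> u))"
    using u HxH[OF u] hm(12)[OF cD(8)[OF x_mem(2) HxH[OF u]]] by (simp add: act_eq \<Delta>_Ax ip_\<Delta>)
qed

lemma positive_op_pos:
  assumes "positive_op Eloc T"
  shows "bounded_on Hx T" "u \<in> Hx \<Longrightarrow> pos (hinner E u (T u))"
    "u \<in> Hx \<Longrightarrow> v \<in> Hx \<Longrightarrow> hinner E (T u) v = hinner E u (T v)"
proof -
  have "bounded_op Eloc T" using assms unfolding positive_op_def selfadjoint_op_def adjointable_def by blast
  from bounded_op_bounded_on[OF this] show "bounded_on Hx T" by simp
  show "u \<in> Hx \<Longrightarrow> pos (hinner E u (T u))" "u \<in> Hx \<Longrightarrow> v \<in> Hx \<Longrightarrow> hinner E (T u) v = hinner E u (T v)"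
    using assms positive_in_imp_pos unfolding positive_op_def selfadjoint_op_def Eloc_simps by blast+
qed

lemma resolvent_positive:
  assumes T: "positive_op Eloc T" and d: "0 < \<delta>" and z: "z \<in> Hx"
  shows "resolvent_op Eloc T \<delta> z \<in> Hx"
    "T (resolvent_op Eloc T \<delta> z) + \<delta> *\<^sub>R resolvent_op Eloc T \<delta> z = z"
    "\<delta> * norm (resolvent_op Eloc T \<delta> z) \<le> norm z"
  using X.bounded_positive_resolvent[OF positive_op_pos(1,2)[OF T] d z, of "resolvent_op Eloc T \<delta> z"]
  by (simp_all add: resolvent_op_def)

lemma norm_sq: "u \<in> hcarrier E \<Longrightarrow> (norm u)\<^sup>2 = norm (hinner E u u)"
  using hm(13) by simp

text \<open>
  For \<open>v = (\<Delta> + \<delta>)\<^sup>-\<^sup>1 x w\<close> pair the equation with \<open>v\<close>: \<open>\<langle>x* v, x* v\<rangle> + \<delta> \<langle>v, v\<rangle> = \<langle>x* v, w\<rangle>\<close>. The first term bounds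
  \<open>x* v\<close> by \<open>w\<close>, and then the second one bounds \<open>v\<close>.
\<close>

lemma \<Delta>_shift_small:
  assumes v: "v \<in> hcarrier E" and w: "w \<in> hcarrier E" and d: "0 < \<delta>" and eq: "\<phi> \<Delta> v + \<delta> *\<^sub>R v = \<phi> x w"
  shows "norm (\<delta> *\<^sub>R v) \<le> sqrt \<delta> * norm w"
proof -
  let ?s = "\<phi> (star x) v"
  have sH: "?s \<in> hcarrier E" "\<phi> \<Delta> v \<in> hcarrier E" using cD(8) x_mem \<Delta>A v by auto
  have "hinner E v (\<phi> x w) = hinner E ?s w"
    using cD(7)[OF x_mem(2) v w] by (simp add: star_star)
  then have sum: "hinner E ?s ?s + \<delta> *\<^sub>R hinner E v v = hinner E ?s w"
    using v sH by (simp add: eq[symmetric] ip_add ip_scaleR ip_\<Delta>)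
  have p: "pos (hinner E ?s ?s)" "pos (\<delta> *\<^sub>R hinner E v v)" using v sH d by (auto intro: ip_pos pos_scaleR)
  have le: "norm (hinner E ?s w) \<le> norm ?s * norm w" by (rule ip_le[OF sH(1) w])
  have "(norm ?s)\<^sup>2 \<le> norm ?s * norm w" using pos_norm_mono[OF p] le by (simp add: sum norm_sq[OF sH(1)])
  then have s: "norm ?s \<le> norm w" by (cases "norm ?s = 0") (simp_all add: power2_eq_square mult_le_cancel_left)
  have "\<delta> * (norm v)\<^sup>2 \<le> norm ?s * norm w"
    using pos_norm_mono[OF p(2,1)] le d sum[unfolded add.commute[of "hinner E ?s ?s"]] by (simp add: norm_sq[OF v])
  also have "\<dots> \<le> norm w * norm w" using s by (intro mult_right_mono) simp_all
  finally have "\<delta> * (\<delta> * (norm v)\<^sup>2) \<le> \<delta> * (norm w * norm w)" using d by (intro mult_left_mono) simp_all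
  moreover have "(norm (\<delta> *\<^sub>R v))\<^sup>2 = \<delta> * (\<delta> * (norm v)\<^sup>2)" by (simp add: power2_eq_square)
  moreover have "(sqrt \<delta> * norm w)\<^sup>2 = \<delta> * (norm w * norm w)"
    using d by (simp add: power_mult_distrib power2_eq_square[of "norm w"])
  ultimately have "(norm (\<delta> *\<^sub>R v))\<^sup>2 \<le> (sqrt \<delta> * norm w)\<^sup>2" by simp
  then show ?thesis by (rule power2_le_imp_le) (use d in simp)
qed

lemma \<Delta>_dense: "closure (act \<Delta> ` Hx) = Hx"
proof
  show "closure (act \<Delta> ` Hx) \<subseteq> Hx" using act_mem[OF \<Delta>_Ax] by (intro closure_minimal) auto
  have "\<phi> x w \<in> closure (act \<Delta> ` Hx)" if w: "w \<in> hcarrier E" for w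
    unfolding closure_approachable
  proof (intro allI impI)
    fix e :: real assume e: "0 < e"
    define \<delta> where "\<delta> = (e / (norm w + 1))\<^sup>2"
    have w1: "0 < norm w + 1" by (simp add: add_nonneg_pos)
    have d: "0 < \<delta>" "sqrt \<delta> = e / (norm w + 1)" using e w1 by (simp_all add: \<delta>_def)
    define v where "v = resolvent_op Eloc (act \<Delta>) \<delta> (\<phi> x w)"
    have v: "v \<in> Hx" "act \<Delta> v + \<delta> *\<^sub>R v = \<phi> x w"
      using resolvent_positive(1,2)[OF positive_\<Delta> d(1) \<phi>x_Hx[OF w]] by (simp_all add: v_def)
    have "dist (act \<Delta> v) (\<phi> x w) = norm (\<delta> *\<^sub>R v)" unfolding v(2)[symmetric] by (simp add: dist_norm)
    also have "\<dots> \<le> e / (norm w + 1) * norm w"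
      using \<Delta>_shift_small[OF HxH[OF v(1)] w d(1)] v d(2) by (simp add: act_eq \<Delta>_Ax)
    also have "\<dots> < e / (norm w + 1) * (norm w + 1)" using e w1 by (intro mult_strict_left_mono) simp_all
    also have "\<dots> = e" using w1 by simp
    finally show "\<exists>y\<in>act \<Delta> ` Hx. dist y (\<phi> x w) < e" using v(1) by blast
  qed
  then show "Hx \<subseteq> closure (act \<Delta> ` Hx)" by (intro closure_minimal image_subsetI closed_closure)
qed

lemma compact_resolvent:
  assumes a: "a \<in> Ax"
  shows "compact_graph Eloc ((shift \<i> Dx)\<inverse> O op_graph Eloc (act a))"
  unfolding compact_graph_def
proof (intro exI conjI)
  let ?T = "\<lambda>z. act a (Rx 1 z)"
  have Rm: "Rx 1 z \<in> Hx" if "z \<in> Hx" for z using Rx_mem[of 1, OF _ that] by simp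
  have eqT: "?T z = \<phi> a (Rx 1 z)" if "z \<in> Hx" for z by (rule act_eq[OF a Rm[OF that]])
  show "compact_op Eloc ?T" unfolding compact_op_def
  proof (intro conjI allI impI)
    have "bounded_op Eloc (act a)" by (rule correspondenceD(3)[OF correspondence_Eloc a])
    then have b: "bounded_op Eloc ?T" by (rule bounded_op_comp[OF _ Rx_bounded_op])
    show "adjointable Eloc ?T" unfolding adjointable_def Eloc_simps
    proof (intro conjI b bexI[of _ "\<lambda>w. Rx (-1) (act (star a) w)"] ballI funcsetI)
      fix w assume w: "w \<in> Hx"
      have aw: "act (star a) w \<in> Hx" by (rule act_mem[OF AxD(2)[OF a] w])
      show "Rx (-1) (act (star a) w) \<in> Hx" by (rule Rx_mem[OF _ aw]) simp
      show "hinner E (?T z) w = hinner E z (Rx (-1) (act (star a) w))" if z: "z \<in> Hx" for z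
        using Rx_adj[OF z aw] correspondenceD(7)[OF correspondence_Eloc a, of "Rx 1 z" w] Rm[OF z] w by simp
    qed
    fix e :: real assume e: "0 < e"
    obtain F where F: "finite_rank_op Eloc F" "\<And>z. z \<in> Hx \<Longrightarrow> norm (\<phi> a (Rx 1 z) - F z) \<le> e / 2 * norm z"
      using \<phi>_Rx_approx[OF a, of "e / 2"] e by auto
    have "op_norm Eloc (\<lambda>u. ?T u - F u) \<le> e / 2"
      by (rule op_norm_le) (use F(2) e eqT in simp_all)
    then show "\<exists>F. finite_rank_op Eloc F \<and> op_norm Eloc (\<lambda>u. ?T u - F u) < e" using F(1) e by (intro exI[of _ F]) simp
  qed
  show "(shift \<i> Dx)\<inverse> O op_graph Eloc (act a) = op_graph Eloc ?T"
  proof (intro set_eqI iffI; clarify)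
    fix z y assume "(z, y) \<in> op_graph Eloc ?T"
    then have z: "z \<in> Hx" "y = act a (Rx 1 z)" by (auto simp: op_graph_def)
    have "(Rx 1 z, z - \<i> *\<^sub>C Rx 1 z) \<in> Dx" using Rx_Dx[of 1, OF _ z(1)] by simp
    then have "(Rx 1 z, z) \<in> shift \<i> Dx" unfolding shift_def
      by (intro CollectI exI[of _ "Rx 1 z"] exI[of _ "z - \<i> *\<^sub>C Rx 1 z"]) simp
    moreover have "(Rx 1 z, y) \<in> op_graph Eloc (act a)" using Rm z by (simp add: op_graph_def)
    ultimately show "(z, y) \<in> (shift \<i> Dx)\<inverse> O op_graph Eloc (act a)" by blast
  next
    fix u z y assume "(u, z) \<in> shift \<i> Dx" "(u, y) \<in> op_graph Eloc (act a)"
    then obtain v where v: "(u, v) \<in> Dx" "z = \<i> *\<^sub>C u + v" "y = act a u" unfolding shift_def op_graph_def by auto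
    have "Rx 1 z = u" by (rule Rx_unique[OF _ v(1)]) (simp_all add: v(2) add.commute)
    moreover have "z \<in> Hx" unfolding v(2) using Dx_mem[OF v(1)] by (intro X.mem)
    ultimately show "(z, y) \<in> op_graph Eloc ?T" by (simp add: op_graph_def v(3))
  qed
qed

text \<open>
  The difference is \<open>-\<delta> (\<Delta> + \<delta>)\<^sup>-\<^sup>1 a\<close> with \<open>\<delta> = 1/n\<close>. Split \<open>a\<close> into a small element and \<open>x c x*\<close>; on
  the second part \<open>\<Delta>_shift_small\<close> gains a factor \<open>\<surd>\<delta>\<close>.
\<close>

lemma approximate_unit:
  assumes a: "a \<in> Ax"
  shows "(\<lambda>n::nat. op_norm Eloc (\<lambda>u. act \<Delta> (resolvent_op Eloc (act \<Delta>) (1 / real n) (act a u)) - act a u)) \<longlonglongrightarrow> 0"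
proof (rule LIMSEQ_I)
  fix e :: real assume e: "0 < e"
  let ?f = "\<lambda>n u. act \<Delta> (resolvent_op Eloc (act \<Delta>) (1 / real n) (act a u)) - act a u"
  obtain c where c: "c \<in> A" "norm (a - x * c * star x) < e / 3" using Ax_approx[OF a, of "e / 3"] e by auto
  let ?b = "a - x * c * star x"
  let ?N = "norm (c * star x)"
  have bAx: "?b \<in> Ax" "x * c * star x \<in> Ax" using mult_Ax[OF c(1)] a AxD by auto
  have cA: "c * star x \<in> A" using c x_mem AD by auto
  have bound: "norm (?f n u) \<le> (e / 3 + sqrt (1 / real n) * ?N) * norm u" if n: "0 < n" and u: "u \<in> Hx" for n u
  proof -
    define \<delta> where "\<delta> = 1 / real n"
    have d: "0 < \<delta>" using n by (simp add: \<delta>_def)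
    define R where "R = resolvent_op Eloc (act \<Delta>) \<delta>"
    note uH = HxH[OF u]
    have z1: "\<phi> ?b u \<in> Hx" by (rule \<phi>_Ax_Hx[OF bAx(1) uH])
    let ?w = "\<phi> (c * star x) u"
    have w: "?w \<in> hcarrier E" by (rule cD(8)[OF cA uH])
    have z2: "\<phi> x ?w \<in> Hx" by (rule \<phi>x_Hx[OF w])
    have "\<phi> a u = \<phi> ?b u + \<phi> (x * c * star x) u" using cD(4)[OF Ax_mem[OF bAx(1)] Ax_mem[OF bAx(2)] uH] by simp
    also have "\<phi> (x * c * star x) u = \<phi> x ?w" using cD(5)[OF x_mem(1) cA uH] by (simp add: mult.assoc)
    finally have z: "act a u = \<phi> ?b u + \<phi> x ?w" by (simp add: act_eq a u)
    have R: "R y \<in> Hx" "act \<Delta> (R y) + \<delta> *\<^sub>R R y = y" "\<delta> * norm (R y) \<le> norm y" if "y \<in> Hx" for y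
      using resolvent_positive[OF positive_\<Delta> d that] by (simp_all add: R_def)
    have au: "act a u \<in> Hx" by (rule act_mem[OF a u])
    let ?d = "R (act a u) - (R (\<phi> ?b u) + R (\<phi> x ?w))"
    have dH: "?d \<in> Hx" using R(1) au z1 z2 by simp
    note lin = clinear_onD[OF bounded_onD(2)[OF positive_op_pos(1)[OF positive_\<Delta>]]]
    have "act \<Delta> ?d + \<delta> *\<^sub>R ?d = (act \<Delta> (R (act a u)) + \<delta> *\<^sub>R R (act a u))
        - (act \<Delta> (R (\<phi> ?b u)) + \<delta> *\<^sub>R R (\<phi> ?b u)) - (act \<Delta> (R (\<phi> x ?w)) + \<delta> *\<^sub>R R (\<phi> x ?w))"
      using R(1) au z1 z2 by (simp add: lin(1) lin(6)[OF X.csub] algebra_simps)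
    also have "\<dots> = 0" by (simp add: R(2)[OF au] R(2)[OF z1] R(2)[OF z2]) (simp add: z)
    finally have "\<delta> * norm ?d \<le> 0"
      using X.positive_shift_bounded_below[of ?d "act \<Delta>" \<delta>] dH act_mem[OF \<Delta>_Ax dH] positive_op_pos(2)[OF positive_\<Delta> dH] d by simp
    then have split: "R (act a u) = R (\<phi> ?b u) + R (\<phi> x ?w)" using d by (simp add: mult_le_0_iff)
    have 1: "norm (\<delta> *\<^sub>R R (\<phi> ?b u)) \<le> e / 3 * norm u"
    proof -
      have "norm (\<phi> ?b u) \<le> norm ?b * norm u" by (rule \<phi>_le[OF Ax_mem[OF bAx(1)] uH])
      also have "\<dots> \<le> e / 3 * norm u" using c(2) by (intro mult_right_mono) simp_all
      finally show ?thesis using R(3)[OF z1] d by simp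
    qed
    have 2: "norm (\<delta> *\<^sub>R R (\<phi> x ?w)) \<le> sqrt \<delta> * ?N * norm u"
    proof -
      have "\<phi> \<Delta> (R (\<phi> x ?w)) + \<delta> *\<^sub>R R (\<phi> x ?w) = \<phi> x ?w" using R(2)[OF z2] by (simp add: act_eq[OF \<Delta>_Ax R(1)[OF z2]])
      then have "norm (\<delta> *\<^sub>R R (\<phi> x ?w)) \<le> sqrt \<delta> * norm ?w" by (rule \<Delta>_shift_small[OF HxH[OF R(1)[OF z2]] w d])
      also have "\<dots> \<le> sqrt \<delta> * (?N * norm u)" using \<phi>_le[OF cA uH] d by (intro mult_left_mono) simp_all
      finally show ?thesis by (simp add: mult.assoc)
    qed
    have "?f n u = - (\<delta> *\<^sub>R R (act a u))" using R(2)[OF au] by (simp add: R_def \<delta>_def algebra_simps)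
    then have "norm (?f n u) = norm (\<delta> *\<^sub>R R (\<phi> ?b u) + \<delta> *\<^sub>R R (\<phi> x ?w))"
      by (simp only: norm_minus_cancel split scaleR_add_right)
    also have "\<dots> \<le> e / 3 * norm u + sqrt \<delta> * ?N * norm u" using 1 2 by (intro norm_triangle_le add_mono)
    finally show ?thesis by (simp add: distrib_right \<delta>_def)
  qed
  have "(\<lambda>n. sqrt (1 / real n) * ?N) \<longlonglongrightarrow> sqrt 0 * ?N"
    by (intro tendsto_mult tendsto_real_sqrt lim_1_over_n tendsto_const)
  then have "\<forall>\<^sub>F n in sequentially. sqrt (1 / real n) * ?N < e / 3"
    by (rule order_tendstoD(2)) (use e in simp)
  then obtain n0 where n0: "\<And>n. n0 \<le> n \<Longrightarrow> sqrt (1 / real n) * ?N < e / 3" unfolding eventually_sequentially by blast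
  show "\<exists>no. \<forall>n\<ge>no. norm (op_norm Eloc (?f n) - 0) < e"
  proof (intro exI[of _ "Suc n0"] allI impI)
    fix n assume n: "Suc n0 \<le> n"
    let ?C = "e / 3 + sqrt (1 / real n) * ?N"
    have "op_norm Eloc (?f n) \<le> ?C"
      by (rule op_norm_le) (use bound[of n] n e in \<open>simp_all add: add_nonneg_nonneg\<close>)
    moreover have "0 \<le> op_norm Eloc (?f n)"
      by (rule op_norm_nonneg[where C = ?C]) (use bound[of n] n in simp_all)
    ultimately show "norm (op_norm Eloc (?f n) - 0) < e" using n0[of n] n e by simp
  qed
qed

text \<open>
  A positive operator needs inner products of the form \<open>b* b\<close>, so a root of \<open>\<Delta>\<close> alone is not enough: \<open>\<Delta>\<^sup>1\<^sup>/\<^sup>2\<close> is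
  exhibited as the square of a selfadjoint fourth root. Both roots are taken in the unitization of \<open>A\<^sub>x\<close>, so that they
  leave \<open>E\<^sub>x\<close> invariant.
\<close>

lemma sqrt_\<Delta>:
  defines "S \<equiv> sqrt_op Eloc (act \<Delta>)"
  shows "positive_op Eloc S" "u \<in> Hx \<Longrightarrow> S (S u) = act \<Delta> u"
proof -
  have "\<exists>S. positive_op Eloc S \<and> (\<forall>u\<in>hcarrier Eloc. S (S u) = act \<Delta> u)"
  proof -
    let ?C = "{y. upart y \<in> Ax}"
    have "cpos (star (uembed (star x)) * uembed (star x))" by (rule cpos_star_mult_self)
    then have p: "cpos (uembed \<Delta>)" by (simp add: uembed_mult uembed_star star_star)
    have pC: "uembed \<Delta> \<in> ?C" by (simp add: \<Delta>_Ax)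
    obtain q where q: "q \<in> ?C" "cpos q" "q * q = uembed \<Delta>" by (rule cpos_sqrt[OF p closed_unital_upart[OF cstar_Ax] pC])
    obtain r where r: "r \<in> ?C" "cpos r" "r * r = q" by (rule cpos_sqrt[OF q(2) closed_unital_upart[OF cstar_Ax] q(1)])
    have qA: "upart q \<in> A" "upart r \<in> A" "upart q \<in> Ax" using q(1) r(1) Ax_mem by auto
    let ?S = "uact \<phi> q"
    have SHx: "?S u \<in> Hx" if u: "u \<in> Hx" for u
      using \<phi>_Ax_Hx[OF qA(3) HxH[OF u]] u by (simp add: uact_def)
    have Sadj: "hinner E (?S u) v = hinner E u (?S v)" if "u \<in> Hx" "v \<in> Hx" for u v
      using uact_star[OF starA chainD(3) qA(1) HxH[OF that(1)] HxH[OF that(2)]] cpos_selfadj[OF q(2)] by simp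
    have "positive_op Eloc ?S" unfolding positive_op_def selfadjoint_op_def Eloc_simps
    proof (intro conjI ballI Sadj)
      have "0 \<in> hcarrier E" by simp
      show "adjointable Eloc ?S"
        by (rule adjointable_Eloc[OF uact_bounded[OF starA chainD(3) qA(1) \<open>0 \<in> hcarrier E\<close>] SHx refl SHx Sadj])
      fix u assume u: "u \<in> Hx"
      note uH = HxH[OF u]
      have rH: "uact \<phi> r u \<in> hcarrier E" by (rule uact_mem[OF starA chainD(3) qA(2) uH])
      have "hinner E u (?S u) = hinner E u (uact \<phi> r (uact \<phi> r u))"
        using uact_mult[OF starA chainD(3) qA(2) uH qA(2)] r(3) by simp
      also have "\<dots> = hinner E (uact \<phi> r u) (uact \<phi> r u)"
        using uact_star[OF starA chainD(3) qA(2) uH rH] cpos_selfadj[OF r(2)] by simp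
      finally show "positive_in UNIV (hinner E u (?S u))" using hm(12)[OF rH] by simp
    qed
    moreover have "?S (?S u) = act \<Delta> u" if u: "u \<in> Hx" for u
      using uact_mult[OF starA chainD(3) qA(1) HxH[OF u] qA(1)] q(3) u by (simp add: act_eq \<Delta>_Ax uact_def)
    ultimately show ?thesis by (intro exI[of _ ?S]) simp
  qed
  from someI_ex[OF this] show "positive_op Eloc S" "u \<in> Hx \<Longrightarrow> S (S u) = act \<Delta> u"
    unfolding S_def sqrt_op_def by auto
qed

text \<open>
  For \<open>S = \<Delta>\<^sup>1\<^sup>/\<^sup>2\<close> and \<open>v = (S + \<epsilon>)\<^sup>-\<^sup>1 z\<close>, expanding \<open>\<langle>z, z\<rangle>\<close> for \<open>z = S v + \<epsilon> v\<close> leaves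
  \<open>\<langle>S v, S v\<rangle> = \<langle>x* v, x* v\<rangle>\<close> and positive terms. The second bound is the adjoint of the first.
\<close>

lemma
  defines "R \<equiv> resolvent_op Eloc (sqrt_op Eloc (act \<Delta>))"
  assumes e: "0 < \<epsilon>"
  shows star_x_resolvent_le: "z \<in> Hx \<Longrightarrow> norm (\<phi> (star x) (R \<epsilon> z)) \<le> norm z"
    and resolvent_x_le: "w \<in> hcarrier E \<Longrightarrow> norm (R \<epsilon> (\<phi> x w)) \<le> norm w"
    and resolvent_sqrt_mem: "z \<in> Hx \<Longrightarrow> R \<epsilon> z \<in> Hx"
proof -
  define S where "S = sqrt_op Eloc (act \<Delta>)"
  note S = sqrt_\<Delta>[folded S_def]
  note Sp = positive_op_pos[OF S(1)]
  have SH: "S u \<in> Hx" if "u \<in> Hx" for u by (rule bounded_onD(1)[OF Sp(1) that])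
  have R: "R \<epsilon> z \<in> Hx" "S (R \<epsilon> z) + \<epsilon> *\<^sub>R R \<epsilon> z = z" if "z \<in> Hx" for z
    using resolvent_positive(1,2)[OF S(1) e that] by (simp_all add: R_def S_def)
  show "z \<in> Hx \<Longrightarrow> R \<epsilon> z \<in> Hx" by (rule R(1))
  have 1: "norm (\<phi> (star x) (R \<epsilon> z)) \<le> norm z" if z: "z \<in> Hx" for z
  proof -
    let ?v = "R \<epsilon> z"
    note v = R(1)[OF z]
    note H = v SH[OF v]
    have "hinner E (\<phi> (star x) ?v) (\<phi> (star x) ?v) = hinner E ?v (act \<Delta> ?v)"
      using ip_\<Delta>[OF HxH[OF v] HxH[OF v]] v by (simp add: act_eq \<Delta>_Ax)
    also have "\<dots> = hinner E (S ?v) (S ?v)" using Sp(3)[OF v SH[OF v]] S(2)[OF v] by simp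
    finally have a: "hinner E (\<phi> (star x) ?v) (\<phi> (star x) ?v) = hinner E (S ?v) (S ?v)" .
    have "hinner E (S ?v + \<epsilon> *\<^sub>R ?v) (S ?v + \<epsilon> *\<^sub>R ?v)
        = hinner E (S ?v) (S ?v) + ((\<epsilon> *\<^sub>R hinner E ?v (S ?v) + \<epsilon> *\<^sub>R hinner E ?v (S ?v)) + (\<epsilon> * \<epsilon>) *\<^sub>R hinner E ?v ?v)"
      using H Sp(3)[OF v v] by (simp add: X.ip_add X.ip_add_left X.ip_scaleR X.ip_scaleR_left algebra_simps)
    moreover have "pos (hinner E (S ?v) (S ?v))" "pos ((\<epsilon> *\<^sub>R hinner E ?v (S ?v) + \<epsilon> *\<^sub>R hinner E ?v (S ?v)) + (\<epsilon> * \<epsilon>) *\<^sub>R hinner E ?v ?v)"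
      using H Sp(2)[OF v] e by (auto intro!: X.ip_pos pos_add pos_scaleR)
    ultimately have "norm (hinner E (S ?v) (S ?v)) \<le> norm (hinner E z z)"
      using pos_norm_mono[of "hinner E (S ?v) (S ?v)"] R(2)[OF z] by simp
    then have "(norm (\<phi> (star x) ?v))\<^sup>2 \<le> (norm z)\<^sup>2"
      using norm_sq[OF cD(8)[OF x_mem(2) HxH[OF v]]] norm_sq[OF HxH[OF z]] a by simp
    then show ?thesis by (rule power2_le_imp_le) simp
  qed
  then show "z \<in> Hx \<Longrightarrow> norm (\<phi> (star x) (R \<epsilon> z)) \<le> norm z" .
  show "norm (R \<epsilon> (\<phi> x w)) \<le> norm w" if w: "w \<in> hcarrier E"
  proof -
    let ?z = "\<phi> x w"
    have z: "?z \<in> Hx" by (rule \<phi>x_Hx[OF w])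
    let ?v = "R \<epsilon> ?z"
    note v = R(1)[OF z]
    let ?y = "R \<epsilon> ?v"
    note y = R(1)[OF v]
    have "hinner E ?v (S ?y + \<epsilon> *\<^sub>R ?y) = hinner E (S ?v + \<epsilon> *\<^sub>R ?v) ?y"
      using v y SH Sp(3)[OF v y] by (simp add: X.ip_add X.ip_add_left X.ip_scaleR X.ip_scaleR_left)
    then have "hinner E ?v ?v = hinner E ?z ?y" using R(2)[OF z] R(2)[OF v] by simp
    also have "\<dots> = hinner E w (\<phi> (star x) ?y)" by (rule cD(7)[OF x_mem(1) w HxH[OF y]])
    finally have "(norm ?v)\<^sup>2 \<le> norm w * norm (\<phi> (star x) ?y)"
      using norm_sq[OF HxH[OF v]] ip_le[OF w cD(8)[OF x_mem(2) HxH[OF y]]] by simp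
    also have "\<dots> \<le> norm w * norm ?v" using 1[OF v] by (intro mult_left_mono) simp_all
    finally have "norm ?v * norm ?v \<le> norm w * norm ?v" by (simp add: power2_eq_square)
    then show ?thesis by (cases "norm ?v = 0") (simp_all add: mult_le_cancel_right)
  qed
qed

lemma Dx_sv: "single_valued Dx"
  using Dx_unbounded unfolding unbounded_op_def by blast

lemmas appDx = clinear_on_app[OF Dx_csub Dx_sv]

text \<open>
  Put \<open>e = x* (a + \<mu>) x\<close>, an element of the dense subalgebra. On the core, \<open>x* (a + \<mu>) \<Delta> = e x*\<close> and
  \<open>x e = \<Delta> (a + \<mu>) x\<close>, so that
  \<open>x D x* (a + \<mu>) \<Delta> - \<Delta> (a + \<mu>) x D x* = x [D, e] x*\<close>.
\<close>

lemma twisted_commutator: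
  assumes a: "a \<in> \<A> \<inter> Ax"
  shows "(\<forall>u\<in>Domain Dx. act a (act \<Delta> u) + \<mu> *\<^sub>C act \<Delta> u \<in> Domain Dx) \<and>
    (\<exists>d. adjointable Eloc d \<and>
       (\<forall>u\<in>Domain Dx. d u = app Dx (act a (act \<Delta> u) + \<mu> *\<^sub>C act \<Delta> u) - act \<Delta> (act a (app Dx u) + \<mu> *\<^sub>C app Dx u)) \<and>
       bdd_above ((\<lambda>\<epsilon>. op_norm Eloc (\<lambda>u. resolvent_op Eloc (sqrt_op Eloc (act \<Delta>)) \<epsilon>
          (d (resolvent_op Eloc (sqrt_op Eloc (act \<Delta>)) \<epsilon> u)))) ` {0<..}))"
proof -
  have a\<A>: "a \<in> \<A>" and aAx: "a \<in> Ax" and aA: "a \<in> A" using a \<A>A by auto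
  define e where "e = star x * a * x + \<mu> *\<^sub>C (star x * x)"
  have e\<A>: "e \<in> \<A>" unfolding e_def by (intro \<A>D(3-5) a\<A> x\<A> x_mem(3))
  have eA: "e \<in> A" "star e \<in> \<A>" by (rule subsetD[OF \<A>A e\<A>], rule \<A>D(2)[OF e\<A>])
  define d where "d u = \<phi> x (comm_ext e (\<phi> (star x) u))" for u
  have d_op: "bounded_op E d"
    unfolding d_def[abs_def] by (rule bounded_op_comp[OF cD(3)[OF x_mem(1)] bounded_op_comp[OF comm_ext_bounded_op[OF e\<A>] cD(3)[OF x_mem(2)]]])
  have sxH: "\<phi> (star x) u \<in> hcarrier E" if "u \<in> hcarrier E" for u by (rule cD(8)[OF x_mem(2) that])
  have dH: "d u \<in> Hx" if "u \<in> hcarrier E" for u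
    unfolding d_def by (rule \<phi>x_Hx[OF comm_ext_mem[OF e\<A> sxH[OF that]]])
  have e_eq: "\<phi> e u = \<phi> (star x) (\<phi> a (\<phi> x u) + \<mu> *\<^sub>C \<phi> x u)" if u: "u \<in> hcarrier E" for u
  proof -
    have m: "star x * a \<in> A" "star x * a * x \<in> A" "star x * x \<in> A" "\<mu> *\<^sub>C (star x * x) \<in> A" using x_mem aA AD by auto
    have "\<phi> e u = \<phi> (star x) (\<phi> a (\<phi> x u)) + \<mu> *\<^sub>C \<phi> (star x) (\<phi> x u)"
      unfolding e_def cD(4)[OF m(2,4) u] cD(6)[OF m(3) u] cD(5)[OF m(1) x_mem(1) u] cD(5)[OF x_mem(2) x_mem(1) u]
        cD(5)[OF x_mem(2) aA cD(8)[OF x_mem(1) u]] ..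
    also have "\<dots> = \<phi> (star x) (\<phi> a (\<phi> x u) + \<mu> *\<^sub>C \<phi> x u)"
      using clinear_onD(1,2)[OF cD(10)[OF x_mem(2)]] cD(8) x_mem aA u by simp
    finally show ?thesis .
  qed
  define Y where "Y u = \<phi> a (\<phi> \<Delta> u) + \<mu> *\<^sub>C \<phi> \<Delta> u" for u
  define Z where "Z w = \<phi> \<Delta> (\<phi> a w + \<mu> *\<^sub>C w)" for w
  have YZ_op: "bounded_on (hcarrier E) Y" "bounded_on (hcarrier E) Z"
  proof -
    have "bounded_on (hcarrier E) (\<lambda>u. \<phi> a u + \<mu> *\<^sub>C u)"
    proof -
      obtain C where C: "\<And>u. u \<in> hcarrier E \<Longrightarrow> norm (\<phi> a u) \<le> C * norm u" using bounded_onD(3)[OF cD(9)[OF aA]] by auto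
      have "norm (\<phi> a u + \<mu> *\<^sub>C u) \<le> (C + cmod \<mu>) * norm u" if "u \<in> hcarrier E" for u
        using C[OF that] norm_triangle_ineq[of "\<phi> a u" "\<mu> *\<^sub>C u"] by (simp add: norm_scaleC distrib_right)
      then show ?thesis using clinear_onD(1,2)[OF cD(10)[OF aA]] cD(8)[OF aA]
        unfolding bounded_on_def clinear_on_def
        by (intro conjI exI[of _ "C + cmod \<mu>"]) (simp_all add: scaleC_add_right scaleC_scaleC mult.commute Pi_iff)
    qed
    from bounded_on_comp[OF this cD(9)[OF \<Delta>A]] bounded_on_comp[OF cD(9)[OF \<Delta>A] this]
    show "bounded_on (hcarrier E) Y" "bounded_on (hcarrier E) Z" by (simp_all add: Y_def[abs_def] Z_def[abs_def])
  qed
  have core_graph: "(Y u, Z w + d u) \<in> core_graph" if uw: "(u, w) \<in> core_graph" for u w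
  proof -
    obtain v where v: "u \<in> Domain D" "u \<in> Hx" "(\<phi> (star x) u, v) \<in> D" "w = \<phi> x v" using uw by (rule core_graphE)
    note uH = HxH[OF v(2)] and vH = D_mem(2)[OF v(3)]
    have "\<phi> \<Delta> u \<in> Domain D" by (rule \<phi>_Dom[OF \<A>D(5)[OF x\<A> x_mem(3)] v(1)])
    then have 1: "Y u \<in> Domain D"
      unfolding Y_def by (intro csubspaceD(2,3)[OF appD(2)] \<phi>_Dom[OF a\<A>])
    have \<Delta>u: "\<phi> \<Delta> u \<in> Hx" by (rule \<phi>_Ax_Hx[OF \<Delta>_Ax uH])
    have 2: "Y u \<in> Hx" unfolding Y_def using \<phi>_Ax_Hx[OF aAx HxH[OF \<Delta>u]] \<Delta>u by simp
    have "\<phi> (star x) (Y u) = \<phi> e (\<phi> (star x) u)"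
      unfolding Y_def e_eq[OF sxH[OF uH]] \<Delta>_eq[OF uH] ..
    then have 3: "(\<phi> (star x) (Y u), \<phi> e v + comm_ext e (\<phi> (star x) u)) \<in> D" using comm_ext_D[OF e\<A> v(3)] by simp
    have wH: "w \<in> hcarrier E" unfolding v(4) by (rule cD(8)[OF x_mem(1) vH])
    have "\<phi> x (\<phi> e v) = Z w"
      unfolding e_eq[OF vH] Z_def v(4)[symmetric] using wH cD(8)[OF aA wH] by (simp add: \<Delta>_eq)
    then have "\<phi> x (\<phi> e v + comm_ext e (\<phi> (star x) u)) = Z w + d u"
      using clinear_onD(1)[OF cD(10)[OF x_mem(1)] cD(8)[OF eA(1) vH] comm_ext_mem[OF e\<A> sxH[OF uH]]] by (simp add: d_def)
    then show ?thesis using core_graphI[OF 1 2 3] by simp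
  qed
  have YD: "(Y u, Z w + d u) \<in> Dx" if uw: "(u, w) \<in> Dx" for u w
  proof -
    obtain s where s: "\<And>n. s n \<in> core_graph" "s \<longlonglongrightarrow> (u, w)" using uw unfolding Dx_eq closure_sequential by blast
    have "fst (s n) \<in> Hx" "snd (s n) \<in> Hx" for n using s(1)[of n] core_graph_sub by auto
    then have sH: "fst (s n) \<in> hcarrier E" "snd (s n) \<in> hcarrier E" for n by (simp_all only: HxH)
    have lim: "(\<lambda>n. fst (s n)) \<longlonglongrightarrow> u" "(\<lambda>n. snd (s n)) \<longlonglongrightarrow> w"
      using tendsto_fst[OF s(2)] tendsto_snd[OF s(2)] by simp_all
    have "(\<lambda>n. (Y (fst (s n)), Z (snd (s n)) + d (fst (s n)))) \<longlonglongrightarrow> (Y u, Z w + d u)"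
      by (intro tendsto_Pair tendsto_add bounded_on_tendsto[OF YZ_op(1) csub] bounded_on_tendsto[OF YZ_op(2) csub]
          bounded_on_tendsto[OF bounded_op_bounded_on[OF d_op] csub] sH lim HxH Dx_mem[OF uw])
    moreover have "(Y (fst (s n)), Z (snd (s n)) + d (fst (s n))) \<in> core_graph" for n
      using core_graph[of "fst (s n)" "snd (s n)"] s(1)[of n] by simp
    ultimately show ?thesis unfolding Dx_eq closure_sequential
      by (intro exI[of _ "\<lambda>n. (Y (fst (s n)), Z (snd (s n)) + d (fst (s n)))"] conjI allI)
  qed
  have Y_act: "act a (act \<Delta> u) + \<mu> *\<^sub>C act \<Delta> u = Y u" if u: "u \<in> Hx" for u
    using u act_mem[OF \<Delta>_Ax u] by (simp add: Y_def act_eq aAx \<Delta>_Ax)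
  have Z_act: "act \<Delta> (act a w + \<mu> *\<^sub>C w) = Z w" if w: "w \<in> Hx" for w
    using w act_mem[OF aAx w] by (simp add: Z_def act_eq aAx \<Delta>_Ax)
  show ?thesis
  proof (intro conjI exI[of _ d] ballI)
    fix u assume u: "u \<in> Domain Dx"
    have uw: "(u, app Dx u) \<in> Dx" by (rule appDx(4)[OF u])
    note H = Dx_mem[OF uw]
    show "act a (act \<Delta> u) + \<mu> *\<^sub>C act \<Delta> u \<in> Domain Dx" unfolding Y_act[OF H(1)] by (rule DomainI[OF YD[OF uw]])
    show "d u = app Dx (act a (act \<Delta> u) + \<mu> *\<^sub>C act \<Delta> u) - act \<Delta> (act a (app Dx u) + \<mu> *\<^sub>C app Dx u)"
      unfolding Y_act[OF H(1)] Z_act[OF H(2)] appDx(3)[OF YD[OF uw]] by simp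
  next
    let ?S = "\<lambda>v. - \<phi> x (comm_ext (star e) (\<phi> (star x) v))"
    show "adjointable Eloc d"
    proof (rule adjointable_Eloc[OF d_op _ refl, where S = ?S])
      show "d u \<in> Hx" if "u \<in> Hx" for u by (rule dH[OF HxH[OF that]])
      show "?S v \<in> Hx" if "v \<in> Hx" for v by (rule X.mem(5)[OF \<phi>x_Hx[OF comm_ext_mem[OF eA(2) sxH[OF HxH[OF that]]]]])
      fix u v assume uv: "u \<in> Hx" "v \<in> Hx"
      note H = sxH[OF HxH[OF uv(1)]] sxH[OF HxH[OF uv(2)]]
      have "hinner E (d u) v = hinner E (comm_ext e (\<phi> (star x) u)) (\<phi> (star x) v)"
        unfolding d_def by (rule cD(7)[OF x_mem(1) comm_ext_mem[OF e\<A> H(1)] HxH[OF uv(2)]])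
      also have "\<dots> = - hinner E (\<phi> (star x) u) (comm_ext (star e) (\<phi> (star x) v))" by (rule comm_ext_adj[OF e\<A> H])
      also have "\<dots> = - hinner E u (\<phi> x (comm_ext (star e) (\<phi> (star x) v)))"
        using cD(7)[OF x_mem(2) HxH[OF uv(1)] comm_ext_mem[OF eA(2) H(2)]] by (simp add: star_star)
      also have "\<dots> = hinner E u (?S v)"
        by (rule ip_minus[OF HxH[OF uv(1)] cD(8)[OF x_mem(1) comm_ext_mem[OF eA(2) H(2)]], symmetric])
      finally show "hinner E (d u) v = hinner E u (?S v)" .
    qed
    let ?R = "resolvent_op Eloc (sqrt_op Eloc (act \<Delta>))"
    obtain C where C: "0 \<le> C" "\<And>u. u \<in> hcarrier E \<Longrightarrow> norm (comm_ext e u) \<le> C * norm u"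
      using bounded_onD(3)[OF comm_ext_bounded[OF e\<A>]] by auto
    show "bdd_above ((\<lambda>\<epsilon>. op_norm Eloc (\<lambda>u. ?R \<epsilon> (d (?R \<epsilon> u)))) ` {0<..})"
    proof (rule bdd_aboveI2[where M = C])
      fix \<epsilon> :: real assume "\<epsilon> \<in> {0<..}"
      then have e0: "0 < \<epsilon>" by simp
      show "op_norm Eloc (\<lambda>u. ?R \<epsilon> (d (?R \<epsilon> u))) \<le> C"
      proof (rule op_norm_le)
        fix u assume "u \<in> hcarrier Eloc"
        then have u: "u \<in> Hx" by simp
        have H: "\<phi> (star x) (?R \<epsilon> u) \<in> hcarrier E" by (rule sxH[OF HxH[OF resolvent_sqrt_mem[OF e0 u]]])
        have "norm (?R \<epsilon> (d (?R \<epsilon> u))) \<le> norm (comm_ext e (\<phi> (star x) (?R \<epsilon> u)))"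
          unfolding d_def by (rule resolvent_x_le[OF e0 comm_ext_mem[OF e\<A> H]])
        also have "\<dots> \<le> C * norm (\<phi> (star x) (?R \<epsilon> u))" by (rule C(2)[OF H])
        also have "\<dots> \<le> C * norm u" by (intro mult_left_mono star_x_resolvent_le[OF e0 u] C(1))
        finally show "norm (?R \<epsilon> (d (?R \<epsilon> u))) \<le> C * norm u" .
      qed (use C(1) in simp_all)
    qed
  qed
qed

text \<open>
  The grading commutes with \<open>x\<close>, hence preserves \<open>E\<^sub>x\<close>, and it anticommutes with \<open>x D x*\<close>; closures inherit this.
\<close>

lemma grading_Eloc:
  assumes g: "grading_op A E \<phi> D \<gamma>"
  shows "grading_op Ax Eloc act Dx (restrict \<gamma> Hx)"
proof -
  have \<gamma>sa: "selfadjoint_op E \<gamma>" and \<gamma>\<gamma>: "\<And>u. u \<in> hcarrier E \<Longrightarrow> \<gamma> (\<gamma> u) = u"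
    and \<gamma>\<phi>: "\<And>a u. a \<in> A \<Longrightarrow> u \<in> hcarrier E \<Longrightarrow> \<phi> a (\<gamma> u) = \<gamma> (\<phi> a u)"
    and \<gamma>D: "op_graph E \<gamma> O D = D O op_graph E (\<lambda>u. - \<gamma> u)"
    using g unfolding grading_op_def by blast+
  have \<gamma>op: "bounded_op E \<gamma>" and \<gamma>adj: "\<And>u v. u \<in> hcarrier E \<Longrightarrow> v \<in> hcarrier E \<Longrightarrow> hinner E (\<gamma> u) v = hinner E u (\<gamma> v)"
    using \<gamma>sa unfolding selfadjoint_op_def adjointable_def by blast+
  note \<gamma>b = bounded_op_bounded_on[OF \<gamma>op]
  note \<gamma>H = bounded_onD(1)[OF \<gamma>b]
  have \<gamma>Hx: "\<gamma> u \<in> Hx" if u: "u \<in> Hx" for u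
  proof -
    obtain s where s: "\<And>n. s n \<in> \<phi> x ` hcarrier E" "s \<longlonglongrightarrow> u" using u unfolding closure_sequential by blast
    have sH: "s n \<in> hcarrier E" for n using s(1)[of n] cD(8)[OF x_mem(1)] by auto
    have "\<gamma> (s n) \<in> \<phi> x ` hcarrier E" for n
    proof -
      obtain w where w: "w \<in> hcarrier E" "s n = \<phi> x w" using s(1)[of n] by blast
      then show ?thesis using \<gamma>\<phi>[OF x_mem(1) w(1)] \<gamma>H[OF w(1)] by (metis imageI)
    qed
    then show ?thesis unfolding closure_sequential
      by (intro exI[of _ "\<lambda>n. \<gamma> (s n)"] conjI allI bounded_on_tendsto[OF \<gamma>b csub sH HxH[OF u] s(2)])
  qed
  have gD: "(\<gamma> u, - \<gamma> w) \<in> D" if uw: "(u, w) \<in> D" for u w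
  proof -
    have "(u, - \<gamma> w) \<in> D O op_graph E (\<lambda>u. - \<gamma> u)" using uw D_mem(2)[OF uw] by (auto simp: op_graph_def)
    then show ?thesis unfolding \<gamma>D[symmetric] by (auto simp: op_graph_def)
  qed
  have gcore: "(\<gamma> u, - \<gamma> z) \<in> core_graph" if uz: "(u, z) \<in> core_graph" for u z
  proof -
    obtain v where v: "u \<in> Domain D" "u \<in> Hx" "(\<phi> (star x) u, v) \<in> D" "z = \<phi> x v" using uz by (rule core_graphE)
    note vH = D_mem(2)[OF v(3)]
    obtain w where "(u, w) \<in> D" using v(1) by blast
    then have 1: "\<gamma> u \<in> Domain D" using gD by blast
    have 2: "(\<phi> (star x) (\<gamma> u), - \<gamma> v) \<in> D" using gD[OF v(3)] \<gamma>\<phi>[OF x_mem(2) HxH[OF v(2)]] by simp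
    have "\<phi> x (- \<gamma> v) = - \<gamma> z"
      using clinear_onD(4)[OF cD(10)[OF x_mem(1)] \<gamma>H[OF vH]] \<gamma>\<phi>[OF x_mem(1) vH] v(4) by simp
    then show ?thesis using core_graphI[OF 1 \<gamma>Hx[OF v(2)] 2] by simp
  qed
  have gDx: "(\<gamma> u, - \<gamma> w) \<in> Dx" if uw: "(u, w) \<in> Dx" for u w
  proof -
    obtain s where s: "\<And>n. s n \<in> core_graph" "s \<longlonglongrightarrow> (u, w)" using uw unfolding Dx_eq closure_sequential by blast
    have "fst (s n) \<in> Hx" "snd (s n) \<in> Hx" for n using s(1)[of n] core_graph_sub by auto
    then have sH: "fst (s n) \<in> hcarrier E" "snd (s n) \<in> hcarrier E" for n by (simp_all only: HxH)
    have lim: "(\<lambda>n. fst (s n)) \<longlonglongrightarrow> u" "(\<lambda>n. snd (s n)) \<longlonglongrightarrow> w"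
      using tendsto_fst[OF s(2)] tendsto_snd[OF s(2)] by simp_all
    have "(\<lambda>n. (\<gamma> (fst (s n)), - \<gamma> (snd (s n)))) \<longlonglongrightarrow> (\<gamma> u, - \<gamma> w)"
      by (intro tendsto_Pair tendsto_minus bounded_on_tendsto[OF \<gamma>b csub] sH lim HxH Dx_mem[OF uw])
    moreover have "(\<gamma> (fst (s n)), - \<gamma> (snd (s n))) \<in> core_graph" for n
      using gcore[of "fst (s n)" "snd (s n)"] s(1)[of n] by simp
    ultimately show ?thesis unfolding Dx_eq closure_sequential
      by (intro exI[of _ "\<lambda>n. (\<gamma> (fst (s n)), - \<gamma> (snd (s n)))"] conjI allI)
  qed
  let ?g = "restrict \<gamma> Hx"
  show ?thesis unfolding grading_op_def selfadjoint_op_def Eloc_simps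
  proof (intro conjI ballI)
    show "adjointable Eloc ?g"
      by (rule adjointable_Eloc[OF \<gamma>op \<gamma>Hx _ \<gamma>Hx]) (simp_all add: \<gamma>adj[OF HxH HxH])
    fix u assume u: "u \<in> Hx"
    show "hinner E (?g u) v = hinner E u (?g v)" if v: "v \<in> Hx" for v
      using u v \<gamma>adj[OF HxH[OF u] HxH[OF v]] by simp
    show "?g (?g u) = u" using u \<gamma>Hx[OF u] \<gamma>\<gamma>[OF HxH[OF u]] by simp
  next
    fix a u assume au: "a \<in> Ax" "u \<in> Hx"
    show "act a (?g u) = ?g (act a u)"
      using au(2) \<phi>_Ax_Hx[OF au(1) HxH[OF au(2)]] \<gamma>\<phi>[OF Ax_mem[OF au(1)] HxH[OF au(2)]]
      unfolding act_eq[OF au] by (simp add: act_eq[OF au(1) \<gamma>Hx[OF au(2)]])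
  next
    show "op_graph Eloc ?g O Dx = Dx O op_graph Eloc (\<lambda>u. - ?g u)"
    proof (intro set_eqI iffI; clarify)
      fix u y v assume "(u, y) \<in> op_graph Eloc ?g" and yv: "(y, v) \<in> Dx"
      then have u: "u \<in> Hx" "y = \<gamma> u" by (auto simp: op_graph_def)
      note vH = Dx_mem(2)[OF yv]
      have "(u, - \<gamma> v) \<in> Dx" using gDx[OF yv] u \<gamma>\<gamma>[OF HxH[OF u(1)]] by simp
      moreover have "(- \<gamma> v, v) \<in> op_graph Eloc (\<lambda>u. - ?g u)"
        using \<gamma>Hx[OF vH] clinear_onD(4)[OF bounded_onD(2)[OF \<gamma>b] \<gamma>H[OF HxH[OF vH]]] \<gamma>\<gamma>[OF HxH[OF vH]]
        by (simp add: op_graph_def)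
      ultimately show "(u, v) \<in> Dx O op_graph Eloc (\<lambda>u. - ?g u)" by blast
    next
      fix u w v assume uw: "(u, w) \<in> Dx" and "(w, v) \<in> op_graph Eloc (\<lambda>u. - ?g u)"
      then have v: "v = - \<gamma> w" by (auto simp: op_graph_def)
      have "(u, \<gamma> u) \<in> op_graph Eloc ?g" using Dx_mem(1)[OF uw] by (simp add: op_graph_def)
      then show "(u, v) \<in> op_graph Eloc ?g O Dx" using gDx[OF uw] v by blast
    qed
  qed
qed

lemma parity_Eloc: "parity_ok Ax Eloc act Dx (map_option (\<lambda>\<gamma>. restrict \<gamma> Hx) g)"
  using chainD(10) grading_Eloc by (cases g) (simp_all add: parity_ok_def)

end

theorem theorem13:
  fixes A :: "'a::cstar_algebra set" and \<A> :: "'a set"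
    and E :: "('e::complex_normed_vector, 'b::cstar_algebra) module_data"
    and \<phi> :: "'a \<Rightarrow> 'e \<Rightarrow> 'e" and D :: "('e \<times> 'e) set"
    and g :: "('e \<Rightarrow> 'e) option" and x :: 'a
  assumes "sigma_unital A" and "sigma_unital (UNIV :: 'b set)"
    and "half_closed_chain A \<A> E \<phi> D g"
    and "x \<in> \<A>"
  shows "unbounded_modular_cycle (loc_algebra A x) (\<A> \<inter> loc_algebra A x)
    (loc_module E \<phi> x) (loc_action A E \<phi> x) (loc_operator E \<phi> D x)
    (loc_action A E \<phi> x (x * star x))
    (map_option (\<lambda>\<gamma>. restrict \<gamma> (hcarrier (loc_module E \<phi> x))) g)"
proof -
  interpret localization A \<A> E \<phi> D g x
    using assms by unfold_locales
  show ?thesis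
    unfolding unbounded_modular_cycle_def Eloc_simps
    by (intro conjI ballI allI cstar_Ax dense_Ax correspondence_Eloc countably_generated_Eloc
        Dx_regular Dx_selfadjoint_unbounded positive_\<Delta> \<Delta>_dense compact_resolvent
        approximate_unit parity_Eloc conjunct1[OF twisted_commutator, rule_format]
        conjunct2[OF twisted_commutator])
qed

end
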